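(* Let $K$ be an infinite field, $S=K[x_1,\dots,x_n]$ the standard graded polynomial ring, and $I\subset S$ a homogeneous ideal generated by elements of a single degree $d$. Then $I$ has linear powers if and only if $\operatorname{reg}_{(1,0)}\operatorname{Rees}(I)=0$.
   Context: $I$ has linear powers if all its powers have a linear resolution, i.e. all minimal generators of $I$ have the same degree $d$ and the Castelnuovo-Mumford regularity satisfies $\operatorname{reg}(I^k)=kd$ for all integers $k\ge 1$ (the zero ideal is regarded as trivially having linear powers). The Rees algebra $\operatorname{Rees}(I)=\bigoplus_{j\ge0}I^j$ is $\mathbb Z^2$-graded by $\operatorname{Rees}(I)_{(i,j)}=(I^j)_{jd+i}$. Let $m$ be the minimal number of generators of $I$ and $A=S[y_1,\dots,y_m]=K[x_1,\dots,x_n,y_1,\dots,y_m]$, bigraded by $\deg x_i=(1,0)$, $\deg y_j=(0,1)$. The bigraded surjection of $S$-algebras $A\to\operatorname{Rees}(I)$ sending the $y_j$ to minimal generators of $I$ (placed in the component $I^1$) makes $\operatorname{Rees}(I)$ a bigraded $A$-module. For a bigraded $A$-module $M$, $\beta^A_{i,(a,b)}(M)$ denotes the Betti number of $M$ in homological position $i$ and degree $(a,b)$, and the $(1,0)$-regularity is $\operatorname{reg}_{(1,0)}(M)=\sup\{a-i:\beta^A_{i,(a,b)}(M)\neq0\text{ for some }b\}$. *)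

theory Defs
  imports
    "HOL-Library.Poly_Mapping"
    "HOL-Library.Product_Plus"
    "HOL-Library.Extended_Real"
    "HOL-Algebra.Ideal_Product"
    "HOL-Algebra.Module"
begin

section \<open>Polynomial rings and gradings\<close>

type_synonym ('v, 'k) mpoly = "('v \<Rightarrow>\<^sub>0 nat) \<Rightarrow>\<^sub>0 'k"

text \<open>The polynomial ring over the field \<^typ>\<open>'k\<close> in the variables from the set \<open>V\<close>.
  The multiplication of \<^type>\<open>poly_mapping\<close> is convolution.\<close>

definition poly_ring :: "'v set \<Rightarrow> ('v, 'k::field) mpoly ring" where
  "poly_ring V = \<lparr> carrier = {p. \<forall>t\<in>Poly_Mapping.keys p. Poly_Mapping.keys t \<subseteq> V},
     mult = (*), one = 1, zero = 0, add = (+) \<rparr>"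

text \<open>The degree of a monomial when the variable \<open>v\<close> has degree \<open>w v\<close>; the inner sum is
  the natural multiple of \<open>w v\<close> by the exponent of \<open>v\<close>.\<close>

definition mdeg :: "('v \<Rightarrow> 'g::ab_group_add) \<Rightarrow> ('v \<Rightarrow>\<^sub>0 nat) \<Rightarrow> 'g" where
  "mdeg w t = (\<Sum>v\<in>Poly_Mapping.keys t. \<Sum>j<Poly_Mapping.lookup t v. w v)"

definition forms :: "'v set \<Rightarrow> ('v \<Rightarrow> 'g::ab_group_add) \<Rightarrow> 'g \<Rightarrow> ('v, 'k::field) mpoly set" where
  "forms V w g = {p \<in> carrier (poly_ring V). \<forall>t\<in>Poly_Mapping.keys p. mdeg w t = g}"

text \<open>The standard graded ring \<open>S = K[x\<^sub>0, \<dots>, x\<^sub>n\<^sub>-\<^sub>1]\<close>, and the bigraded ring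
  \<open>A = S[y\<^sub>0, \<dots>, y\<^sub>m\<^sub>-\<^sub>1]\<close>, where \<open>Inl i\<close> stands for \<open>x\<^sub>i\<close> and \<open>Inr j\<close> for \<open>y\<^sub>j\<close>.\<close>

abbreviation S_vars :: "nat \<Rightarrow> nat set" where
  "S_vars n \<equiv> {..<n}"

abbreviation S_wt :: "nat \<Rightarrow> int" where
  "S_wt \<equiv> (\<lambda>_. 1)"

abbreviation S_ring :: "nat \<Rightarrow> (nat, 'k::field) mpoly ring" where
  "S_ring n \<equiv> poly_ring (S_vars n)"

abbreviation A_vars :: "nat \<Rightarrow> nat \<Rightarrow> (nat + nat) set" where
  "A_vars n m \<equiv> {..<n} <+> {..<m}"

abbreviation A_wt :: "nat + nat \<Rightarrow> int \<times> int" where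
  "A_wt \<equiv> case_sum (\<lambda>_. (1, 0)) (\<lambda>_. (0, 1))"


section \<open>Graded modules, minimal free resolutions and Betti numbers\<close>

text \<open>As in HOL-Algebra, the fields \<open>mult\<close> and \<open>one\<close> inherited from the ring record are
  irrelevant for a module.\<close>

record ('a, 'm, 'g) graded_module = "('a, 'm) module" +
  homog_part :: "'g \<Rightarrow> 'm set"

text \<open>Homomorphisms of degree zero.\<close>

definition graded_hom ::
  "('a, 'c) ring_scheme \<Rightarrow> ('a, 'm, 'g) graded_module \<Rightarrow> ('a, 'n, 'g) graded_module \<Rightarrow> ('m \<Rightarrow> 'n) \<Rightarrow> bool"
  where
  "graded_hom R M N f \<longleftrightarrow>
     (\<forall>x\<in>carrier M. f x \<in> carrier N) \<and>
     (\<forall>x\<in>carrier M. \<forall>y\<in>carrier M. f (x \<oplus>\<^bsub>M\<^esub> y) = f x \<oplus>\<^bsub>N\<^esub> f y) \<and>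
     (\<forall>a\<in>carrier R. \<forall>x\<in>carrier M. f (a \<odot>\<^bsub>M\<^esub> x) = a \<odot>\<^bsub>N\<^esub> f x) \<and>
     (\<forall>g. \<forall>x\<in>homog_part M g. f x \<in> homog_part N g)"

text \<open>The free module \<open>R(-s\<^sub>0) \<oplus> \<dots> \<oplus> R(-s\<^sub>r\<^sub>-\<^sub>1)\<close> over \<open>R = poly_ring V\<close>; its elements are
  sequences vanishing from position \<open>r\<close> on, and the \<open>k\<close>-th basis vector has degree \<open>s k\<close>.\<close>

definition free_module ::
  "'v set \<Rightarrow> ('v \<Rightarrow> 'g::ab_group_add) \<Rightarrow> nat \<Rightarrow> (nat \<Rightarrow> 'g) \<Rightarrow>
   (('v, 'k::field) mpoly, nat \<Rightarrow> ('v, 'k) mpoly, 'g) graded_module" where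
  "free_module V w r s = \<lparr>
     carrier = {u. (\<forall>k<r. u k \<in> carrier (poly_ring V)) \<and> (\<forall>k\<ge>r. u k = 0)},
     mult = undefined, one = undefined,
     zero = (\<lambda>_. 0), add = (\<lambda>u v k. u k + v k), smult = (\<lambda>p u k. p * u k),
     homog_part = (\<lambda>g. {u. (\<forall>k<r. u k \<in> forms V w (g - s k)) \<and> (\<forall>k\<ge>r. u k = 0)}) \<rparr>"

text \<open>The data of a graded free resolution: the module in homological position \<open>i\<close> has rank
  \<open>res_rank F i\<close> and shifts \<open>res_shift F i\<close>; \<open>res_diff F i\<close> maps position \<open>i + 1\<close> to
  position \<open>i\<close>, and \<open>res_aug F\<close> maps position \<open>0\<close> to the resolved module.\<close>

record ('a, 'm, 'g) free_res =
  res_rank :: "nat \<Rightarrow> nat"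
  res_shift :: "nat \<Rightarrow> nat \<Rightarrow> 'g"
  res_diff :: "nat \<Rightarrow> (nat \<Rightarrow> 'a) \<Rightarrow> nat \<Rightarrow> 'a"
  res_aug :: "(nat \<Rightarrow> 'a) \<Rightarrow> 'm"

definition res_module ::
  "'v set \<Rightarrow> ('v \<Rightarrow> 'g::ab_group_add) \<Rightarrow> (('v, 'k::field) mpoly, 'm, 'g) free_res \<Rightarrow> nat \<Rightarrow>
   (('v, 'k) mpoly, nat \<Rightarrow> ('v, 'k) mpoly, 'g) graded_module" where
  "res_module V w F i = free_module V w (res_rank F i) (res_shift F i)"

text \<open>The last condition is minimality: the differentials are zero modulo the ideal generated
  by the variables, which consists of the polynomials without constant term.\<close>

definition minimal_free_resolution ::
  "'v set \<Rightarrow> ('v \<Rightarrow> 'g::ab_group_add) \<Rightarrow> (('v, 'k::field) mpoly, 'm, 'g) graded_module \<Rightarrow>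
   (('v, 'k) mpoly, 'm, 'g) free_res \<Rightarrow> bool" where
  "minimal_free_resolution V w M F \<longleftrightarrow>
     graded_hom (poly_ring V) (res_module V w F 0) M (res_aug F) \<and>
     (\<forall>i. graded_hom (poly_ring V) (res_module V w F (Suc i)) (res_module V w F i) (res_diff F i)) \<and>
     res_aug F ` carrier (res_module V w F 0) = carrier M \<and>
     a_kernel (res_module V w F 0) M (res_aug F)
       = res_diff F 0 ` carrier (res_module V w F 1) \<and>
     (\<forall>i. a_kernel (res_module V w F (Suc i)) (res_module V w F i) (res_diff F i)
       = res_diff F (Suc i) ` carrier (res_module V w F (Suc (Suc i)))) \<and>
     (\<forall>i. \<forall>u\<in>carrier (res_module V w F (Suc i)). \<forall>k. Poly_Mapping.lookup (res_diff F i u k) 0 = 0)"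

text \<open>For a finitely generated graded module a minimal graded free resolution exists and is
  unique up to isomorphism, so that the choice is immaterial.\<close>

definition betti ::
  "'v set \<Rightarrow> ('v \<Rightarrow> 'g::ab_group_add) \<Rightarrow> (('v, 'k::field) mpoly, 'm, 'g) graded_module \<Rightarrow>
   nat \<Rightarrow> 'g \<Rightarrow> nat" where
  "betti V w M i g =
     (let F = (SOME F. minimal_free_resolution V w M F)
      in card {k. k < res_rank F i \<and> res_shift F i k = g})"

text \<open>The suprema are taken in the extended reals; the regularity of the zero module is
  \<open>-\<infinity>\<close>.\<close>

definition cm_reg :: "nat \<Rightarrow> ((nat, 'k::field) mpoly, 'm, int) graded_module \<Rightarrow> ereal" where
  "cm_reg n M = Sup {ereal (of_int (a - int i)) | i a. betti (S_vars n) S_wt M i a \<noteq> 0}"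

definition reg_10 ::
  "nat \<Rightarrow> nat \<Rightarrow> ((nat + nat, 'k::field) mpoly, 'm, int \<times> int) graded_module \<Rightarrow> ereal" where
  "reg_10 n m M =
     Sup {ereal (of_int (a - int i)) | i a. \<exists>b. betti (A_vars n m) A_wt M i (a, b) \<noteq> 0}"


section \<open>Homogeneous ideals, their powers, and linear powers\<close>

definition homogeneous_ideal :: "nat \<Rightarrow> (nat, 'k::field) mpoly set \<Rightarrow> bool" where
  "homogeneous_ideal n I \<longleftrightarrow> ideal I (S_ring n) \<and>
     (\<exists>G. G \<subseteq> (\<Union>a. forms (S_vars n) S_wt a) \<and> I = Idl\<^bsub>S_ring n\<^esub> G)"

definition min_num_gens :: "('a, 'c) ring_scheme \<Rightarrow> 'a set \<Rightarrow> nat" where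
  "min_num_gens R I = (LEAST m. \<exists>G. G \<subseteq> carrier R \<and> finite G \<and> card G = m \<and> I = Idl\<^bsub>R\<^esub> G)"

text \<open>In the record \<^const>\<open>ideals_set\<close> the unit is the whole ring and the multiplication is the
  product of ideals.\<close>

abbreviation ideal_power :: "nat \<Rightarrow> (nat, 'k::field) mpoly set \<Rightarrow> nat \<Rightarrow> (nat, 'k) mpoly set" where
  "ideal_power n I j \<equiv> I [^]\<^bsub>ideals_set (S_ring n)\<^esub> j"

definition ideal_module ::
  "nat \<Rightarrow> (nat, 'k::field) mpoly set \<Rightarrow> ((nat, 'k) mpoly, (nat, 'k) mpoly, int) graded_module" where
  "ideal_module n J = \<lparr> carrier = J, mult = (*), one = 1, zero = 0, add = (+), smult = (*),
     homog_part = (\<lambda>a. J \<inter> forms (S_vars n) S_wt a) \<rparr>"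

definition min_homog_gens :: "nat \<Rightarrow> (nat, 'k::field) mpoly set \<Rightarrow> (nat, 'k) mpoly set \<Rightarrow> bool" where
  "min_homog_gens n I G \<longleftrightarrow>
     G \<subseteq> (\<Union>a. forms (S_vars n) S_wt a) \<and> I = Idl\<^bsub>S_ring n\<^esub> G \<and>
     (\<forall>H. H \<subset> G \<longrightarrow> I \<noteq> Idl\<^bsub>S_ring n\<^esub> H)"

definition linear_powers :: "nat \<Rightarrow> (nat, 'k::field) mpoly set \<Rightarrow> bool" where
  "linear_powers n I \<longleftrightarrow> I = {0} \<or>
     (\<exists>d::nat. (\<forall>G. min_homog_gens n I G \<longrightarrow> G \<subseteq> forms (S_vars n) S_wt (int d)) \<and>
        (\<forall>k\<ge>1. cm_reg n (ideal_module n (ideal_power n I k)) = ereal (of_nat (k * d))))"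


section \<open>The Rees algebra\<close>

text \<open>The Rees algebra is the subring of \<open>S[t]\<close> of all \<open>f\<close> whose coefficient of \<open>t\<^sup>j\<close> lies in
  \<open>I\<^sup>j\<close>. For a list \<open>fs\<close> of elements of \<open>I\<close>, the following is the homomorphism of \<open>S\<close>-algebras
  \<open>A \<rightarrow> S[t]\<close> sending \<open>y\<^sub>j\<close> to \<open>fs ! j\<close> in the component \<open>I\<^sup>1\<close>, that is, to \<open>(fs ! j) t\<close>.\<close>

definition rees_map ::
  "(nat, 'k::field) mpoly list \<Rightarrow> (nat + nat, 'k) mpoly \<Rightarrow> nat \<Rightarrow>\<^sub>0 (nat, 'k) mpoly" where
  "rees_map fs p = (\<Sum>t\<in>Poly_Mapping.keys p.
     Poly_Mapping.single 0 (Poly_Mapping.single 0 (Poly_Mapping.lookup p t)) *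
     (\<Prod>v\<in>Poly_Mapping.keys t.
        (case v of
           Inl i \<Rightarrow> Poly_Mapping.single 0 (Poly_Mapping.single (Poly_Mapping.single i 1) 1)
         | Inr j \<Rightarrow> Poly_Mapping.single 1 (fs ! j)) ^ Poly_Mapping.lookup t v))"

text \<open>The component of degree \<open>(a, b)\<close> is \<open>(I\<^sup>b)\<^bsub>bd+a\<^esub>\<close>, which is zero for negative \<open>b\<close>.\<close>

definition rees_module ::
  "nat \<Rightarrow> nat \<Rightarrow> (nat, 'k::field) mpoly set \<Rightarrow> (nat, 'k) mpoly list \<Rightarrow>
   ((nat + nat, 'k) mpoly, nat \<Rightarrow>\<^sub>0 (nat, 'k) mpoly, int \<times> int) graded_module" where
  "rees_module n d I fs = \<lparr>
     carrier = {f. \<forall>j. Poly_Mapping.lookup f j \<in> ideal_power n I j},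
     mult = (*), one = 1, zero = 0, add = (+), smult = (\<lambda>p f. rees_map fs p * f),
     homog_part = (\<lambda>(a, b). {f. (\<forall>j. Poly_Mapping.lookup f j \<in> ideal_power n I j) \<and>
       (\<forall>j\<in>Poly_Mapping.keys f. int j = b \<and>
          Poly_Mapping.lookup f j \<in> forms (S_vars n) S_wt (int j * int d + a))}) \<rparr>"

end

theory Submission
  imports Defs "HOL-Library.Function_Algebras" "HOL-Computational_Algebra.Primes"
begin

text \<open>Call the regularity of a graded \<open>S\<close>-module at most \<open>r\<close> if it is generated in degrees at most
  \<open>r\<close> and the syzygies of some (equivalently, any) such generators have regularity at most \<open>r + 1\<close>.
  This recursive notion, cut off after \<open>p\<close> steps, replaces \<open>Tor\<close>; in a minimal resolution it says
  that the shifts in position \<open>i\<close> are at most \<open>r + i\<close>.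

  For a bigraded \<open>A\<close>-module, the strand in a fixed \<open>y\<close>-degree of a bigraded free module is a free
  \<open>S\<close>-module of finite rank, with the multiples of the basis by \<open>y\<close>-monomials as its basis, which
  have the same \<open>x\<close>-degree. So if all shifts \<open>(a, b)\<close> in position \<open>i\<close> of the minimal resolution
  satisfy \<open>a \<le> i\<close>, then its strands bound the regularity of each strand of the module by \<open>0\<close>.
  Conversely, if all strands of the module have regularity at most \<open>0\<close>, then inductively those of
  its \<open>i\<close>-th syzygy module have regularity at most \<open>i\<close>; in particular they are generated in degrees
  at most \<open>i\<close>, and minimality forces \<open>a \<le> i\<close> in position \<open>i\<close>.

  The strand of the Rees algebra in \<open>y\<close>-degree \<open>j\<close> is \<open>I\<^sup>j\<close> with degrees shifted by \<open>j d\<close>. The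
  regularities are bounded below by \<open>0\<close> and \<open>j d\<close>, since the generators start in these degrees.
  As the Betti numbers are defined through a chosen minimal resolution, its existence is also
  needed; it rests on Hilbert's basis theorem for submodules of free modules.\<close>

section \<open>Graded modules, syzygies and bounded regularity\<close>

text \<open>A resolution is an infinite sequence with no last position to start from, so the passage
  from shifts to strands inducts on the cut-off \<open>p\<close>: the bound for \<open>p + 1\<close>
  steps of one syzygy module follows from that for \<open>p\<close> steps of the next, for all
  positions at once. The converse goes along the positions. There it matters that \<open>lin\<close>
  does not depend on the generators, since those coming from the resolution differ from those behind
  the assumed bound. This independence rests on one fact: a free summand with basis in degrees at
  most \<open>r\<close> can be added or split off without affecting the bound \<open>r\<close>.

  Most arguments use homogeneous pieces only, because a strand is the restriction of the family of
  pieces to a line of degrees. Carriers return when a resolution is translated into a chain of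
  generators and syzygies.

  Equality of the regularity with the expected value, rather than a mere upper bound, comes from the
  first generator of a minimal resolution: it is nonzero and so cannot lie below the initial degree.
  The zeroth power also occurs as a strand; it is \<open>S\<close> and always satisfies its
  bound.\<close>

abbreviation (input) lookup where "lookup \<equiv> Poly_Mapping.lookup"
abbreviation (input) keys where "keys \<equiv> Poly_Mapping.keys"
abbreviation (input) single where "single \<equiv> Poly_Mapping.single"

lemma sum_fun_apply: "(\<Sum>k\<in>A. f k) j = (\<Sum>k\<in>A. f k j)"
  by (induction A rule: infinite_finite_induct) auto

lemma sum_lessThan_add:
  fixes f :: "nat \<Rightarrow> 'a::comm_monoid_add"
  shows "(\<Sum>k<l+m. f k) = (\<Sum>k<l. f k) + (\<Sum>k<m. f (l + k))"
  by (induction m) (auto simp: add.assoc)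

definition vscale :: "'a::comm_ring_1 \<Rightarrow> (nat \<Rightarrow> 'a) \<Rightarrow> nat \<Rightarrow> 'a" where
  "vscale a u = (\<lambda>k. a * u k)"

lemma vscale_apply [simp]: "vscale a u k = a * u k"
  by (simp add: vscale_def)

lemma module_vscale: "Modules.module vscale"
  by unfold_locales (auto simp: vscale_def fun_eq_iff algebra_simps)

lemma sum_scale_unit:
  fixes k l :: nat
  assumes "Modules.module sc" "k < l"
  shows "(\<Sum>j<l. sc (if j = k then 1 else 0) (x j)) = x k"
proof -
  interpret Modules.module sc by fact
  have "(\<Sum>j<l. sc (if j = k then 1 else 0) (x j)) = (\<Sum>j<l. if j = k then x j else 0)"
    by (rule sum.cong) auto
  then show ?thesis using assms(2) by simp
qed

text \<open>The ring is seen only through its homogeneous pieces, and the degree group is left open: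
  it is the integers for \<open>S\<close> and for single strands, and pairs of integers for
  \<open>A\<close>.\<close>

locale graded_pieces =
  fixes Rg :: "'g::ab_group_add \<Rightarrow> 'a::comm_ring_1 set"
  assumes Rg_zero: "0 \<in> Rg g"
    and Rg_add: "a \<in> Rg g \<Longrightarrow> b \<in> Rg g \<Longrightarrow> a + b \<in> Rg g"
    and Rg_minus: "a \<in> Rg g \<Longrightarrow> - a \<in> Rg g"
    and Rg_mult: "a \<in> Rg g \<Longrightarrow> b \<in> Rg h \<Longrightarrow> a * b \<in> Rg (g + h)"
    and Rg_one: "1 \<in> Rg 0"
begin

lemma Rg_diff: "a \<in> Rg g \<Longrightarrow> b \<in> Rg g \<Longrightarrow> a - b \<in> Rg g"
  using Rg_add[of a g "- b"] Rg_minus by simp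

lemma Rg_sum: "(\<And>k. k \<in> A \<Longrightarrow> f k \<in> Rg g) \<Longrightarrow> sum f A \<in> Rg g"
  by (induction A rule: infinite_finite_induct) (auto simp: Rg_zero Rg_add)

lemma Rg_mult': "a \<in> Rg g \<Longrightarrow> b \<in> Rg h \<Longrightarrow> k = g + h \<Longrightarrow> a * b \<in> Rg k"
  using Rg_mult by simp

definition graded_sub :: "('a \<Rightarrow> 'm::ab_group_add \<Rightarrow> 'm) \<Rightarrow> ('g \<Rightarrow> 'm set) \<Rightarrow> bool" where
  "graded_sub sc H \<longleftrightarrow> Modules.module sc \<and> (\<forall>g. 0 \<in> H g \<and> (\<forall>x\<in>H g. \<forall>y\<in>H g. x + y \<in> H g) \<and>
     (\<forall>x\<in>H g. - x \<in> H g)) \<and> (\<forall>g h. \<forall>a\<in>Rg g. \<forall>x\<in>H h. sc a x \<in> H (g + h))"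

text \<open>Generators form a finite sequence in which zeros and repetitions are allowed, so two
  systems can be concatenated freely.\<close>

definition gen :: "('a \<Rightarrow> 'm::ab_group_add \<Rightarrow> 'm) \<Rightarrow> nat \<Rightarrow> (nat \<Rightarrow> 'g) \<Rightarrow> (nat \<Rightarrow> 'm) \<Rightarrow> ('g \<Rightarrow> 'm set) \<Rightarrow> bool"
  where "gen sc l s x H \<longleftrightarrow> (\<forall>k<l. x k \<in> H (s k)) \<and>
     (\<forall>g. \<forall>y\<in>H g. \<exists>c. (\<forall>k<l. c k \<in> Rg (g - s k)) \<and> y = (\<Sum>k<l. sc (c k) (x k)))"

text \<open>Coefficients vanish from position \<open>l\<close> on, so a relation is determined by
  its first \<open>l\<close> entries while all syzygy modules live in one type.\<close>

definition Syz :: "('a \<Rightarrow> 'm::ab_group_add \<Rightarrow> 'm) \<Rightarrow> nat \<Rightarrow> (nat \<Rightarrow> 'g) \<Rightarrow> (nat \<Rightarrow> 'm) \<Rightarrow> 'g \<Rightarrow> (nat \<Rightarrow> 'a) set"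
  where "Syz sc l s x g = {c. (\<forall>k<l. c k \<in> Rg (g - s k)) \<and> (\<forall>k\<ge>l. c k = 0) \<and> (\<Sum>k<l. sc (c k) (x k)) = 0}"

lemma graded_subD:
  assumes "graded_sub sc H"
  shows "Modules.module sc" "0 \<in> H g" "x \<in> H g \<Longrightarrow> y \<in> H g \<Longrightarrow> x + y \<in> H g"
    "x \<in> H g \<Longrightarrow> - x \<in> H g" "a \<in> Rg g \<Longrightarrow> x \<in> H h \<Longrightarrow> sc a x \<in> H (g + h)"
    "x \<in> H g \<Longrightarrow> y \<in> H g \<Longrightarrow> x - y \<in> H g"
proof -
  show d: "x \<in> H g \<Longrightarrow> y \<in> H g \<Longrightarrow> x + y \<in> H g" "x \<in> H g \<Longrightarrow> - x \<in> H g" for x y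
    using assms by (auto simp: graded_sub_def)
  show "x \<in> H g \<Longrightarrow> y \<in> H g \<Longrightarrow> x - y \<in> H g"
    using d(1)[of x "- y"] d(2)[of y] by simp
qed (use assms in \<open>auto simp: graded_sub_def\<close>)

lemma graded_sub_sum:
  assumes "graded_sub sc H" "\<And>k. k \<in> A \<Longrightarrow> f k \<in> H g"
  shows "sum f A \<in> H g"
  using assms(2) by (induction A rule: infinite_finite_induct) (auto simp: graded_subD[OF assms(1)])

lemma graded_sub_comb:
  assumes "graded_sub sc H" "\<And>k. k < l \<Longrightarrow> x k \<in> H (s k)" "\<And>k. k < l \<Longrightarrow> c k \<in> Rg (g - s k)"
  shows "(\<Sum>k<l. sc (c k) (x k)) \<in> H g"
proof (rule graded_sub_sum[OF assms(1)])
  fix k assume "k \<in> {..<l}"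
  then have "sc (c k) (x k) \<in> H (g - s k + s k)"
    by (intro graded_subD(5)[OF assms(1)] assms) auto
  then show "sc (c k) (x k) \<in> H g" by simp
qed

lemma graded_sub_Syz:
  assumes "Modules.module sc"
  shows "graded_sub vscale (Syz sc l s x)"
proof -
  interpret m: Modules.module sc by fact
  have "vscale a c \<in> Syz sc l s x (g + h)" if a: "a \<in> Rg g" and c: "c \<in> Syz sc l s x h" for a c g h
  proof -
    have "(\<Sum>k<l. sc (a * c k) (x k)) = sc a (\<Sum>k<l. sc (c k) (x k))"
      by (simp add: m.scale_sum_right)
    also have "\<dots> = 0" using c by (simp add: Syz_def)
    finally have "(\<Sum>k<l. sc (a * c k) (x k)) = 0" .
    moreover have "a * c k \<in> Rg (g + h - s k)" if "k < l" for k
      by (rule Rg_mult'[of _ g _ "h - s k"]) (use that a c in \<open>auto simp: Syz_def\<close>)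
    ultimately show ?thesis using c by (simp add: Syz_def)
  qed
  moreover have "0 \<in> Syz sc l s x g" "c \<in> Syz sc l s x g \<Longrightarrow> - c \<in> Syz sc l s x g" for g c
    by (auto simp: Syz_def Rg_zero Rg_minus sum_negf)
  moreover have "c \<in> Syz sc l s x g \<Longrightarrow> d \<in> Syz sc l s x g \<Longrightarrow> c + d \<in> Syz sc l s x g" for g c d
    by (auto simp: Syz_def Rg_add m.scale_left_distrib sum.distrib)
  ultimately show ?thesis unfolding graded_sub_def using module_vscale by (intro conjI allI ballI) auto
qed

lemma gen_mem: "gen sc l s x H \<Longrightarrow> k < l \<Longrightarrow> x k \<in> H (s k)"
  by (simp add: gen_def)

lemma genD:
  assumes "gen sc l s x H" "y \<in> H g"
  shows "\<exists>c. (\<forall>k<l. c k \<in> Rg (g - s k)) \<and> y = (\<Sum>k<l. sc (c k) (x k))"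
  using assms by (simp add: gen_def)

lemma gen_matrix:
  assumes "gen sc l s x H" "\<And>j. j < m \<Longrightarrow> y j \<in> H (t j)"
  shows "\<exists>b. (\<forall>j<m. \<forall>k<l. b j k \<in> Rg (t j - s k)) \<and> (\<forall>j<m. y j = (\<Sum>k<l. sc (b j k) (x k)))"
proof -
  have "\<forall>j\<in>{..<m}. \<exists>b. (\<forall>k<l. b k \<in> Rg (t j - s k)) \<and> y j = (\<Sum>k<l. sc (b k) (x k))"
    using genD[OF assms(1) assms(2)] by blast
  from bchoice[OF this] show ?thesis by auto
qed

lemma genE:
  assumes "gen sc l s x H" "y \<in> H g"
  obtains c where "\<And>k. k < l \<Longrightarrow> c k \<in> Rg (g - s k)" "y = (\<Sum>k<l. sc (c k) (x k))"
  using genD[OF assms] that by blast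

lemma genI:
  assumes "\<And>k. k < l \<Longrightarrow> x k \<in> H (s k)"
    and "\<And>g y. y \<in> H g \<Longrightarrow> \<exists>c. (\<forall>k<l. c k \<in> Rg (g - s k)) \<and> y = (\<Sum>k<l. sc (c k) (x k))"
  shows "gen sc l s x H"
  unfolding gen_def using assms by simp

lemma gen_image:
  assumes add: "\<And>x y. \<phi> (x + y) = \<phi> x + \<phi> y" and sc: "\<And>a x. \<phi> (sc a x) = sc' a (\<phi> x)"
    and im: "\<And>g. \<phi> ` H g = H' g"
    and "gen sc l s x H"
  shows "gen sc' l s (\<lambda>k. \<phi> (x k)) H'"
proof -
  interpret \<phi>: additive \<phi> by unfold_locales (rule add)
  show ?thesis
  proof (rule genI)
    show "\<phi> (x k) \<in> H' (s k)" if "k < l" for k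
      using gen_mem[OF assms(4) that] im[of "s k"] by blast
  next
    fix g z assume "z \<in> H' g"
    then obtain y where y: "y \<in> H g" "z = \<phi> y" using im[of g] by blast
    obtain c where "\<And>k. k < l \<Longrightarrow> c k \<in> Rg (g - s k)" "y = (\<Sum>k<l. sc (c k) (x k))"
      using genE[OF assms(4) y(1)] by metis
    then show "\<exists>c. (\<forall>k<l. c k \<in> Rg (g - s k)) \<and> z = (\<Sum>k<l. sc' (c k) (\<phi> (x k)))"
      using y(2) by (intro exI[of _ c]) (simp add: \<phi>.sum sc)
  qed
qed

text \<open>The combinations in question are homogeneous, so injectivity of \<open>\<phi>\<close> on
  the pieces of \<open>H\<close> lets relations pass back from the images.\<close>

lemma Syz_image:
  assumes add: "\<And>x y. \<phi> (x + y) = \<phi> x + \<phi> y" and sc: "\<And>a x. \<phi> (sc a x) = sc' a (\<phi> x)"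
    and H: "graded_sub sc H"
    and inj: "\<forall>g. \<forall>x\<in>H g. \<phi> x = 0 \<longrightarrow> x = 0"
    and x: "\<And>k. k < l \<Longrightarrow> x k \<in> H (s k)"
  shows "Syz sc' l s (\<lambda>k. \<phi> (x k)) = Syz sc l s x"
proof -
  interpret \<phi>: additive \<phi> by unfold_locales (rule add)
  have "(\<Sum>k<l. sc' (c k) (\<phi> (x k))) = 0 \<longleftrightarrow> (\<Sum>k<l. sc (c k) (x k)) = 0"
    if "\<And>k. k < l \<Longrightarrow> c k \<in> Rg (g - s k)" for c g
    using inj[rule_format, OF graded_sub_comb[of sc H, OF H x that]] \<phi>.sum[of "\<lambda>k. sc (c k) (x k)" "{..<l}"] \<phi>.zero
    by (auto simp: sc)
  then show ?thesis unfolding Syz_def by (intro ext Collect_cong) blast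
qed

lemma Syz_cong:
  assumes "\<And>k. k < l \<Longrightarrow> x k = y k"
  shows "Syz sc l s x = Syz sc l s y"
proof -
  have *: "(\<Sum>k<l. sc (c k) (x k)) = (\<Sum>k<l. sc (c k) (y k))" for c
    using assms by (intro sum.cong) auto
  show ?thesis unfolding Syz_def by (simp only: *)
qed

text \<open>The generators are lifted degree by degree. The lifts generate, because the difference
  between an element and its expected combination is homogeneous and killed by
  \<open>\<phi>\<close>.\<close>

lemma gen_preimage:
  assumes add: "\<And>x y. \<phi> (x + y) = \<phi> x + \<phi> y" and sc: "\<And>a x. \<phi> (sc a x) = sc' a (\<phi> x)"
    and H: "graded_sub sc H"
    and inj: "\<forall>g. \<forall>x\<in>H g. \<phi> x = 0 \<longrightarrow> x = 0"
    and im: "\<And>g. \<phi> ` H g = H' g"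
    and gen': "gen sc' l s x' H'"
  obtains x where "gen sc l s x H" "\<And>k. k < l \<Longrightarrow> \<phi> (x k) = x' k"
proof -
  interpret \<phi>: additive \<phi> by unfold_locales (rule add)
  have "x' k \<in> \<phi> ` H (s k)" if "k < l" for k
    using gen_mem[OF gen' that] by (simp only: im)
  then have "\<forall>k\<in>{..<l}. \<exists>x. x \<in> H (s k) \<and> \<phi> x = x' k"
    by (auto simp: image_iff eq_commute)
  from bchoice[OF this] obtain x where x: "\<And>k. k < l \<Longrightarrow> x k \<in> H (s k) \<and> \<phi> (x k) = x' k"
    by auto
  have "gen sc l s x H"
  proof (rule genI)
    fix g y assume y: "y \<in> H g"
    then have "\<phi> y \<in> H' g" using im[of g, symmetric] by simp
    then obtain c where c: "\<And>k. k < l \<Longrightarrow> c k \<in> Rg (g - s k)" "\<phi> y = (\<Sum>k<l. sc' (c k) (x' k))"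
      using genE[OF gen'] by metis
    have "\<phi> (y - (\<Sum>k<l. sc (c k) (x k))) = 0"
      using x c(2) by (simp add: \<phi>.diff \<phi>.sum sc)
    moreover have "y - (\<Sum>k<l. sc (c k) (x k)) \<in> H g"
      by (intro graded_subD(6)[OF H] y graded_sub_comb[OF H, where s = s]) (use x c in auto)
    ultimately have "y - (\<Sum>k<l. sc (c k) (x k)) = 0" by (intro inj[rule_format])
    then have "y = (\<Sum>k<l. sc (c k) (x k))" by simp
    then show "\<exists>c. (\<forall>k<l. c k \<in> Rg (g - s k)) \<and> y = (\<Sum>k<l. sc (c k) (x k))"
      using c(1) by blast
  qed (use x in blast)
  then show ?thesis using that x by blast
qed

end

section \<open>Regularity bounds from truncated resolutions\<close>

locale int_graded_pieces = graded_pieces Rg for Rg :: "int \<Rightarrow> 'a::comm_ring_1 set"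
begin

primrec lin_vec :: "nat \<Rightarrow> int \<Rightarrow> (int \<Rightarrow> (nat \<Rightarrow> 'a) set) \<Rightarrow> bool" where
  "lin_vec 0 = (\<lambda>r H. True)"
| "lin_vec (Suc p) = (\<lambda>r H. \<exists>l s x. gen vscale l s x H \<and> (\<forall>k<l. s k \<le> r) \<and> lin_vec p (r + 1) (Syz vscale l s x))"

text \<open>\<open>lin sc p r H\<close> says that the first \<open>p\<close> steps of some free resolution of \<open>H\<close> witness
  regularity at most \<open>r\<close>. The recursion needs a fixed type, which the syzygies provide.\<close>

definition lin :: "('a \<Rightarrow> 'm::ab_group_add \<Rightarrow> 'm) \<Rightarrow> nat \<Rightarrow> int \<Rightarrow> (int \<Rightarrow> 'm set) \<Rightarrow> bool" where
  "lin sc p r H \<longleftrightarrow> (case p of 0 \<Rightarrow> True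
     | Suc q \<Rightarrow> \<exists>l s x. gen sc l s x H \<and> (\<forall>k<l. s k \<le> r) \<and> lin_vec q (r + 1) (Syz sc l s x))"

lemma lin_vec_eq: "lin_vec = lin vscale"
proof (intro ext)
  show "lin_vec p r H = lin vscale p r H" for p r H
    by (cases p) (simp_all add: lin_def)
qed

lemma lin_0: "lin sc 0 r H"
  by (simp add: lin_def)

lemma lin_Suc:
  "lin sc (Suc p) r H \<longleftrightarrow>
    (\<exists>l s x. gen sc l s x H \<and> (\<forall>k<l. s k \<le> r) \<and> lin vscale p (r + 1) (Syz sc l s x))"
  unfolding lin_def[of sc] lin_vec_eq nat.case ..

lemma linI:
  assumes "gen sc l s x H" "\<forall>k<l. s k \<le> r" "lin vscale p (r + 1) (Syz sc l s x)"
  shows "lin sc (Suc p) r H"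
  using assms unfolding lin_Suc by blast

lemma linE:
  assumes "lin sc (Suc p) r H"
  obtains l s x where "gen sc l s x H" "\<forall>k<l. s k \<le> r" "lin vscale p (r + 1) (Syz sc l s x)"
  using assms unfolding lin_Suc by blast

text \<open>A degreewise bijective linear map carries generators in both directions and leaves their
  relations literally unchanged. It serves to permute generators, to identify syzygies of strands
  with strands of syzygies, and to identify strands of the Rees algebra with powers.\<close>

lemma lin_image_iff:
  assumes add: "\<And>x y. \<phi> (x + y) = \<phi> x + \<phi> y" and sc: "\<And>a x. \<phi> (sc a x) = sc' a (\<phi> x)"
    and H: "graded_sub sc H"
    and inj: "\<forall>g. \<forall>x\<in>H g. \<phi> x = 0 \<longrightarrow> x = 0"
    and im: "\<And>g. \<phi> ` H g = H' g"
  shows "lin sc' p r H' \<longleftrightarrow> lin sc p r H"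
proof (cases p)
  case (Suc q)
  note S = Syz_image[of \<phi> sc sc', OF add sc H inj]
  show ?thesis unfolding Suc
  proof
    assume "lin sc' (Suc q) r H'"
    then obtain l s x' where *: "gen sc' l s x' H'" "\<forall>k<l. s k \<le> r"
      "lin vscale q (r + 1) (Syz sc' l s x')" by (rule linE) blast
    obtain x where x: "gen sc l s x H" "\<And>k. k < l \<Longrightarrow> \<phi> (x k) = x' k"
      using gen_preimage[of \<phi> sc sc', OF add sc H inj im *(1)] by blast
    have "Syz sc' l s x' = Syz sc l s x"
      using Syz_cong[of l "\<lambda>k. \<phi> (x k)" x' sc' s] S[of l x s] x gen_mem[OF x(1)] by auto
    with * x show "lin sc (Suc q) r H" by (intro linI[of sc l s x]) auto
  next
    assume "lin sc (Suc q) r H"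
    then obtain l s x where *: "gen sc l s x H" "\<forall>k<l. s k \<le> r"
      "lin vscale q (r + 1) (Syz sc l s x)" by (rule linE)
    show "lin sc' (Suc q) r H'"
      by (rule linI[OF gen_image[of \<phi> sc sc', OF add sc im *(1)]]) (use * S[of l x s] gen_mem[OF *(1)] in auto)
  qed
qed (simp add: lin_0)

end

section \<open>Adding and splitting off free summands\<close>

definition append_seq :: "nat \<Rightarrow> (nat \<Rightarrow> 'b) \<Rightarrow> (nat \<Rightarrow> 'b) \<Rightarrow> nat \<Rightarrow> 'b" where
  "append_seq l x y k = (if k < l then x k else y (k - l))"

lemma append_seq_simps [simp]:
  "k < l \<Longrightarrow> append_seq l x y k = x k" "append_seq l x y (l + k) = y k"
  by (simp_all add: append_seq_def)

lemma less_add_cases: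
  assumes "(k::nat) < l + m"
  obtains "k < l" | j where "k = l + j" "j < m"
  using assms by (metis add_less_cancel_left le_Suc_ex not_le)

text \<open>\<open>P\<close> is the direct sum of \<open>N\<close> and a free module with basis
  \<open>e j\<close> in degree \<open>t j\<close>. The assumption \<open>indep\<close> expresses
  both directness of the sum and freeness.\<close>

locale free_extension = graded_pieces Rg for Rg :: "'g::ab_group_add \<Rightarrow> 'a::comm_ring_1 set" +
  fixes sc :: "'a \<Rightarrow> 'm::ab_group_add \<Rightarrow> 'm" and N P :: "'g \<Rightarrow> 'm set"
    and m :: nat and t :: "nat \<Rightarrow> 'g" and e :: "nat \<Rightarrow> 'm"
  assumes N: "graded_sub sc N" and P: "graded_sub sc P" and N_le: "N g \<subseteq> P g"
    and e: "j < m \<Longrightarrow> e j \<in> P (t j)"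
    and decomp: "z \<in> P g \<Longrightarrow> \<exists>y\<in>N g. \<exists>c. (\<forall>j<m. c j \<in> Rg (g - t j)) \<and> z = y + (\<Sum>j<m. sc (c j) (e j))"
    and indep: "y \<in> N g \<Longrightarrow> (\<And>j. j < m \<Longrightarrow> c j \<in> Rg (g - t j)) \<Longrightarrow>
      y + (\<Sum>j<m. sc (c j) (e j)) = 0 \<Longrightarrow> y = 0 \<and> (\<forall>j<m. c j = 0)"
begin

sublocale Modules.module sc
  using N by (rule graded_subD(1))

lemma gen_append:
  assumes "gen sc l s x N"
  shows "gen sc (l + m) (append_seq l s t) (append_seq l x e) P"
proof (rule genI)
  show "append_seq l x e k \<in> P (append_seq l s t k)" if "k < l + m" for k
    using that by (cases rule: less_add_cases) (use gen_mem[OF assms] N_le e in auto)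
next
  fix g z assume "z \<in> P g"
  then obtain y c where c: "y \<in> N g" "\<forall>j<m. c j \<in> Rg (g - t j)" "z = y + (\<Sum>j<m. sc (c j) (e j))"
    using decomp by metis
  obtain b where b: "\<And>k. k < l \<Longrightarrow> b k \<in> Rg (g - s k)" "y = (\<Sum>k<l. sc (b k) (x k))"
    using genE[OF assms c(1)] by metis
  show "\<exists>c. (\<forall>k<l + m. c k \<in> Rg (g - append_seq l s t k)) \<and>
      z = (\<Sum>k<l + m. sc (c k) (append_seq l x e k))"
  proof (intro exI[of _ "append_seq l b c"] conjI allI impI)
    show "append_seq l b c k \<in> Rg (g - append_seq l s t k)" if "k < l + m" for k
      using that by (cases rule: less_add_cases) (use b c in auto)
    show "z = (\<Sum>k<l + m. sc (append_seq l b c k) (append_seq l x e k))"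
      by (simp add: sum_lessThan_add b c)
  qed
qed

text \<open>The basis of a free complement takes part in no relation, so only the relations among
  the generators of \<open>N\<close> remain.\<close>

lemma Syz_append:
  assumes "\<And>k. k < l \<Longrightarrow> x k \<in> N (s k)"
  shows "Syz sc (l + m) (append_seq l s t) (append_seq l x e) = Syz sc l s x"
proof -
  have "c \<in> Syz sc l s x g" if c: "c \<in> Syz sc (l + m) (append_seq l s t) (append_seq l x e) g" for c g
  proof -
  have c1: "c k \<in> Rg (g - s k)" if "k < l" for k
    using c that by (simp add: Syz_def) (metis append_seq_simps(1) trans_less_add1)
  have c2: "c (l + j) \<in> Rg (g - t j)" if "j < m" for j
    using c that by (simp add: Syz_def) (metis append_seq_simps(2) add_less_cancel_left)
  have "(\<Sum>k<l. sc (c k) (x k)) \<in> N g" by (rule graded_sub_comb[OF N assms c1])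
  from indep[OF this c2] have *: "(\<Sum>k<l. sc (c k) (x k)) = 0" "\<And>j. j < m \<Longrightarrow> c (l + j) = 0"
    using c by (auto simp: Syz_def sum_lessThan_add)
  have "c k = 0" if "k \<ge> l" for k
  proof (cases "k < l + m")
    case True then show ?thesis using *(2)[of "k - l"] that by simp
  next
    case False then show ?thesis using c by (simp add: Syz_def)
  qed
  with c1 * show ?thesis by (simp add: Syz_def)
  qed
  moreover have "c \<in> Syz sc (l + m) (append_seq l s t) (append_seq l x e) g" if c: "c \<in> Syz sc l s x g" for c g
  proof -
  have "c k \<in> Rg (g - append_seq l s t k)" if "k < l + m" for k
    using that by (cases rule: less_add_cases) (use c in \<open>auto simp: Syz_def Rg_zero\<close>)
  with c show ?thesis
    by (simp add: Syz_def sum_lessThan_add)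
  qed
  ultimately show ?thesis by (intro ext) blast
qed

end

context free_extension begin

lemma comb_decomp:
  assumes y: "\<And>k. k < l \<Longrightarrow> z k = y k + (\<Sum>j<m. sc (c k j) (e j))"
  shows "(\<Sum>k<l. sc (u k) (z k)) = (\<Sum>k<l. sc (u k) (y k)) + (\<Sum>j<m. sc (\<Sum>k<l. u k * c k j) (e j))"
proof -
  have "(\<Sum>k<l. sc (u k) (z k)) = (\<Sum>k<l. sc (u k) (y k) + (\<Sum>j<m. sc (u k * c k j) (e j)))"
    by (rule sum.cong) (auto simp: y scale_right_distrib scale_sum_right)
  also have "\<dots> = (\<Sum>k<l. sc (u k) (y k)) + (\<Sum>j<m. \<Sum>k<l. sc (u k * c k j) (e j))"
    by (simp add: sum.distrib sum.swap[of _ "{..<m}"])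
  finally show ?thesis by (simp add: scale_sum_left)
qed

lemma comb_indep:
  assumes "y \<in> N g" "y' \<in> N g" "\<And>j. j < m \<Longrightarrow> b j \<in> Rg (g - t j)" "\<And>j. j < m \<Longrightarrow> c j \<in> Rg (g - t j)"
    and eq: "y + (\<Sum>j<m. sc (b j) (e j)) = y' + (\<Sum>j<m. sc (c j) (e j))"
  shows "y = y'" "\<forall>j<m. b j = c j"
proof -
  have "(y - y') + (\<Sum>j<m. sc (b j - c j) (e j)) = 0"
    using eq by (simp add: scale_left_diff_distrib sum_subtractf algebra_simps)
  from indep[OF _ _ this, of g] show "y = y'" "\<forall>j<m. b j = c j"
    using graded_subD(6)[OF N assms(1,2)] Rg_diff assms(3,4) by auto
qed

end

locale int_free_extension = free_extension Rg + int_graded_pieces Rg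
  for Rg :: "int \<Rightarrow> 'a::comm_ring_1 set" +
  fixes r :: int
  assumes t_le: "j < m \<Longrightarrow> t j \<le> r"
begin

lemma lin_extend:
  assumes "lin sc p r N"
  shows "lin sc p r P"
proof (cases p)
  case (Suc q)
  obtain l s x where *: "gen sc l s x N" "\<forall>k<l. s k \<le> r" "lin vscale q (r + 1) (Syz sc l s x)"
    using assms unfolding Suc by (rule linE)
  show ?thesis unfolding Suc
  proof (rule linI[OF gen_append[OF *(1)]])
    show "\<forall>k<l + m. append_seq l s t k \<le> r"
      using *(2) t_le by (auto elim: less_add_cases)
    show "lin vscale q (r + 1) (Syz sc (l + m) (append_seq l s t) (append_seq l x e))"
      using *(3) by (simp add: Syz_append gen_mem[OF *(1)])
  qed
qed (simp add: lin_0)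

text \<open>Generators \<open>z\<close> of \<open>P\<close> are projected along the free summand to
  generators \<open>y\<close> of \<open>N\<close>. The relations of \<open>y\<close> are those of
  \<open>z\<close> together with a free module whose basis again has the degrees \<open>t j\<close>,
  so the claim reduces to \<open>lin_extend\<close> one syzygy further on.\<close>

lemma lin_restrict:
  assumes "lin sc p r P"
  shows "lin sc p r N"
proof (cases p)
  case (Suc q)
  obtain l s z where z: "gen sc l s z P" and s: "\<forall>k<l. s k \<le> r" and lin: "lin vscale q (r + 1) (Syz sc l s z)"
    using assms unfolding Suc by (rule linE)
  have "\<forall>k\<in>{..<l}. \<exists>yc. fst yc \<in> N (s k) \<and> (\<forall>j<m. snd yc j \<in> Rg (s k - t j)) \<and>
      z k = fst yc + (\<Sum>j<m. sc (snd yc j) (e j))"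
    using decomp[OF gen_mem[OF z]] by fastforce
  from bchoice[OF this] obtain yc where yc: "\<And>k. k < l \<Longrightarrow> fst (yc k) \<in> N (s k)"
    "\<And>k j. k < l \<Longrightarrow> j < m \<Longrightarrow> snd (yc k) j \<in> Rg (s k - t j)"
    "\<And>k. k < l \<Longrightarrow> z k = fst (yc k) + (\<Sum>j<m. sc (snd (yc k) j) (e j))"
    by auto
  define y c where "y k = fst (yc k)" and "c k = snd (yc k)" for k
  have y: "\<And>k. k < l \<Longrightarrow> y k \<in> N (s k)" and c: "\<And>k j. k < l \<Longrightarrow> j < m \<Longrightarrow> c k j \<in> Rg (s k - t j)"
    and zy: "\<And>k. k < l \<Longrightarrow> z k = y k + (\<Sum>j<m. sc (c k j) (e j))"
    using yc by (auto simp: y_def c_def)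
  have comb: "(\<Sum>k<l. sc (u k) (z k)) = (\<Sum>k<l. sc (u k) (y k)) + (\<Sum>j<m. sc (\<Sum>k<l. u k * c k j) (e j))" for u
    by (rule comb_decomp) (rule zy)
  have uc: "(\<Sum>k<l. u k * c k j) \<in> Rg (g - t j)" if "\<And>k. k < l \<Longrightarrow> u k \<in> Rg (g - s k)" "j < m" for u g j
    by (rule Rg_sum, rule Rg_mult'[OF that(1) c]) (use that in auto)
  have uy: "(\<Sum>k<l. sc (u k) (y k)) \<in> N g" if "\<And>k. k < l \<Longrightarrow> u k \<in> Rg (g - s k)" for u g
    by (rule graded_sub_comb[OF N y that])
  have gen_y: "gen sc l s y N"
  proof (rule genI)
    fix g w assume w: "w \<in> N g"
    then obtain u where u: "\<And>k. k < l \<Longrightarrow> u k \<in> Rg (g - s k)" "w = (\<Sum>k<l. sc (u k) (z k))"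
      using genE[OF z] N_le by (metis subsetD)
    have "w + (\<Sum>j<m. sc 0 (e j)) = (\<Sum>k<l. sc (u k) (y k)) + (\<Sum>j<m. sc (\<Sum>k<l. u k * c k j) (e j))"
      using u comb by simp
    from comb_indep(1)[OF w uy _ _ this] u uc Rg_zero
    show "\<exists>u. (\<forall>k<l. u k \<in> Rg (g - s k)) \<and> w = (\<Sum>k<l. sc (u k) (y k))" by blast
  qed (rule y)
  \<comment> \<open>Since \<open>e j\<close> has no component in \<open>N\<close>, its coefficients
    with respect to \<open>z\<close> form a relation of the projections \<open>y\<close>.\<close>
  obtain a0 where a0: "\<And>j k. j < m \<Longrightarrow> k < l \<Longrightarrow> a0 j k \<in> Rg (t j - s k)"
    "\<And>j. j < m \<Longrightarrow> e j = (\<Sum>k<l. sc (a0 j k) (z k))"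
    using gen_matrix[OF z, of m e t] e by blast
  define a where "a j k = (if k < l then a0 j k else 0)" for j k
  have a: "\<And>j k. j < m \<Longrightarrow> k < l \<Longrightarrow> a j k \<in> Rg (t j - s k)"
    "\<And>j. j < m \<Longrightarrow> e j = (\<Sum>k<l. sc (a j k) (z k))" "\<And>j k. k \<ge> l \<Longrightarrow> a j k = 0"
    using a0 by (auto simp: a_def)
  note module = module_axioms
  have ay: "(\<Sum>k<l. sc (a i k) (y k)) = 0" if i: "i < m" for i
  proof -
    have "0 + (\<Sum>j<m. sc (if j = i then 1 else 0) (e j)) = (\<Sum>k<l. sc (a i k) (y k)) + (\<Sum>j<m. sc (\<Sum>k<l. a i k * c k j) (e j))"
      using sum_scale_unit[OF module i, of e] a(2)[OF i] comb[of "a i"] by simp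
    from comb_indep(1)[OF _ uy _ uc this, of "t i"] a(1)[OF i] show ?thesis
      by (auto simp: Rg_zero Rg_one graded_subD(2)[OF N])
  qed
  \<comment> \<open>The vectors \<open>a j\<close> are the basis of the free complement, and their
    degrees satisfy \<open>t j \<le> r + 1\<close>, the bound that applies to syzygies.\<close>
  interpret S: int_free_extension vscale "Syz sc l s z" "Syz sc l s y" m t a Rg "r + 1"
  proof unfold_locales
    show "graded_sub vscale (Syz sc l s z)" "graded_sub vscale (Syz sc l s y)"
      by (rule graded_sub_Syz[OF module])+
    show "Syz sc l s z g \<subseteq> Syz sc l s y g" for g
    proof
      fix u assume u: "u \<in> Syz sc l s z g"
      then have u': "\<And>k. k < l \<Longrightarrow> u k \<in> Rg (g - s k)" by (simp add: Syz_def)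
      have u0: "(\<Sum>k<l. sc (u k) (z k)) = 0" using u by (simp add: Syz_def)
      have e0: "(\<Sum>k<l. sc (u k) (y k)) + (\<Sum>j<m. sc (\<Sum>k<l. u k * c k j) (e j)) = 0"
        by (rule trans[OF comb[of u, symmetric] u0])
      have "(\<Sum>k<l. sc (u k) (y k)) = 0 \<and> (\<forall>j<m. (\<Sum>k<l. u k * c k j) = 0)"
        by (rule indep[OF _ _ e0, of g]) (auto intro: uy[OF u'] uc[OF u'])
      then show "u \<in> Syz sc l s y g" using u by (simp add: Syz_def)
    qed
    show "a j \<in> Syz sc l s y (t j)" if "j < m" for j
      using a(1,3) ay that by (simp add: Syz_def)
    show "t j \<le> r + 1" if "j < m" for j using t_le[OF that] by simp
  next
    fix u g assume u: "u \<in> Syz sc l s y g"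
    then have u': "\<And>k. k < l \<Longrightarrow> u k \<in> Rg (g - s k)" by (simp add: Syz_def)
    \<comment> \<open>For a relation \<open>u\<close> of \<open>y\<close>, the combination of
      \<open>z\<close> with coefficients \<open>u\<close> lies in the free summand and has
      coordinates \<open>v\<close>. Subtracting the matching combination of the \<open>a j\<close>
      leaves a relation of \<open>z\<close>.\<close>
    define v where "v j = (\<Sum>k<l. u k * c k j)" for j
    have v: "\<And>j. j < m \<Longrightarrow> v j \<in> Rg (g - t j)" unfolding v_def by (rule uc[OF u'])
    define w where "w = u - (\<Sum>j<m. vscale (v j) (a j))"
    have w_app: "w k = u k - (\<Sum>j<m. v j * a j k)" for k by (simp add: w_def sum_fun_apply)
    have "w k \<in> Rg (g - s k)" if "k < l" for k unfolding w_app
      by (intro Rg_diff u' Rg_sum that, rule Rg_mult'[OF v a(1)]) (use that in auto)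
    moreover have "w k = 0" if "k \<ge> l" for k
      using u that by (simp add: w_app a(3) Syz_def)
    moreover have "(\<Sum>k<l. sc (w k) (z k)) = 0"
    proof -
      have "(\<Sum>k<l. sc (w k) (z k)) = (\<Sum>k<l. sc (u k) (z k)) - (\<Sum>k<l. \<Sum>j<m. sc (v j * a j k) (z k))"
        by (simp add: w_app scale_left_diff_distrib sum_subtractf scale_sum_left)
      also have "(\<Sum>k<l. \<Sum>j<m. sc (v j * a j k) (z k)) = (\<Sum>j<m. sc (v j) (e j))"
        by (subst sum.swap) (simp add: a(2) scale_sum_right)
      also have "(\<Sum>k<l. sc (u k) (z k)) = (\<Sum>j<m. sc (v j) (e j))"
        using comb[of u] u by (simp add: v_def Syz_def)
      finally show ?thesis by simp
    qed
    ultimately have "w \<in> Syz sc l s z g" by (simp add: Syz_def)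
    then show "\<exists>w\<in>Syz sc l s z g. \<exists>v. (\<forall>j<m. v j \<in> Rg (g - t j)) \<and> u = w + (\<Sum>j<m. vscale (v j) (a j))"
      using v by (intro bexI[of _ w] exI[of _ v]) (auto simp: w_def)
  next
    fix w g and v :: "nat \<Rightarrow> 'a"
    assume w: "w \<in> Syz sc l s z g" and v: "\<And>j. j < m \<Longrightarrow> v j \<in> Rg (g - t j)"
      and eq: "w + (\<Sum>j<m. vscale (v j) (a j)) = 0"
    have eq': "w k + (\<Sum>j<m. v j * a j k) = 0" for k
      using fun_cong[OF eq, of k] by (simp add: sum_fun_apply)
    have "0 = (\<Sum>k<l. sc (w k + (\<Sum>j<m. v j * a j k)) (z k))" by (simp add: eq')
    also have "\<dots> = (\<Sum>k<l. sc (w k) (z k)) + (\<Sum>k<l. \<Sum>j<m. sc (v j * a j k) (z k))"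
      by (simp add: scale_left_distrib sum.distrib scale_sum_left)
    also have "(\<Sum>k<l. \<Sum>j<m. sc (v j * a j k) (z k)) = (\<Sum>j<m. sc (v j) (e j))"
      by (subst sum.swap) (simp add: a(2) scale_sum_right)
    finally have "0 + (\<Sum>j<m. sc (v j) (e j)) = 0" using w by (simp add: Syz_def)
    from indep[OF graded_subD(2)[OF N] v this] have v0: "\<forall>j<m. v j = 0" by simp
    then have "w = 0" using eq' by (auto simp: fun_eq_iff)
    with v0 show "w = 0 \<and> (\<forall>j<m. v j = 0)" by simp
  qed
  show ?thesis unfolding Suc by (rule linI[OF gen_y s S.lin_extend[OF lin]])
qed (simp add: lin_0)

end

section \<open>Independence of the chosen generators\<close>

context int_graded_pieces begin

lemma Syz_append_iff:
  "c \<in> Syz sc (l + m) (append_seq l s t) (append_seq l x y) g \<longleftrightarrow>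
    (\<forall>k<l. c k \<in> Rg (g - s k)) \<and> (\<forall>j<m. c (l + j) \<in> Rg (g - t j)) \<and> (\<forall>k\<ge>l + m. c k = 0) \<and>
    (\<Sum>k<l. sc (c k) (x k)) + (\<Sum>j<m. sc (c (l + j)) (y j)) = 0"
proof -
  have "(\<forall>k<l + m. c k \<in> Rg (g - append_seq l s t k)) \<longleftrightarrow>
      (\<forall>k<l. c k \<in> Rg (g - s k)) \<and> (\<forall>j<m. c (l + j) \<in> Rg (g - t j))" (is "?L \<longleftrightarrow> ?R")
  proof (intro iffI conjI allI impI)
    show "c k \<in> Rg (g - s k)" if ?L "k < l" for k
      using that(1)[rule_format, of k] that(2) by simp
    show "c (l + j) \<in> Rg (g - t j)" if ?L "j < m" for j
      using that(1)[rule_format, of "l + j"] that(2) by simp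
    show "c k \<in> Rg (g - append_seq l s t k)" if ?R "k < l + m" for k
      using that(2) by (cases rule: less_add_cases) (use that(1) in auto)
  qed
  then show ?thesis by (simp add: Syz_def sum_lessThan_add conj_assoc)
qed

text \<open>Each redundant generator \<open>y j\<close> contributes one relation \<open>e j\<close>,
  which expresses it through \<open>x\<close> and has coefficient \<open>1\<close> at
  \<open>y j\<close>. These relations are a basis of a free complement to the relations of
  \<open>x\<close>, so a free summand is added or split off.\<close>

lemma lin_Syz_append:
  assumes H: "graded_sub sc H" and x: "gen sc l s x H"
    and y: "\<And>j. j < m \<Longrightarrow> y j \<in> H (t j)" and t: "\<And>j. j < m \<Longrightarrow> t j \<le> r"
  shows "lin vscale p r (Syz sc (l + m) (append_seq l s t) (append_seq l x y)) \<longleftrightarrow> lin vscale p r (Syz sc l s x)"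
proof -
  interpret Modules.module sc using H by (rule graded_subD(1))
  obtain b where b: "\<And>j k. j < m \<Longrightarrow> k < l \<Longrightarrow> b j k \<in> Rg (t j - s k)"
    "\<And>j. j < m \<Longrightarrow> y j = (\<Sum>k<l. sc (b j k) (x k))"
    using gen_matrix[OF x, of m y t] y by blast
  define e where "e j = append_seq l (\<lambda>k. - b j k) (\<lambda>i. if i = j then 1 else 0)" for j
  let ?S = "Syz sc (l + m) (append_seq l s t) (append_seq l x y)"
  have S: "graded_sub vscale ?S" by (rule graded_sub_Syz[OF module_axioms])
  have e_l: "e j k = - b j k" if "k < l" for j k using that by (simp add: e_def)
  have e_m: "e j (l + i) = (if i = j then 1 else 0)" for i j by (simp add: e_def)
  have e0: "e j k = 0" if "k \<ge> l + m" "j < m" for j k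
    using that e_m[of j "k - l"] by auto
  have e_S: "e j \<in> ?S (t j)" if j: "j < m" for j
  proof -
    have "(\<Sum>i<m. sc (if i = j then 1 else 0) (y i)) = y j"
      by (rule sum_scale_unit[OF module_axioms j])
    then show ?thesis unfolding Syz_append_iff
      using j b(2)[OF j] b(1)[OF j] by (auto simp: e_m e_l e0 sum_negf Rg_minus Rg_one Rg_zero)
  qed
  have SySz: "Syz sc l s x g \<subseteq> ?S g" for g
  proof
    fix c assume c: "c \<in> Syz sc l s x g"
    then show "c \<in> ?S g" unfolding Syz_append_iff by (simp add: Syz_def Rg_zero)
  qed
  have comb_e: "(\<Sum>j<m. v j * e j (l + i)) = v i" if "i < m" for v i
  proof -
    have "(\<Sum>j<m. v j * e j (l + i)) = (\<Sum>j<m. if j = i then v j else 0)"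
      by (rule sum.cong) (auto simp: e_m)
    then show ?thesis using that by simp
  qed
  interpret F: int_free_extension vscale "Syz sc l s x" ?S m t e Rg r
  proof unfold_locales
    show "graded_sub vscale (Syz sc l s x)" by (rule graded_sub_Syz[OF module_axioms])
  next
    fix u g assume u: "u \<in> ?S g"
    define v where "v j = u (l + j)" for j
    have v: "v j \<in> Rg (g - t j)" if "j < m" for j
      using u that unfolding v_def Syz_append_iff by simp
    define w where "w = u - (\<Sum>j<m. vscale (v j) (e j))"
    have w_app: "w k = u k - (\<Sum>j<m. v j * e j k)" for k by (simp add: w_def sum_fun_apply)
    have "w \<in> ?S g" unfolding w_def
      by (intro graded_subD(6)[OF S] u graded_sub_comb[OF S e_S v]) auto
    moreover have w0: "w (l + i) = 0" if "i < m" for i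
      using that by (simp add: w_app comb_e v_def)
    moreover have "w k = 0" if "k \<ge> l" "\<forall>k\<ge>l + m. w k = 0" for k
      using that w0[of "k - l"] by (cases "k < l + m") auto
    ultimately have w: "w \<in> Syz sc l s x g"
      unfolding Syz_append_iff by (simp add: Syz_def)
    show "\<exists>w\<in>Syz sc l s x g. \<exists>v. (\<forall>j<m. v j \<in> Rg (g - t j)) \<and> u = w + (\<Sum>j<m. vscale (v j) (e j))"
      using v w by (intro bexI[of _ w] exI[of _ v]) (auto simp: w_def)
  next
    fix w g and v :: "nat \<Rightarrow> 'a"
    assume w: "w \<in> Syz sc l s x g" and eq: "w + (\<Sum>j<m. vscale (v j) (e j)) = 0"
    have v0: "v i = 0" if "i < m" for i
      using fun_cong[OF eq, of "l + i"] w that by (simp add: sum_fun_apply comb_e Syz_def)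
    then have "(\<Sum>j<m. vscale (v j) (e j)) = 0" by (intro sum.neutral) (auto simp: vscale_def fun_eq_iff)
    with eq v0 show "w = 0 \<and> (\<forall>j<m. v j = 0)" by simp
  qed (use S SySz e_S t in auto)
  show ?thesis using F.lin_extend F.lin_restrict by blast
qed

definition swap_seq :: "nat \<Rightarrow> nat \<Rightarrow> (nat \<Rightarrow> 'b::zero) \<Rightarrow> nat \<Rightarrow> 'b" where
  "swap_seq l m u = append_seq m (\<lambda>k. u (l + k)) (\<lambda>k. if k < l then u k else 0)"

lemma swap_seq_simps:
  "k < m \<Longrightarrow> swap_seq l m u k = u (l + k)" "k < l \<Longrightarrow> swap_seq l m u (m + k) = u k"
  "k \<ge> m + l \<Longrightarrow> swap_seq l m u k = 0"
  by (auto simp: swap_seq_def append_seq_def)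

lemma swap_seq_Syz:
  assumes u: "u \<in> Syz sc (l + m) (append_seq l s t) (append_seq l x y) g"
  shows "swap_seq l m u \<in> Syz sc (m + l) (append_seq m t s) (append_seq m y x) g"
    "swap_seq m l (swap_seq l m u) = u"
proof -
  show "swap_seq l m u \<in> Syz sc (m + l) (append_seq m t s) (append_seq m y x) g"
    using u unfolding Syz_append_iff
    by (simp add: swap_seq_simps add.commute[of m l] add.commute[of "\<Sum>k<m. sc (u (l + k)) (y k)"])
  show "swap_seq m l (swap_seq l m u) = u"
  proof
    fix k show "swap_seq m l (swap_seq l m u) k = u k"
    proof (cases "k < l + m")
      case True then show ?thesis
        by (cases rule: less_add_cases) (auto simp: swap_seq_simps)
    next
      case False then show ?thesis using u by (simp add: Syz_def swap_seq_simps)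
    qed
  qed
qed

lemma lin_Syz_swap:
  assumes "Modules.module sc"
  shows "lin vscale p r (Syz sc (m + l) (append_seq m t s) (append_seq m y x)) \<longleftrightarrow>
    lin vscale p r (Syz sc (l + m) (append_seq l s t) (append_seq l x y))"
proof (rule lin_image_iff[where \<phi> = "swap_seq l m"])
  show "graded_sub vscale (Syz sc (l + m) (append_seq l s t) (append_seq l x y))"
    by (rule graded_sub_Syz[OF assms])
  have "swap_seq m l (0 :: nat \<Rightarrow> 'a) = 0" by (auto simp: swap_seq_def append_seq_def)
  then show "\<forall>g. \<forall>u\<in>Syz sc (l + m) (append_seq l s t) (append_seq l x y) g. swap_seq l m u = 0 \<longrightarrow> u = 0"
    using swap_seq_Syz(2) by metis
  show "swap_seq l m ` Syz sc (l + m) (append_seq l s t) (append_seq l x y) g =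
      Syz sc (m + l) (append_seq m t s) (append_seq m y x) g" for g
  proof (intro equalityI subsetI)
    fix u assume "u \<in> Syz sc (m + l) (append_seq m t s) (append_seq m y x) g"
    from swap_seq_Syz[OF this] show "u \<in> swap_seq l m ` Syz sc (l + m) (append_seq l s t) (append_seq l x y) g"
      by (metis imageI)
  qed (use swap_seq_Syz(1) in blast)
qed (auto simp: swap_seq_def append_seq_def fun_eq_iff)

text \<open>Comparing two generating sets through their union replaces Schanuel's lemma.\<close>

lemma lin_SucD:
  assumes H: "graded_sub sc H" and lin: "lin sc (Suc p) r H" and x: "gen sc l s x H" and s: "\<forall>k<l. s k \<le> r"
  shows "lin vscale p (r + 1) (Syz sc l s x)"
proof -
  obtain m t y where y: "gen sc m t y H" and t: "\<forall>k<m. t k \<le> r" and L: "lin vscale p (r + 1) (Syz sc m t y)"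
    using lin by (rule linE)
  have "lin vscale p (r + 1) (Syz sc (m + l) (append_seq m t s) (append_seq m y x))"
    using lin_Syz_append[OF H y, of l x s "r + 1" p] gen_mem[OF x] s L by fastforce
  then have "lin vscale p (r + 1) (Syz sc (l + m) (append_seq l s t) (append_seq l x y))"
    by (simp add: lin_Syz_swap[OF graded_subD(1)[OF H]])
  then show ?thesis
    using lin_Syz_append[OF H x, of m y t "r + 1" p] gen_mem[OF y] t by fastforce
qed

lemma lin_zero:
  assumes "Modules.module sc"
  shows "lin sc p r (\<lambda>_. {0})"
proof (cases p)
  case (Suc q)
  have "lin vscale q r (\<lambda>_. {0})" for r
  proof (induction q arbitrary: r)
    case (Suc q)
    have "Syz vscale 0 (\<lambda>_. 0) (\<lambda>_. 0) = (\<lambda>_. {0})" by (auto simp: Syz_def fun_eq_iff)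
    with Suc.IH[of "r + 1"] show ?case
      by (intro linI[of vscale 0 "\<lambda>_. 0" "\<lambda>_. 0"]) (simp_all only: gen_def, simp_all)
  qed (rule lin_0)
  moreover have "Syz sc 0 (\<lambda>_. 0) (\<lambda>_. 0) = (\<lambda>_. {0})" by (auto simp: Syz_def fun_eq_iff)
  ultimately show ?thesis unfolding Suc by (intro linI[of sc 0 "\<lambda>_. 0" "\<lambda>_. 0"]) (auto simp: gen_def)
qed (simp add: lin_0)

end

section \<open>Polynomial rings\<close>

text \<open>Reduces identities between additive maps to single terms.\<close>

lemma poly_mapping_add_induct:
  fixes p :: "'a \<Rightarrow>\<^sub>0 'b::comm_monoid_add"
  assumes "\<And>t c. Q (single t c)" "\<And>p q. Q p \<Longrightarrow> Q q \<Longrightarrow> Q (p + q)"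
  shows "Q p"
proof -
  have eq: "p = (\<Sum>t\<in>keys p. single t (lookup p t))"
    by (rule poly_mapping_eqI) (simp add: lookup_sum lookup_single when_def sum.delta in_keys_iff)
  have "Q (\<Sum>t\<in>A. single t (f t))" if "finite A" for A and f :: "'a \<Rightarrow> 'b"
    using that
  proof induction
    case empty
    show ?case using assms(1)[of undefined 0] by simp
  qed (simp add: assms)
  then show ?thesis by (subst eq) simp
qed

text \<open>Additive extension of a map given on terms. The embeddings of monomials and polynomials
  of \<open>S\<close> into \<open>A\<close> and the map to the Rees algebra all have this form, so
  their algebraic laws need checking on terms only.\<close>

definition msum :: "('a \<Rightarrow> 'b \<Rightarrow> 'c::comm_monoid_add) \<Rightarrow> ('a \<Rightarrow>\<^sub>0 'b::zero) \<Rightarrow> 'c" where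
  "msum G p = (\<Sum>t\<in>keys p. G t (lookup p t))"

lemma msum_single: "G t 0 = 0 \<Longrightarrow> msum G (single t c) = G t c"
  by (simp add: msum_def)

lemma msum_add:
  fixes p q :: "'a \<Rightarrow>\<^sub>0 'b::comm_monoid_add"
  assumes "\<And>t. G t 0 = 0" "\<And>t b c. G t (b + c) = G t b + G t c"
  shows "msum G (p + q) = msum G p + msum G q"
  unfolding msum_def by (rule setsum_keys_plus_distrib) (use assms in auto)

lemma msum_mult:
  fixes p q :: "'a::monoid_add \<Rightarrow>\<^sub>0 'b::semiring_0" and G :: "'a \<Rightarrow> 'b \<Rightarrow> 'c::semiring_0"
  assumes G: "\<And>t. G t 0 = 0" "\<And>t b c. G t (b + c) = G t b + G t c"
    and mult: "\<And>s t b c. G (s + t) (b * c) = G s b * G t c"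
  shows "msum G (p * q) = msum G p * msum G q"
proof (induction p rule: poly_mapping_add_induct)
  case (1 s b)
  show ?case
    by (induction q rule: poly_mapping_add_induct)
      (simp_all add: mult_single msum_single G mult msum_add[of G, OF G] distrib_left)
qed (simp add: msum_add[of G, OF G] distrib_right)

lemma monomial_add_eq_0_iff: "(s::'v \<Rightarrow>\<^sub>0 nat) + t = 0 \<longleftrightarrow> s = 0 \<and> t = 0"
  by (auto simp: poly_mapping_eq_iff fun_eq_iff lookup_add)

lemma lookup_mult_0:
  fixes p q :: "('v, 'k::field) mpoly"
  shows "lookup (p * q) 0 = lookup p 0 * lookup q 0"
proof (induction p rule: poly_mapping_add_induct)
  case (1 s b)
  show ?case
    by (induction q rule: poly_mapping_add_induct)
      (auto simp: mult_single lookup_single when_def monomial_add_eq_0_iff lookup_add distrib_left)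
qed (simp add: lookup_add distrib_right)

lemma sum_lessThan_const_add:
  "(\<Sum>j<a + b. c) = (\<Sum>j<a. c) + (\<Sum>j<(b::nat). (c::'g::comm_monoid_add))"
  by (simp add: sum_lessThan_add)

lemma mdeg_superset:
  assumes "finite A" "keys t \<subseteq> A"
  shows "mdeg w t = (\<Sum>v\<in>A. \<Sum>j<lookup t v. w v)"
  unfolding mdeg_def by (rule sum.mono_neutral_left) (use assms in \<open>auto simp: in_keys_iff\<close>)

lemma mdeg_0 [simp]: "mdeg w 0 = 0"
  by (simp add: mdeg_def)

lemma mdeg_add: "mdeg w (s + t) = mdeg w s + mdeg w t"
proof -
  let ?A = "keys s \<union> keys t"
  have "keys (s + t) \<subseteq> ?A" by (rule keys_add)
  then show ?thesis
    by (simp add: mdeg_superset[of ?A] lookup_add sum_lessThan_const_add sum.distrib)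
qed

lemma mdeg_single: "mdeg w (single v n) = (\<Sum>j<n. w v)"
  by (simp add: mdeg_superset[of "{v}"])

lemma carrier_poly_ring: "p \<in> carrier (poly_ring V) \<longleftrightarrow> (\<forall>t\<in>keys p. keys t \<subseteq> V)"
  by (simp add: poly_ring_def)

lemma forms_iff:
  "p \<in> forms V w g \<longleftrightarrow> (\<forall>t\<in>keys p. keys t \<subseteq> V \<and> mdeg w t = g)"
  by (auto simp: forms_def carrier_poly_ring)

lemma poly_ring_closed:
  fixes p q :: "('v, 'k::field) mpoly"
  assumes "p \<in> carrier (poly_ring V)" "q \<in> carrier (poly_ring V)"
  shows "p + q \<in> carrier (poly_ring V)" "p * q \<in> carrier (poly_ring V)"
proof -
  show "p + q \<in> carrier (poly_ring V)"
    using assms keys_add[of p q] by (auto simp: carrier_poly_ring)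
  show "p * q \<in> carrier (poly_ring V)" unfolding carrier_poly_ring
  proof
    fix t assume "t \<in> keys (p * q)"
    then obtain a b where "t = a + b" "a \<in> keys p" "b \<in> keys q"
      using keys_mult[of p q] by blast
    then show "keys t \<subseteq> V" using assms keys_add[of a b] by (fastforce simp: carrier_poly_ring)
  qed
qed

lemma poly_ring_0_1 [simp]: "0 \<in> carrier (poly_ring V)" "1 \<in> carrier (poly_ring V)"
  by (simp_all add: carrier_poly_ring)

lemma poly_ring_sum: "(\<And>k. k \<in> A \<Longrightarrow> f k \<in> carrier (poly_ring V)) \<Longrightarrow> sum f A \<in> carrier (poly_ring V)"
  by (induction A rule: infinite_finite_induct) (auto intro: poly_ring_closed)

lemma graded_pieces_forms: "graded_pieces (forms V w :: 'g::ab_group_add \<Rightarrow> ('v, 'k::field) mpoly set)"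
proof
  fix p q :: "('v, 'k) mpoly" and g h
  show "0 \<in> forms V w g" "1 \<in> forms V w 0" by (auto simp: forms_iff)
  show "p + q \<in> forms V w g" if "p \<in> forms V w g" "q \<in> forms V w g"
    using that keys_add[of p q] by (fastforce simp: forms_iff)
  show "- p \<in> forms V w g" if "p \<in> forms V w g" using that by (simp add: forms_iff)
  show "p * q \<in> forms V w (g + h)" if "p \<in> forms V w g" "q \<in> forms V w h"
    unfolding forms_iff
  proof
    fix t assume "t \<in> keys (p * q)"
    then obtain a b where "t = a + b" "a \<in> keys p" "b \<in> keys q"
      using keys_mult[of p q] by blast
    then show "keys t \<subseteq> V \<and> mdeg w t = g + h"
      using that keys_add[of a b] by (fastforce simp: forms_iff mdeg_add)
  qed
qed

lemma forms_carrier: "p \<in> forms V w g \<Longrightarrow> p \<in> carrier (poly_ring V)"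
  by (simp add: forms_def)

lemma lookup_0_forms: "p \<in> forms V w g \<Longrightarrow> g \<noteq> 0 \<Longrightarrow> lookup p 0 = 0"
  using lookup_not_eq_zero_eq_in_keys[of p 0] by (fastforce simp: forms_iff)

definition hcomp :: "('v \<Rightarrow> 'g::ab_group_add) \<Rightarrow> 'g \<Rightarrow> ('v, 'k::field) mpoly \<Rightarrow> ('v, 'k) mpoly" where
  "hcomp w g p = Poly_Mapping.mapp (\<lambda>t c. c when mdeg w t = g) p"

lemma lookup_hcomp: "lookup (hcomp w g p) t = (lookup p t when mdeg w t = g)"
  by (simp add: hcomp_def lookup_mapp in_keys_iff when_def)

lemma hcomp_add: "hcomp w g (p + q) = hcomp w g p + hcomp w g q"
  by (rule poly_mapping_eqI) (simp add: lookup_hcomp lookup_add when_add_distrib)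

lemma hcomp_forms: "p \<in> carrier (poly_ring V) \<Longrightarrow> hcomp w g p \<in> forms V w g"
  by (auto simp: forms_iff in_keys_iff lookup_hcomp carrier_poly_ring)

lemma hcomp_form: "p \<in> forms V w h \<Longrightarrow> hcomp w g p = (if g = h then p else 0)"
  by (intro poly_mapping_eqI) (auto simp: lookup_hcomp when_def forms_iff in_keys_iff)

lemma hcomp_sum_superset:
  assumes "finite D" "mdeg w ` keys p \<subseteq> D"
  shows "(\<Sum>g\<in>D. hcomp w g p) = p"
proof (rule poly_mapping_eqI)
  fix t
  have "(\<Sum>g\<in>D. lookup p t when mdeg w t = g) = lookup p t"
  proof (cases "mdeg w t \<in> D")
    case True with assms(1) show ?thesis by (simp add: when_def)
  next
    case False
    with assms(2) have "t \<notin> keys p" by blast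
    then have "lookup p t = 0" by (simp add: in_keys_iff)
    then show ?thesis by simp
  qed
  then show "lookup (\<Sum>g\<in>D. hcomp w g p) t = lookup p t"
    by (simp add: lookup_sum lookup_hcomp)
qed

lemma hcomp_eq_0: "g \<notin> mdeg w ` keys p \<Longrightarrow> hcomp w g p = 0"
  by (intro poly_mapping_eqI) (auto simp: lookup_hcomp when_def in_keys_iff)

section \<open>Strands of a resolution\<close>

text \<open>The ring \<open>R = poly_ring V\<close> is graded by \<open>'g\<close> and contains \<open>S\<close> via \<open>\<rho>\<close>; \<open>\<iota>\<close> embeds the degrees of
  \<open>S\<close>, and \<open>\<alpha>\<close> extracts the \<open>x\<close>-degree. If \<open>\<alpha> h = 0\<close>, then \<open>Y h 0, Y h 1, \<dots>\<close> is an \<open>S\<close>-basis of the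
  strand of \<open>R\<close> through \<open>h\<close>. The case \<open>R = S\<close> is included to treat resolutions over \<open>S\<close> as well.\<close>

locale strand_data =
  fixes n :: nat and V :: "'v set" and w :: "'v \<Rightarrow> 'g::ab_group_add"
    and \<rho> :: "(nat, 'k::field) mpoly \<Rightarrow> ('v, 'k) mpoly"
    and \<iota> :: "int \<Rightarrow> 'g" and \<alpha> :: "'g \<Rightarrow> int"
    and ylen :: "'g \<Rightarrow> nat" and Y :: "'g \<Rightarrow> nat \<Rightarrow> ('v, 'k) mpoly"
  assumes \<rho>_add: "\<rho> (b + c) = \<rho> b + \<rho> c" and \<rho>_mult: "\<rho> (b * c) = \<rho> b * \<rho> c" and \<rho>_1: "\<rho> 1 = 1"
    and \<rho>_forms: "c \<in> forms {..<n} S_wt a \<Longrightarrow> \<rho> c \<in> forms V w (\<iota> a)"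
    and \<iota>_add: "\<iota> (a + a') = \<iota> a + \<iota> a'" and \<alpha>_add: "\<alpha> (g + h) = \<alpha> g + \<alpha> h" and \<alpha>_\<iota>: "\<alpha> (\<iota> a) = a"
    and Y_forms: "\<alpha> h = 0 \<Longrightarrow> q < ylen h \<Longrightarrow> Y h q \<in> forms V w h"
    and Y_span: "\<alpha> h = 0 \<Longrightarrow> f \<in> forms V w (h + \<iota> a) \<Longrightarrow>
      \<exists>c. (\<forall>q<ylen h. c q \<in> forms {..<n} S_wt a) \<and> f = (\<Sum>q<ylen h. \<rho> (c q) * Y h q)"
    and Y_indep: "\<alpha> h = 0 \<Longrightarrow> \<forall>q<ylen h. e q \<in> forms {..<n} S_wt a \<Longrightarrow>
      (\<Sum>q<ylen h. \<rho> (e q) * Y h q) = 0 \<Longrightarrow> \<forall>q<ylen h. e q = 0"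
begin

abbreviation SF :: "int \<Rightarrow> (nat, 'k) mpoly set" where "SF \<equiv> forms {..<n} S_wt"
abbreviation RF :: "'g \<Rightarrow> ('v, 'k) mpoly set" where "RF \<equiv> forms V w"

sublocale S: int_graded_pieces SF
  unfolding int_graded_pieces_def by (rule graded_pieces_forms)

sublocale R: graded_pieces RF
  by (rule graded_pieces_forms)

sublocale \<rho>: additive \<rho> by unfold_locales (rule \<rho>_add)
sublocale \<iota>: additive \<iota> by unfold_locales (rule \<iota>_add)
sublocale \<alpha>: additive \<alpha> by unfold_locales (rule \<alpha>_add)

definition strand :: "'g \<Rightarrow> ('g \<Rightarrow> 'm set) \<Rightarrow> int \<Rightarrow> 'm set" where
  "strand g H a = H (g + \<iota> a)"

definition ssc :: "(('v, 'k) mpoly \<Rightarrow> 'm \<Rightarrow> 'm) \<Rightarrow> (nat, 'k) mpoly \<Rightarrow> 'm \<Rightarrow> 'm" where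
  "ssc sc a x = sc (\<rho> a) x"

lemma module_ssc:
  assumes "Modules.module sc" shows "Modules.module (ssc sc)"
proof -
  interpret Modules.module sc by fact
  show ?thesis by unfold_locales (simp_all add: ssc_def \<rho>_add \<rho>_mult \<rho>_1 algebra_simps)
qed

lemma graded_sub_strand:
  assumes "R.graded_sub sc H" shows "S.graded_sub (ssc sc) (strand g H)"
proof -
  note D = R.graded_subD[OF assms]
  have "ssc sc a x \<in> strand g H (p + q)" if "a \<in> SF p" "x \<in> strand g H q" for a x p q
    using D(5)[OF \<rho>_forms[OF that(1)], of x "g + \<iota> q"] that(2)
    by (simp add: strand_def ssc_def \<iota>_add add_ac)
  then show ?thesis
    using D(2-4) module_ssc[OF D(1)] unfolding S.graded_sub_def by (simp add: strand_def)
qed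

end

section \<open>Generators and syzygies of a single strand\<close>

locale strand_cover = strand_data n V w \<rho> \<iota> \<alpha> ylen Y
  for n :: nat and V :: "'v set" and w :: "'v \<Rightarrow> 'g::ab_group_add"
    and \<rho> :: "(nat, 'k::field) mpoly \<Rightarrow> ('v, 'k) mpoly"
    and \<iota> :: "int \<Rightarrow> 'g" and \<alpha> :: "'g \<Rightarrow> int"
    and ylen :: "'g \<Rightarrow> nat" and Y :: "'g \<Rightarrow> nat \<Rightarrow> ('v, 'k) mpoly" +
  fixes sc :: "('v, 'k) mpoly \<Rightarrow> 'm::ab_group_add \<Rightarrow> 'm" and H :: "'g \<Rightarrow> 'm set"
    and l :: nat and s :: "nat \<Rightarrow> 'g" and x :: "nat \<Rightarrow> 'm"
  assumes H: "R.graded_sub sc H" and gen: "R.gen sc l s x H"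
begin

sublocale M: Modules.module sc using H by (rule R.graded_subD(1))

text \<open>Nakayama: an expression of \<open>x k\<close> by generators of the strand in smaller degrees is a syzygy
  with constant coefficient \<open>1\<close> at \<open>k\<close>.\<close>

lemma generator_bound:
  assumes min: "\<forall>g. \<forall>u\<in>R.Syz sc l s x g. \<forall>k. lookup (u k) 0 = 0"
    and gen': "S.gen (ssc sc) l' s' x' (strand g0 H)" and s': "\<forall>j<l'. s' j \<le> r"
    and k: "k < l" "s k = g0 + \<iota> a"
  shows "a \<le> r"
proof (rule ccontr)
  assume a: "\<not> a \<le> r"
  have "x k \<in> strand g0 H a" using R.gen_mem[OF gen k(1)] by (simp add: strand_def k(2))
  from S.genD[OF gen' this] obtain c where c: "\<And>j. j < l' \<Longrightarrow> c j \<in> SF (a - s' j)"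
    "x k = (\<Sum>j<l'. ssc sc (c j) (x' j))" by blast
  obtain u where u: "\<And>j i. j < l' \<Longrightarrow> i < l \<Longrightarrow> u j i \<in> RF (g0 + \<iota> (s' j) - s i)"
    "\<And>j. j < l' \<Longrightarrow> x' j = (\<Sum>i<l. sc (u j i) (x i))"
    using R.gen_matrix[OF gen, of l' x' "\<lambda>j. g0 + \<iota> (s' j)"] S.gen_mem[OF gen'] strand_def by metis
  define v where "v i = (if i < l then (\<Sum>j<l'. \<rho> (c j) * u j i) else 0)" for i
  have v: "v i \<in> RF (s k - s i)" if "i < l" for i
  proof -
    have "\<rho> (c j) * u j i \<in> RF (s k - s i)" if "j < l'" for j
      by (rule R.Rg_mult'[OF \<rho>_forms[OF c(1)[OF that]] u(1)[OF that \<open>i < l\<close>]])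
        (simp add: k(2) \<iota>.diff)
    then have "(\<Sum>j<l'. \<rho> (c j) * u j i) \<in> RF (s k - s i)" by (intro R.Rg_sum) simp
    then show ?thesis using that by (simp add: v_def)
  qed
  have v0: "lookup (v i) 0 = 0" for i
  proof -
    have "lookup (\<rho> (c j)) 0 = 0" if "j < l'" for j
    \<comment> \<open>As \<open>s' j \<le> r < a\<close>, the coefficient \<open>c j\<close> has
      nonzero degree and hence no constant term.\<close>
    proof (rule lookup_0_forms[OF \<rho>_forms[OF c(1)[OF that]]])
      have "a - s' j \<noteq> 0" using a s' that by force
      then show "\<iota> (a - s' j) \<noteq> 0" using \<alpha>_\<iota>[of "a - s' j"] \<alpha>.zero by auto
    qed
    then show ?thesis by (simp add: v_def lookup_sum lookup_mult_0)
  qed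
  have "x k = (\<Sum>i<l. sc (v i) (x i))"
  proof -
    have "x k = (\<Sum>j<l'. \<Sum>i<l. sc (\<rho> (c j) * u j i) (x i))"
      using c(2) by (simp add: ssc_def u(2) M.scale_sum_right)
    also have "\<dots> = (\<Sum>i<l. sc (v i) (x i))"
      by (subst sum.swap) (simp add: v_def M.scale_sum_left)
    finally show ?thesis .
  qed
  moreover have "(\<Sum>i<l. sc (if i = k then 1 else 0) (x i)) = x k"
    by (rule sum_scale_unit[OF M.module_axioms k(1)])
  ultimately have "(\<Sum>i<l. sc ((if i = k then 1 else 0) - v i) (x i)) = 0"
    by (simp add: M.scale_left_diff_distrib sum_subtractf)
  then have "(\<lambda>i. (if i = k then 1 else 0) - v i) \<in> R.Syz sc l s x (s k)"
    using k(1) R.Rg_diff[OF _ v, of "if _ = k then 1 else 0"] R.Rg_one R.Rg_zero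
    by (auto simp: R.Syz_def v_def)
  from min[rule_format, OF this, of k] show False using v0[of k] by (simp add: lookup_minus)
qed

context
  fixes g0 :: 'g
begin

text \<open>The degree with \<open>x\<close>-part zero that moves \<open>x k\<close> into the strand
  through \<open>g0\<close>: the product of \<open>Y (yd k) q\<close> and \<open>x k\<close> has
  degree \<open>g0 + \<iota> (\<alpha> (s k) - \<alpha> g0)\<close>, whence the formula for
  \<open>strand_deg\<close>.\<close>

definition yd :: "nat \<Rightarrow> 'g" where
  "yd k = g0 - s k + \<iota> (\<alpha> (s k) - \<alpha> g0)"

definition ix :: "(nat \<times> nat) set" where
  "ix = Sigma {..<l} (\<lambda>k. {..<ylen (yd k)})"

text \<open>Generating systems are indexed by initial segments of the naturals, so the pairs
  \<open>(k, q)\<close> have to be flattened.\<close>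

definition enum_ix :: "nat \<Rightarrow> nat \<times> nat" where
  "enum_ix = (SOME f. bij_betw f {..<card ix} ix)"

definition index_of :: "nat \<times> nat \<Rightarrow> nat" where
  "index_of = inv_into {..<card ix} enum_ix"

definition strand_deg :: "nat \<Rightarrow> int" where
  "strand_deg p = \<alpha> (s (fst (enum_ix p))) - \<alpha> g0"

definition strand_gen :: "nat \<Rightarrow> 'm" where
  "strand_gen p = (case enum_ix p of (k, q) \<Rightarrow> sc (Y (yd k) q) (x k))"

text \<open>Collects the \<open>S\<close>-coefficients belonging to one \<open>x k\<close> into a
  single \<open>R\<close>-coefficient. Because \<open>Y\<close> is an \<open>S\<close>-basis, this
  identifies the free \<open>S\<close>-module on the strand generators with a strand of the free
  \<open>R\<close>-module.\<close>

definition to_R :: "(nat \<Rightarrow> (nat, 'k) mpoly) \<Rightarrow> nat \<Rightarrow> ('v, 'k) mpoly" where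
  "to_R c k = (if k < l then \<Sum>q<ylen (yd k). \<rho> (c (index_of (k, q))) * Y (yd k) q else 0)"

lemma yd: "\<alpha> (yd k) = 0"
  by (simp add: yd_def \<alpha>_add \<alpha>.diff \<alpha>_\<iota>)

lemma degree_split: "g0 + \<iota> a - s k = yd k + \<iota> (a - (\<alpha> (s k) - \<alpha> g0))"
  by (simp add: yd_def \<iota>_add \<iota>.diff algebra_simps)

lemma bij_enum_ix: "bij_betw enum_ix {..<card ix} ix"
proof -
  have "finite ix" by (simp add: ix_def)
  then have "\<exists>f. bij_betw f {..<card ix} ix"
    using ex_bij_betw_nat_finite by (metis atLeast0LessThan)
  then show ?thesis unfolding enum_ix_def by (rule someI_ex)
qed

lemma enum_ix_mem: "p < card ix \<Longrightarrow> enum_ix p \<in> ix"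
  using bij_enum_ix by (auto simp: bij_betw_def)

lemma index_of: "z \<in> ix \<Longrightarrow> index_of z < card ix" "z \<in> ix \<Longrightarrow> enum_ix (index_of z) = z"
  "p < card ix \<Longrightarrow> index_of (enum_ix p) = p"
proof -
  show "z \<in> ix \<Longrightarrow> index_of z < card ix" "z \<in> ix \<Longrightarrow> enum_ix (index_of z) = z"
    using bij_enum_ix unfolding index_of_def bij_betw_def
    by (metis inv_into_into lessThan_iff, metis f_inv_into_f)
  show "p < card ix \<Longrightarrow> index_of (enum_ix p) = p"
    using bij_enum_ix unfolding index_of_def by (auto simp: bij_betw_def inv_into_f_f)
qed

lemma sum_enum_ix: "(\<Sum>p<card ix. f (enum_ix p)) = (\<Sum>k<l. \<Sum>q<ylen (yd k). f (k, q))"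
proof -
  have "(\<Sum>p<card ix. f (enum_ix p)) = sum f ix"
    by (rule sum.reindex_bij_betw[OF bij_enum_ix])
  also have "\<dots> = (\<Sum>k<l. \<Sum>q<ylen (yd k). f (k, q))"
    unfolding ix_def by (subst sum.Sigma) auto
  finally show ?thesis .
qed

lemma comb_to_R:
  "(\<Sum>p<card ix. ssc sc (c p) (strand_gen p)) = (\<Sum>k<l. sc (to_R c k) (x k))"
proof -
  have "(\<Sum>p<card ix. ssc sc (c p) (strand_gen p)) =
      (\<Sum>p<card ix. (\<lambda>(k, q). sc (\<rho> (c (index_of (k, q)))) (sc (Y (yd k) q) (x k))) (enum_ix p))"
    by (rule sum.cong) (auto simp: ssc_def strand_gen_def index_of(3) split: prod.splits, metis index_of(3))
  also have "\<dots> = (\<Sum>k<l. \<Sum>q<ylen (yd k). sc (\<rho> (c (index_of (k, q)))) (sc (Y (yd k) q) (x k)))"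
    by (subst sum_enum_ix) simp
  finally show ?thesis by (simp add: to_R_def M.scale_sum_left)
qed

lemma to_R_surj:
  assumes u: "\<And>k. k < l \<Longrightarrow> u k \<in> RF (g0 + \<iota> a - s k)" "\<And>k. k \<ge> l \<Longrightarrow> u k = 0"
  obtains c where "\<And>p. p < card ix \<Longrightarrow> c p \<in> SF (a - strand_deg p)" "\<And>p. p \<ge> card ix \<Longrightarrow> c p = 0" "to_R c = u"
proof -
  have "\<exists>c. (\<forall>q<ylen (yd k). c q \<in> SF (a - (\<alpha> (s k) - \<alpha> g0))) \<and> u k = (\<Sum>q<ylen (yd k). \<rho> (c q) * Y (yd k) q)"
    if "k < l" for k
    using Y_span[OF yd] u(1)[OF that] by (simp only: degree_split)
  then have "\<forall>k\<in>{..<l}. \<exists>c. (\<forall>q<ylen (yd k). c q \<in> SF (a - (\<alpha> (s k) - \<alpha> g0))) \<and>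
      u k = (\<Sum>q<ylen (yd k). \<rho> (c q) * Y (yd k) q)" by blast
  from bchoice[OF this] obtain b where b: "\<And>k q. k < l \<Longrightarrow> q < ylen (yd k) \<Longrightarrow> b k q \<in> SF (a - (\<alpha> (s k) - \<alpha> g0))"
    "\<And>k. k < l \<Longrightarrow> u k = (\<Sum>q<ylen (yd k). \<rho> (b k q) * Y (yd k) q)" by auto
  define c where "c p = (if p < card ix then case_prod b (enum_ix p) else 0)" for p
  show thesis
  proof (rule that[of c])
    show "c p \<in> SF (a - strand_deg p)" if "p < card ix" for p
      using b(1) enum_ix_mem[OF that] that by (auto simp: c_def strand_deg_def ix_def split: prod.splits)
    have "c (index_of (k, q)) = b k q" if "k < l" "q < ylen (yd k)" for k q
      using index_of(1,2)[of "(k, q)"] that by (simp add: c_def ix_def)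
    then show "to_R c = u" using b(2) u(2) by (intro ext) (simp add: to_R_def)
  qed (simp add: c_def)
qed

lemma to_R_forms:
  assumes c: "\<And>p. p < card ix \<Longrightarrow> c p \<in> SF (a - strand_deg p)" and k: "k < l"
  shows "to_R c k \<in> RF (g0 + \<iota> a - s k)"
proof -
  have "\<rho> (c (index_of (k, q))) * Y (yd k) q \<in> RF (g0 + \<iota> a - s k)" if "q < ylen (yd k)" for q
  proof (rule R.Rg_mult'[OF \<rho>_forms Y_forms[OF yd that]])
    have "(k, q) \<in> ix" using k that by (simp add: ix_def)
    then show "c (index_of (k, q)) \<in> SF (a - (\<alpha> (s k) - \<alpha> g0))"
      using c[of "index_of (k, q)"] by (simp add: index_of strand_deg_def)
  qed (simp add: degree_split add.commute)
  then have "(\<Sum>q<ylen (yd k). \<rho> (c (index_of (k, q))) * Y (yd k) q) \<in> RF (g0 + \<iota> a - s k)"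
    by (intro R.Rg_sum) simp
  then show ?thesis using k by (simp add: to_R_def)
qed

lemma to_R_inj:
  assumes c: "\<And>p. p < card ix \<Longrightarrow> c p \<in> SF (a - strand_deg p)" "\<And>p. p \<ge> card ix \<Longrightarrow> c p = 0"
    and 0: "to_R c = 0"
  shows "c = 0"
proof
  fix p show "c p = 0 p"
  proof (cases "p < card ix")
    case True
    obtain k q where kq: "enum_ix p = (k, q)" by fastforce
    then have k: "k < l" and q: "q < ylen (yd k)" using enum_ix_mem[OF True] by (auto simp: ix_def)
    have "c (index_of (k, q')) \<in> SF (a - (\<alpha> (s k) - \<alpha> g0))" if "q' < ylen (yd k)" for q'
      using c(1)[of "index_of (k, q')"] index_of(1,2)[of "(k, q')"] that k by (simp add: ix_def strand_deg_def)
    moreover have "(\<Sum>q<ylen (yd k). \<rho> (c (index_of (k, q))) * Y (yd k) q) = 0"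
      using fun_cong[OF 0, of k] k by (simp add: to_R_def)
    ultimately have "c (index_of (k, q)) = 0"
      using Y_indep[OF yd, of k "\<lambda>q. c (index_of (k, q))"] q by blast
    then show ?thesis using index_of(3)[OF True] kq by simp
  qed (use c(2) in simp)
qed

lemma gen_strand: "S.gen (ssc sc) (card ix) strand_deg strand_gen (strand g0 H)"
proof (rule S.genI)
  fix p assume "p < card ix"
  then obtain k q where kq: "enum_ix p = (k, q)" "k < l" "q < ylen (yd k)"
    using enum_ix_mem by (fastforce simp: ix_def)
  have "sc (Y (yd k) q) (x k) \<in> H (yd k + s k)"
    by (intro R.graded_subD(5)[OF H] Y_forms yd kq R.gen_mem[OF gen])
  then show "strand_gen p \<in> strand g0 H (strand_deg p)"
    by (simp add: strand_gen_def strand_def strand_deg_def kq(1) yd_def)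
next
  fix a y assume "y \<in> strand g0 H a"
  then obtain u0 where u0: "\<And>k. k < l \<Longrightarrow> u0 k \<in> RF (g0 + \<iota> a - s k)" "y = (\<Sum>k<l. sc (u0 k) (x k))"
    using R.genE[OF gen] unfolding strand_def by metis
  define u where "u k = (if k < l then u0 k else 0)" for k
  obtain c where c: "\<And>p. p < card ix \<Longrightarrow> c p \<in> SF (a - strand_deg p)" "to_R c = u"
    using to_R_surj[of u a] u0(1) by (auto simp: u_def)
  show "\<exists>c. (\<forall>p<card ix. c p \<in> SF (a - strand_deg p)) \<and> y = (\<Sum>p<card ix. ssc sc (c p) (strand_gen p))"
    by (rule exI[of _ c]) (simp add: c comb_to_R u0 u_def)
qed

text \<open>By \<open>comb_to_R\<close>, the bijection \<open>to_R\<close> respects the combinations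
  on both sides, so it restricts to a degreewise bijection between the relations.\<close>

lemma lin_Syz_strand:
  "S.lin vscale p r (S.Syz (ssc sc) (card ix) strand_deg strand_gen) \<longleftrightarrow>
   S.lin (ssc vscale) p r (strand g0 (R.Syz sc l s x))"
proof (rule S.lin_image_iff[symmetric, where \<phi> = to_R])
  show "S.graded_sub vscale (S.Syz (ssc sc) (card ix) strand_deg strand_gen)"
    by (intro S.graded_sub_Syz module_ssc M.module_axioms)
  show "\<forall>g. \<forall>c\<in>S.Syz (ssc sc) (card ix) strand_deg strand_gen g. to_R c = 0 \<longrightarrow> c = 0"
    using to_R_inj unfolding S.Syz_def by blast
  show "to_R (c + d) = to_R c + to_R d" for c d
    by (auto simp: to_R_def fun_eq_iff \<rho>_add distrib_right sum.distrib)
  show "to_R (vscale a c) = ssc vscale a (to_R c)" for a c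
    by (auto simp: to_R_def fun_eq_iff \<rho>_mult ssc_def sum_distrib_left mult.assoc)
  show "to_R ` S.Syz (ssc sc) (card ix) strand_deg strand_gen a = strand g0 (R.Syz sc l s x) a" for a
  proof (intro equalityI subsetI)
    fix u assume "u \<in> to_R ` S.Syz (ssc sc) (card ix) strand_deg strand_gen a"
    then show "u \<in> strand g0 (R.Syz sc l s x) a"
      using to_R_forms by (auto simp: S.Syz_def R.Syz_def strand_def comb_to_R) (simp add: to_R_def)
  next
    fix u assume "u \<in> strand g0 (R.Syz sc l s x) a"
    then have u: "\<And>k. k < l \<Longrightarrow> u k \<in> RF (g0 + \<iota> a - s k)" "\<And>k. k \<ge> l \<Longrightarrow> u k = 0"
      "(\<Sum>k<l. sc (u k) (x k)) = 0" by (auto simp: R.Syz_def strand_def)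
    obtain c where c: "\<And>p. p < card ix \<Longrightarrow> c p \<in> SF (a - strand_deg p)" "\<And>p. p \<ge> card ix \<Longrightarrow> c p = 0" "to_R c = u"
      using to_R_surj[of u a] u(1,2) by metis
    then have "c \<in> S.Syz (ssc sc) (card ix) strand_deg strand_gen a"
      using u(3) by (simp add: S.Syz_def comb_to_R)
    with c(3) show "u \<in> to_R ` S.Syz (ssc sc) (card ix) strand_deg strand_gen a" by blast
  qed
qed

lemma strand_deg_le:
  assumes "\<forall>k<l. \<alpha> (s k) \<le> r"
  shows "\<forall>p<card ix. strand_deg p \<le> r - \<alpha> g0"
  using enum_ix_mem assms by (fastforce simp: strand_deg_def ix_def)

text \<open>Taking syzygies commutes with passing to a strand. From left to right
  \<open>lin_SucD\<close> is essential, since the generators behind the assumed bound may differ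
  from \<open>strand_gen\<close>.\<close>

lemma lin_strand_Suc_iff:
  assumes "\<forall>k<l. \<alpha> (s k) \<le> r"
  shows "S.lin (ssc sc) (Suc p) (r - \<alpha> g0) (strand g0 H) \<longleftrightarrow>
    S.lin (ssc vscale) p (r - \<alpha> g0 + 1) (strand g0 (R.Syz sc l s x))"
  using S.linI[OF gen_strand strand_deg_le[OF assms]]
    S.lin_SucD[OF graded_sub_strand[OF H] _ gen_strand strand_deg_le[OF assms]] lin_Syz_strand
  by blast

end

end

text \<open>In position \<open>i\<close>, a minimal free resolution of \<open>H\<close> has rank \<open>L i\<close> and shifts \<open>s i\<close>; \<open>Z i\<close> is the
  \<open>(i + 1)\<close>-st syzygy module, generated by the images \<open>x i\<close> of the basis vectors in position \<open>i + 1\<close>.\<close>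

definition minimal_chain ::
  "'v set \<Rightarrow> ('v \<Rightarrow> 'g::ab_group_add) \<Rightarrow> (('v, 'k::field) mpoly \<Rightarrow> 'm::ab_group_add \<Rightarrow> 'm) \<Rightarrow> ('g \<Rightarrow> 'm set) \<Rightarrow>
    (nat \<Rightarrow> nat) \<Rightarrow> (nat \<Rightarrow> nat \<Rightarrow> 'g) \<Rightarrow> (nat \<Rightarrow> 'm) \<Rightarrow> (nat \<Rightarrow> nat \<Rightarrow> nat \<Rightarrow> ('v, 'k) mpoly) \<Rightarrow>
    (nat \<Rightarrow> 'g \<Rightarrow> (nat \<Rightarrow> ('v, 'k) mpoly) set) \<Rightarrow> bool" where
  "minimal_chain V w sc H L s x0 x Z \<longleftrightarrow>
     graded_pieces.gen (forms V w) sc (L 0) (s 0) x0 H \<and>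
     Z 0 = graded_pieces.Syz (forms V w) sc (L 0) (s 0) x0 \<and>
     (\<forall>i. graded_pieces.gen (forms V w) vscale (L (Suc i)) (s (Suc i)) (x i) (Z i)) \<and>
     (\<forall>i. Z (Suc i) = graded_pieces.Syz (forms V w) vscale (L (Suc i)) (s (Suc i)) (x i)) \<and>
     (\<forall>i g. \<forall>u\<in>Z i g. \<forall>k. lookup (u k) 0 = 0)"

section \<open>Shifts of a minimal resolution and regularity of strands\<close>

context strand_data begin

text \<open>\<open>G0\<close> meets every line of degrees, so each generator lies on one of the
  strands considered, where \<open>generator_bound\<close> limits its degree.\<close>

lemma one_step:
  assumes H: "R.graded_sub sc H" and gen: "R.gen sc l s x H"
    and min: "\<forall>g. \<forall>u\<in>R.Syz sc l s x g. \<forall>k. lookup (u k) 0 = 0"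
    and G0: "\<And>g. \<exists>g0\<in>G0. \<exists>a. g = g0 + \<iota> a"
  shows "(\<forall>p. \<forall>g0\<in>G0. S.lin (ssc sc) p (r - \<alpha> g0) (strand g0 H)) \<longleftrightarrow>
    (\<forall>k<l. \<alpha> (s k) \<le> r) \<and>
    (\<forall>p. \<forall>g0\<in>G0. S.lin (ssc vscale) p (r + 1 - \<alpha> g0) (strand g0 (R.Syz sc l s x)))"
proof -
  interpret strand_cover n V w \<rho> \<iota> \<alpha> ylen Y sc H l s x
    by unfold_locales (rule H, rule gen)
  have eq: "r - \<alpha> g0 + 1 = r + 1 - \<alpha> g0" for g0 by simp
  have "\<alpha> (s k) \<le> r" if k: "k < l" and lin: "\<forall>p. \<forall>g0\<in>G0. S.lin (ssc sc) p (r - \<alpha> g0) (strand g0 H)" for k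
  proof -
    obtain g0 a where g0: "g0 \<in> G0" "s k = g0 + \<iota> a" using G0 by blast
    from lin g0(1) have "S.lin (ssc sc) (Suc 0) (r - \<alpha> g0) (strand g0 H)" by blast
    then obtain l' s' x' where "S.gen (ssc sc) l' s' x' (strand g0 H)" "\<forall>j<l'. s' j \<le> r - \<alpha> g0"
      by (rule S.linE)
    from generator_bound[OF min this k g0(2)] show ?thesis by (simp add: g0(2) \<alpha>_add \<alpha>_\<iota>)
  qed
  moreover have "(\<forall>p. \<forall>g0\<in>G0. S.lin (ssc sc) p (r - \<alpha> g0) (strand g0 H)) \<longleftrightarrow>
      (\<forall>p. \<forall>g0\<in>G0. S.lin (ssc vscale) p (r + 1 - \<alpha> g0) (strand g0 (R.Syz sc l s x)))"
    if s: "\<forall>k<l. \<alpha> (s k) \<le> r"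
  proof -
    \<comment> \<open>The bound for \<open>0\<close> steps is void, so \<open>p\<close> may be
      replaced by \<open>Suc p\<close> under the quantifier.\<close>
    have "(\<forall>p. \<forall>g0\<in>G0. S.lin (ssc sc) p (r - \<alpha> g0) (strand g0 H)) \<longleftrightarrow>
        (\<forall>p. \<forall>g0\<in>G0. S.lin (ssc sc) (Suc p) (r - \<alpha> g0) (strand g0 H))"
      by (metis S.lin_0 not0_implies_Suc)
    then show ?thesis by (simp only: lin_strand_Suc_iff[OF s] eq)
  qed
  ultimately show ?thesis by blast
qed

text \<open>Here \<open>p\<close> is fixed, which makes the statement usable as the step of an
  induction on \<open>p\<close>.\<close>

lemma one_step_lin:
  assumes H: "R.graded_sub sc H" and gen: "R.gen sc l s x H" and s: "\<forall>k<l. \<alpha> (s k) \<le> r"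
    and lin: "\<forall>g0\<in>G0. S.lin (ssc vscale) p (r + 1 - \<alpha> g0) (strand g0 (R.Syz sc l s x))"
  shows "\<forall>g0\<in>G0. S.lin (ssc sc) (Suc p) (r - \<alpha> g0) (strand g0 H)"
proof -
  interpret strand_cover n V w \<rho> \<iota> \<alpha> ylen Y sc H l s x
    by unfold_locales (rule H, rule gen)
  have eq: "r - \<alpha> g0 + 1 = r + 1 - \<alpha> g0" for g0 by simp
  show ?thesis using lin unfolding lin_strand_Suc_iff[OF s, where p = p] eq .
qed

theorem shifts_le_iff_strands_lin:
  assumes chain: "minimal_chain V w sc H L s x0 x Z" and H: "R.graded_sub sc H"
    and G0: "\<And>g. \<exists>g0\<in>G0. \<exists>a. g = g0 + \<iota> a"
  shows "(\<forall>i. \<forall>k<L i. \<alpha> (s i k) \<le> r + int i) \<longleftrightarrow>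
    (\<forall>p. \<forall>g0\<in>G0. S.lin (ssc sc) p (r - \<alpha> g0) (strand g0 H))"
proof -
  have gen0: "R.gen sc (L 0) (s 0) x0 H" and Z0: "Z 0 = R.Syz sc (L 0) (s 0) x0"
    and gen: "\<And>i. R.gen vscale (L (Suc i)) (s (Suc i)) (x i) (Z i)"
    and Z: "\<And>i. Z (Suc i) = R.Syz vscale (L (Suc i)) (s (Suc i)) (x i)"
    and min: "\<And>i. \<forall>g. \<forall>u\<in>Z i g. \<forall>k. lookup (u k) 0 = 0"
    using chain unfolding minimal_chain_def by blast+
  have ZS: "R.graded_sub vscale (Z i)" for i
  proof (cases i)
    case 0 then show ?thesis using Z0 R.graded_sub_Syz[OF R.graded_subD(1)[OF H]] by simp
  next
    case (Suc j) then show ?thesis using Z R.graded_sub_Syz[OF module_vscale] by simp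
  qed
  define Q where "Q i \<longleftrightarrow> (\<forall>p. \<forall>g0\<in>G0. S.lin (ssc vscale) p (r + int i + 1 - \<alpha> g0) (strand g0 (Z i)))" for i
  have base: "(\<forall>p. \<forall>g0\<in>G0. S.lin (ssc sc) p (r - \<alpha> g0) (strand g0 H)) \<longleftrightarrow> (\<forall>k<L 0. \<alpha> (s 0 k) \<le> r) \<and> Q 0"
    unfolding Q_def Z0 using one_step[OF H gen0 min[of 0, unfolded Z0] G0, of r] by simp
  have step: "Q i \<longleftrightarrow> (\<forall>k<L (Suc i). \<alpha> (s (Suc i) k) \<le> r + int (Suc i)) \<and> Q (Suc i)" for i
    unfolding Q_def Z using one_step[OF ZS gen min[of "Suc i", unfolded Z] G0, of "r + int i + 1"]
    by (simp add: algebra_simps)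
  show ?thesis
  proof
    assume s: "\<forall>i. \<forall>k<L i. \<alpha> (s i k) \<le> r + int i"
    have "\<forall>g0\<in>G0. S.lin (ssc vscale) p (r + int i + 1 - \<alpha> g0) (strand g0 (Z i))" for p i
    proof (induction p arbitrary: i)
      case (Suc p)
      show ?case
      proof (rule one_step_lin[OF ZS gen])
        show "\<forall>k<L (Suc i). \<alpha> (s (Suc i) k) \<le> r + int i + 1"
          using s[rule_format, of _ "Suc i"] by (simp add: algebra_simps)
        show "\<forall>g0\<in>G0. S.lin (ssc vscale) p (r + int i + 1 + 1 - \<alpha> g0)
            (strand g0 (R.Syz vscale (L (Suc i)) (s (Suc i)) (x i)))"
          using Suc.IH[of "Suc i"] by (simp add: Z algebra_simps del: vscale_apply)
      qed
    qed (simp add: S.lin_0)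
    then have "Q 0" unfolding Q_def by blast
    moreover have "\<forall>k<L 0. \<alpha> (s 0 k) \<le> r" using s[rule_format, of _ 0] by simp
    ultimately show "\<forall>p. \<forall>g0\<in>G0. S.lin (ssc sc) p (r - \<alpha> g0) (strand g0 H)" using base by blast
  next
    assume "\<forall>p. \<forall>g0\<in>G0. S.lin (ssc sc) p (r - \<alpha> g0) (strand g0 H)"
    with base have 0: "\<forall>k<L 0. \<alpha> (s 0 k) \<le> r" "Q 0" by blast+
    have Q: "Q i" for i by (induction i) (use 0 step in blast)+
    have "\<forall>k<L i. \<alpha> (s i k) \<le> r + int i" for i
    proof (cases i)
      case (Suc j)
      show ?thesis unfolding Suc using step[of j] Q[of j] by blast
    qed (use 0(1) in simp)
    then show "\<forall>i. \<forall>k<L i. \<alpha> (s i k) \<le> r + int i" by blast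
  qed
qed

end

section \<open>Existence of minimal resolutions\<close>

text \<open>Dickson's lemma in the form of a common subsequence: the functions are treated one after
  another, and thinning out further preserves the monotonicity already achieved.\<close>

lemma ex_mono_subseq:
  fixes X :: "(nat \<Rightarrow> nat) set"
  assumes "finite X"
  shows "\<exists>f :: nat \<Rightarrow> nat. strict_mono f \<and> (\<forall>h\<in>X. \<forall>i j. i \<le> j \<longrightarrow> h (f i) \<le> h (f j))"
  using assms
proof induction
  case empty
  show ?case by (rule exI[of _ id]) (simp add: strict_mono_def)
next
  case (insert h X)
  then obtain f :: "nat \<Rightarrow> nat" where f: "strict_mono f" "\<And>h i j. h \<in> X \<Longrightarrow> i \<le> j \<Longrightarrow> h (f i) \<le> h (f j)"
    by blast
  obtain g where g: "strict_mono g" "monoseq (\<lambda>n. (h \<circ> f) (g n))"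
    using seq_monosub[of "h \<circ> f"] by blast
  define y where "y n = h (f (g n))" for n
  \<comment> \<open>A nonincreasing sequence of naturals is eventually constant, so dropping
    \<open>N\<close> terms makes it nondecreasing as well.\<close>
  have "\<exists>N. \<forall>i j. i \<le> j \<longrightarrow> y (i + N) \<le> y (j + N)"
  proof (cases "\<forall>m. \<forall>n\<ge>m. y m \<le> y n")
    case True
    then show ?thesis by (intro exI[of _ 0]) auto
  next
    case False
    with g(2) have dec: "\<And>m n. m \<le> n \<Longrightarrow> y n \<le> y m" by (auto simp: monoseq_def y_def)
    obtain N where N: "\<And>n. y N \<le> y n" using ex_has_least_nat[of "\<lambda>_. True" 0 y] by auto
    have "y (n + N) = y N" for n using dec[of N "n + N"] N[of "n + N"] by simp
    then show ?thesis by (intro exI[of _ N]) simp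
  qed
  then obtain N where N: "\<And>i j. i \<le> j \<Longrightarrow> y (i + N) \<le> y (j + N)" by blast
  define f' where "f' i = f (g (i + N))" for i
  have "strict_mono f'"
    using f(1) g(1) by (auto simp: f'_def strict_mono_def)
  moreover have "\<forall>h'\<in>insert h X. \<forall>i j. i \<le> j \<longrightarrow> h' (f' i) \<le> h' (f' j)"
  proof (intro ballI allI impI)
    fix h' i and j :: nat assume h': "h' \<in> insert h X" and ij: "i \<le> j"
    have "g (i + N) \<le> g (j + N)" using g(1) ij by (simp add: strict_mono_less_eq)
    then show "h' (f' i) \<le> h' (f' j)"
      using h' f(2) N[OF ij] by (auto simp: f'_def y_def)
  qed
  ultimately show ?case by blast
qed

text \<open>Monomials of a free module, encoded by products of distinct primes, inherit a
  multiplicative well-ordering from the natural numbers.\<close>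

definition nth_prime :: "nat \<Rightarrow> nat" where
  "nth_prime = enumerate {p. prime p}"

lemma prime_nth_prime: "prime (nth_prime n)"
  using enumerate_in_set[OF primes_infinite] by (simp add: nth_prime_def)

lemma nth_prime_eq_iff: "nth_prime m = nth_prime n \<longleftrightarrow> m = n"
  unfolding nth_prime_def using enumerate_mono[OF _ primes_infinite]
  by (metis less_irrefl linorder_neqE_nat)

definition mono_code :: "('v \<Rightarrow> nat) \<Rightarrow> 'v set \<Rightarrow> ('v \<Rightarrow>\<^sub>0 nat) \<Rightarrow> nat" where
  "mono_code \<nu> V t = (\<Prod>v\<in>V. nth_prime (Suc (2 * \<nu> v)) ^ lookup t v)"

text \<open>Variables own odd-indexed primes and positions even-indexed ones, so the two kinds of
  data do not mix. Multiplying a term by a monomial multiplies its code, the compatibility expected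
  of a term order.\<close>

definition term_code :: "('v \<Rightarrow> nat) \<Rightarrow> 'v set \<Rightarrow> nat \<times> ('v \<Rightarrow>\<^sub>0 nat) \<Rightarrow> nat" where
  "term_code \<nu> V z = nth_prime (2 * fst z) * mono_code \<nu> V (snd z)"

lemma mono_code_add: "mono_code \<nu> V (s + t) = mono_code \<nu> V s * mono_code \<nu> V t"
  by (simp add: mono_code_def lookup_add power_add prod.distrib)

lemma term_code_add: "term_code \<nu> V (k, s + t) = mono_code \<nu> V s * term_code \<nu> V (k, t)"
  by (simp add: term_code_def mono_code_add)

text \<open>Unique factorisation: the multiplicities of the code at even-indexed primes reveal the
  position, those at odd-indexed primes the exponents.\<close>

lemma term_code_inj:
  assumes V: "finite V" and \<nu>: "inj_on \<nu> V" and eq: "term_code \<nu> V (k, s) = term_code \<nu> V (l, t)"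
    and st: "keys s \<subseteq> V" "keys t \<subseteq> V"
  shows "k = l" "s = t"
proof -
  define W where "W = nth_prime ` (\<lambda>v. Suc (2 * \<nu> v)) ` V"
  define ex where "ex t p = lookup t (inv_into V (\<lambda>v. nth_prime (Suc (2 * \<nu> v))) p)"
    for t :: "'a \<Rightarrow>\<^sub>0 nat" and p
  have inj: "inj_on (\<lambda>v. nth_prime (Suc (2 * \<nu> v))) V"
    using \<nu> by (auto simp: inj_on_def nth_prime_eq_iff)
  define pe where "pe k t p = (if p = nth_prime (2 * k) then 1 else if p \<in> W then ex t p else 0)"
    for k :: nat and t :: "'a \<Rightarrow>\<^sub>0 nat" and p
  have notW: "nth_prime (2 * i) \<notin> W" for i
    by (auto simp: W_def nth_prime_eq_iff) presburger
  have code: "multiplicity p (term_code \<nu> V (k, t)) = pe k t p" if p: "prime p" for k t and p :: nat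
  proof -
    have "mono_code \<nu> V t = (\<Prod>p\<in>W. p ^ ex t p)"
      unfolding mono_code_def W_def image_image
      by (subst prod.reindex[OF inj]) (auto simp: ex_def inv_into_f_f[OF inj] intro!: prod.cong)
    also have "\<dots> = (\<Prod>p\<in>W. p ^ pe k t p)"
      by (rule prod.cong) (use notW in \<open>auto simp: pe_def\<close>)
    finally have "term_code \<nu> V (k, t) = (\<Prod>p\<in>insert (nth_prime (2 * k)) W. p ^ pe k t p)"
      using V notW by (simp add: term_code_def W_def pe_def)
    then have "multiplicity p (term_code \<nu> V (k, t)) = (if p \<in> insert (nth_prime (2 * k)) W then pe k t p else 0)"
      by (simp only:, intro multiplicity_prod_prime_powers) (use p V in \<open>auto simp: W_def prime_nth_prime\<close>)
    then show ?thesis by (auto simp: pe_def)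
  qed
  have pe_eq: "pe k s p = pe l t p" if "prime p" for p
    using code[OF that, of k s] code[OF that, of l t] eq by simp
  show "k = l"
    using pe_eq[OF prime_nth_prime, of "2 * k"] notW by (auto simp: pe_def nth_prime_eq_iff split: if_splits)
  have "lookup s v = lookup t v" if v: "v \<in> V" for v
  proof -
    have "nth_prime (Suc (2 * \<nu> v)) \<in> W" using v by (auto simp: W_def)
    with pe_eq[OF prime_nth_prime, of "Suc (2 * \<nu> v)"] notW v show ?thesis
      by (auto simp: pe_def ex_def inv_into_f_f[OF inj v] split: if_splits)
  qed
  moreover have "lookup s v = 0" "lookup t v = 0" if "v \<notin> V" for v
    using that st by (auto simp: in_keys_iff subset_iff)
  ultimately show "s = t" by (intro poly_mapping_eqI) metis
qed

section \<open>Hilbert's basis theorem for submodules of free modules\<close>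

definition free_piece :: "'v set \<Rightarrow> ('v \<Rightarrow> 'g::ab_group_add) \<Rightarrow> nat \<Rightarrow> (nat \<Rightarrow> 'g) \<Rightarrow> 'g \<Rightarrow> (nat \<Rightarrow> ('v, 'k::field) mpoly) set"
  where "free_piece V w l s g = {u. (\<forall>k<l. u k \<in> forms V w (g - s k)) \<and> (\<forall>k\<ge>l. u k = 0)}"

abbreviation pgen where "pgen V w \<equiv> graded_pieces.gen (forms V w)"
abbreviation pSyz where "pSyz V w \<equiv> graded_pieces.Syz (forms V w)"
abbreviation pgraded_sub where "pgraded_sub V w \<equiv> graded_pieces.graded_sub (forms V w)"

lemma Syz_subset_free_piece: "pSyz V w sc l s x g \<subseteq> free_piece V w l s g"
  unfolding graded_pieces.Syz_def[OF graded_pieces_forms] free_piece_def by blast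

lemma single_times:
  "lookup (single m a * p) t =
    (if \<exists>t'. t = m + t' then a * lookup p (t - m) else 0)"
  for p :: "('v, 'k::field) mpoly"
proof (induction p rule: poly_mapping_add_induct)
  case (1 s b)
  show ?case by (auto simp: mult_single lookup_single when_def) metis
qed (auto simp: distrib_left lookup_add)

lemma keys_single_times: "keys (single m a * p) \<subseteq> (+) m ` keys p"
  for p :: "('v, 'k::field) mpoly"
  by (auto simp: in_keys_iff single_times split: if_splits)

definition vec_terms :: "nat \<Rightarrow> (nat \<Rightarrow> ('v, 'k::field) mpoly) \<Rightarrow> (nat \<times> ('v \<Rightarrow>\<^sub>0 nat)) set" where
  "vec_terms l u = Sigma {..<l} (\<lambda>k. keys (u k))"

text \<open>The leading term is represented by its code alone. For \<open>u = 0\<close> the maximum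
  would range over the empty set, so \<open>vec_terms_nonempty\<close> accompanies its use.\<close>

definition lead_code :: "('v \<Rightarrow> nat) \<Rightarrow> 'v set \<Rightarrow> nat \<Rightarrow> (nat \<Rightarrow> ('v, 'k::field) mpoly) \<Rightarrow> nat" where
  "lead_code \<nu> V l u = Max (term_code \<nu> V ` vec_terms l u)"

lemma finite_vec_terms: "finite (vec_terms l u)"
  by (simp add: vec_terms_def)

lemma vec_terms_nonempty:
  assumes "u \<in> free_piece V w l s g" "u \<noteq> 0"
  shows "vec_terms l u \<noteq> {}"
proof
  assume "vec_terms l u = {}"
  then have "keys (u k) = {}" if "k < l" for k using that unfolding vec_terms_def by blast
  then have "u k = 0" if "k < l" for k using that by simp
  moreover have "u k = 0" if "k \<ge> l" for k using assms(1) that by (simp add: free_piece_def)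
  ultimately have "u = 0" by (intro ext) (metis not_le zero_fun_apply)
  with assms(2) show False by simp
qed

text \<open>Otherwise choose successively homogeneous elements outside the submodule generated by the
  previous ones, with least leading term. By Dickson's lemma one leading term divides a later
  one, whose element can then be reduced to one with a smaller leading term.\<close>

lemma finitely_generated_submodule:
  fixes N :: "'g::ab_group_add \<Rightarrow> (nat \<Rightarrow> ('v, 'k::field) mpoly) set"
  assumes V: "finite V" and N: "pgraded_sub V w vscale N" and N_le: "\<And>g. N g \<subseteq> free_piece V w l s g"
  shows "\<exists>l' s' x'. pgen V w vscale l' s' x' N"
proof (rule ccontr)
  interpret R: graded_pieces "forms V w :: 'g \<Rightarrow> ('v, 'k) mpoly set"
    by (rule graded_pieces_forms)
  interpret VS: Modules.module "vscale :: ('v, 'k) mpoly \<Rightarrow> _" by (rule module_vscale)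
  assume not_fg: "\<not> ?thesis"
  obtain \<nu> :: "'v \<Rightarrow> nat" where \<nu>: "inj_on \<nu> V"
    using finite_imp_inj_to_nat_seg[OF V] by metis
  define Span where "Span i F g = {\<Sum>j<i. vscale (c j) (snd (F j)) | c. \<forall>j<i. c j \<in> forms V w (g - fst (F j))}"
    for i :: nat and F :: "nat \<Rightarrow> 'g \<times> (nat \<Rightarrow> ('v, 'k) mpoly)" and g
  define bad where "bad F i z \<longleftrightarrow> snd z \<in> N (fst z) \<and> snd z \<notin> Span i F (fst z)" for F i z
  \<comment> \<open>\<open>F i\<close> will lie outside the span of its predecessors and have the
    least leading code among all such elements; the final reduction contradicts this
    minimality.\<close>
  define P where "P F i z \<longleftrightarrow> bad F i z \<and> (\<forall>y. bad F i y \<longrightarrow> lead_code \<nu> V l (snd z) \<le> lead_code \<nu> V l (snd y))"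
    for F i z
  have "\<exists>F. \<forall>i. P F i (F i)"
  proof (rule dependent_wellorder_choice)
    fix z and F G :: "nat \<Rightarrow> 'g \<times> (nat \<Rightarrow> ('v, 'k) mpoly)" and i :: nat
    assume "\<And>j. j < i \<Longrightarrow> F j = G j"
    then have "Span i F g = Span i G g" for g
      unfolding Span_def by simp
    then have "bad F i = bad G i" by (auto simp: bad_def fun_eq_iff)
    then show "P F i z = P G i z" by (simp add: P_def)
  next
    fix i F assume F: "\<And>j. j < i \<Longrightarrow> P F j (F j)"
    have "\<exists>z. bad F i z"
    proof (rule ccontr)
      assume nobad: "\<nexists>z. bad F i z"
      have "R.gen vscale i (\<lambda>j. fst (F j)) (\<lambda>j. snd (F j)) N"
      proof (rule R.genI)
        show "snd (F k) \<in> N (fst (F k))" if "k < i" for k using F[OF that] by (simp add: P_def bad_def)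
        fix g y assume "y \<in> N g"
        then have "y \<in> Span i F g" using nobad by (auto simp: bad_def)
        then show "\<exists>c. (\<forall>k<i. c k \<in> forms V w (g - fst (F k))) \<and> y = (\<Sum>k<i. vscale (c k) (snd (F k)))"
          unfolding Span_def by blast
      qed
      with not_fg show False by blast
    qed
    then obtain z0 where z0: "bad F i z0" by blast
    show "\<exists>z. P F i z"
      unfolding P_def using ex_has_least_nat[of "bad F i" z0 "\<lambda>z. lead_code \<nu> V l (snd z)"] z0 by blast
  qed
  then obtain F where F: "\<And>i. P F i (F i)" by blast
  define g u where "g i = fst (F i)" and "u i = snd (F i)" for i
  have uN: "u i \<in> N (g i)" and uS: "u i \<notin> Span i F (g i)"
    and u_min: "\<And>h v. v \<in> N h \<Longrightarrow> v \<notin> Span i F h \<Longrightarrow> lead_code \<nu> V l (u i) \<le> lead_code \<nu> V l v" for i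
    using F[of i] by (auto simp: P_def bad_def g_def u_def)
  have u_free: "u i \<in> free_piece V w l s (g i)" for i using uN N_le by blast
  have zero_Span: "0 \<in> Span i F h" for i h
    unfolding Span_def by (auto intro!: exI[of _ "\<lambda>_. 0"] simp: R.Rg_zero simp del: vscale_apply)
  then have "u i \<noteq> 0" for i using uS by metis
  then have terms_ne: "vec_terms l (u i) \<noteq> {}" for i using vec_terms_nonempty u_free by metis
  have "\<exists>z\<in>vec_terms l (u i). term_code \<nu> V z = lead_code \<nu> V l (u i)" for i
  proof -
    have "lead_code \<nu> V l (u i) \<in> term_code \<nu> V ` vec_terms l (u i)"
      unfolding lead_code_def by (rule Max_in) (use terms_ne[of i] finite_vec_terms[of l "u i"] in auto)
    then show ?thesis by (metis imageE)
  qed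
  then obtain z where z: "\<And>i. z i \<in> vec_terms l (u i)" "\<And>i. term_code \<nu> V (z i) = lead_code \<nu> V l (u i)"
    by metis
  define k t where "k i = fst (z i)" and "t i = snd (z i)" for i
  have k: "k i < l" and t: "t i \<in> keys (u i (k i))" for i
    using z(1)[of i] by (auto simp: vec_terms_def k_def t_def)
  have keys_u: "keys t' \<subseteq> V \<and> mdeg w t' = g i - s k'"
    if "k' < l" "t' \<in> keys (u i k')" for i k' t'
    using u_free[of i] that by (auto simp: free_piece_def forms_iff)
  \<comment> \<open>Including both \<open>k\<close> and its reversal \<open>l - k i\<close> forces
    the position to be constant along the subsequence.\<close>
  define X where "X = insert k (insert (\<lambda>i. l - k i) ((\<lambda>v i. lookup (t i) v) ` V))"
  have "finite X" using V by (simp add: X_def)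
  from ex_mono_subseq[OF this] obtain f :: "nat \<Rightarrow> nat" where f: "strict_mono f" "\<And>h i j. h \<in> X \<Longrightarrow> i \<le> j \<Longrightarrow> h (f i) \<le> h (f j)"
    by blast
  define a b where "a = f 0" and "b = f 1"
  have ab: "a < b" using f(1) by (simp add: a_def b_def strict_mono_def)
  have "k a \<le> k b" "l - k a \<le> l - k b" "\<And>v. v \<in> V \<Longrightarrow> lookup (t a) v \<le> lookup (t b) v"
    using f(2)[of _ 0 1] by (auto simp: X_def a_def b_def)
  with k[of a] k[of b] have kab: "k a = k b" by linarith
  have t_le: "lookup (t a) v \<le> lookup (t b) v" for v
  proof (cases "v \<in> V")
    case False
    then have "lookup (t a) v = 0" using keys_u[OF k t, of a] by (auto simp: in_keys_iff)
    then show ?thesis by simp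
  qed fact
  define m where "m = t b - t a"
  have tb: "t b = m + t a"
    by (rule poly_mapping_eqI) (simp add: m_def lookup_add lookup_minus t_le)
  have m_keys: "keys m \<subseteq> V"
    using keys_u[OF k t, of b] by (auto simp: m_def in_keys_iff lookup_minus)
  have m_deg: "mdeg w m = g b - g a"
    using keys_u[OF k t, of b] keys_u[OF k t, of a] kab by (simp add: tb mdeg_add algebra_simps)
  \<comment> \<open>The quotient of the leading coefficients, chosen so that the term
    \<open>t b\<close> at position \<open>k b\<close> cancels in \<open>v\<close>.\<close>
  define ca where "ca = lookup (u b (k b)) (t b) / lookup (u a (k a)) (t a)"
  define q where "q = single m ca"
  have q: "q \<in> forms V w (g b - g a)" using m_keys m_deg by (auto simp: q_def forms_iff)
  define v where "v = u b - vscale q (u a)"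
  have v_app: "v k' = u b k' - q * u a k'" for k' by (simp add: v_def)
  have v_N: "v \<in> N (g b)" unfolding v_def
    using R.graded_subD(5)[OF N q uN[of a]] by (intro R.graded_subD(6)[OF N uN]) simp
  have v_S: "v \<notin> Span b F (g b)"
  proof
    assume "v \<in> Span b F (g b)"
    then obtain c where c: "\<forall>j<b. c j \<in> forms V w (g b - fst (F j))" "v = (\<Sum>j<b. vscale (c j) (snd (F j)))"
      unfolding Span_def by blast
    define c' where "c' j = c j + (if j = a then q else 0)" for j
    have "(\<Sum>j<b. vscale (if j = a then q else 0) (snd (F j))) = (\<Sum>j<b. if j = a then vscale q (u a) else 0)"
      by (rule sum.cong) (auto simp: u_def fun_eq_iff)
    also have "\<dots> = vscale q (u a)" using ab by simp
    finally have "(\<Sum>j<b. vscale (c' j) (snd (F j))) = v + vscale q (u a)"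
      unfolding c'_def VS.scale_left_distrib sum.distrib c(2) by (rule arg_cong)
    also have "\<dots> = u b" by (simp add: v_def)
    finally have "u b = (\<Sum>j<b. vscale (c' j) (snd (F j)))" ..
    moreover have "\<forall>j<b. c' j \<in> forms V w (g b - fst (F j))"
      using c(1) q R.Rg_add by (auto simp: c'_def g_def)
    ultimately show False using uS[of b] unfolding Span_def by blast
  qed
  then have v_ne: "vec_terms l v \<noteq> {}"
    using vec_terms_nonempty zero_Span v_N N_le by (metis subsetD)
  have code_le: "term_code \<nu> V y \<le> lead_code \<nu> V l (u i)" if "y \<in> vec_terms l (u i)" for y i
    using that by (simp add: lead_code_def finite_vec_terms)
  \<comment> \<open>Multiplication by \<open>m\<close> carries the leading code of
    \<open>u a\<close> to that of \<open>u b\<close>, so no term of \<open>v\<close> exceeds the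
    latter. Equality would, by injectivity of the code, single out the cancelled term.\<close>
  have "term_code \<nu> V y < lead_code \<nu> V l (u b)" if y: "y \<in> vec_terms l v" for y
  proof -
    obtain k' t' where y': "y = (k', t')" "k' < l" "t' \<in> keys (v k')"
      using y by (auto simp: vec_terms_def)
    have "keys (v k') \<subseteq> keys (u b k') \<union> keys (q * u a k')"
      unfolding v_app using keys_add[of "u b k'" "- (q * u a k')"] by simp
    then consider "t' \<in> keys (u b k')" | t'' where "t' = m + t''" "t'' \<in> keys (u a k')"
      using y'(3) keys_single_times[of m ca "u a k'"] by (auto simp: q_def)
    then have "term_code \<nu> V y \<le> lead_code \<nu> V l (u b) \<and> keys t' \<subseteq> V"
    proof cases
      case 1
      then show ?thesis using code_le[of y b] y' keys_u[OF y'(2) 1] by (simp add: vec_terms_def)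
    next
      case 2
      have "term_code \<nu> V y = mono_code \<nu> V m * term_code \<nu> V (k', t'')" by (simp add: y' 2 term_code_add)
      also have "\<dots> \<le> mono_code \<nu> V m * lead_code \<nu> V l (u a)"
        using code_le[of "(k', t'')" a] 2 y' by (simp add: vec_terms_def)
      also have "\<dots> = term_code \<nu> V (k b, t b)"
        using z(2)[of a] unfolding tb term_code_add kab[symmetric] by (simp add: k_def t_def)
      also have "\<dots> = lead_code \<nu> V l (u b)" using z(2)[of b] by (simp add: k_def t_def)
      finally show ?thesis using keys_u[OF y'(2) 2(2)] m_keys keys_add[of m t''] by (auto simp: 2(1))
    qed
    moreover have "term_code \<nu> V y \<noteq> lead_code \<nu> V l (u b)"
    proof
      assume "term_code \<nu> V y = lead_code \<nu> V l (u b)"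
      then have "term_code \<nu> V (k', t') = term_code \<nu> V (k b, t b)"
        using z(2)[of b] by (simp add: y' k_def t_def)
      from term_code_inj[OF V \<nu> this] have "k' = k b" "t' = t b"
        using calculation keys_u[OF k t, of b] by auto
      moreover have "lookup (v (k b)) (t b) = 0"
      proof -
        have "lookup (q * u a (k a)) (t b) = ca * lookup (u a (k a)) (t a)"
          by (auto simp: q_def single_times tb)
        also have "\<dots> = lookup (u b (k b)) (t b)"
          using t[of a] by (simp add: ca_def in_keys_iff)
        finally show ?thesis by (simp add: v_app lookup_minus kab)
      qed
      ultimately show False using y'(3) by (simp add: in_keys_iff)
    qed
    ultimately show ?thesis by simp
  qed
  then have "lead_code \<nu> V l v < lead_code \<nu> V l (u b)"
    using v_ne by (simp add: lead_code_def[of _ _ _ v] finite_vec_terms)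
  then show False using u_min[OF v_N v_S] by simp
qed

section \<open>Minimal generators and iterated syzygies\<close>

lemma sum_skip:
  fixes f :: "nat \<Rightarrow> 'b::ab_group_add"
  assumes "k < l"
  shows "(\<Sum>j<l - 1. f (if j < k then j else Suc j)) = (\<Sum>j<l. f j) - f k"
proof -
  have "bij_betw (\<lambda>j. if j < k then j else Suc j) {..<l - 1} ({..<l} - {k})"
    using assms by (intro bij_betwI[where g = "\<lambda>j. if j < k then j else j - 1"]) (auto split: if_splits)
  from sum.reindex_bij_betw[OF this, of f] show ?thesis
    using assms by (simp add: sum_diff1)
qed

text \<open>A generating set of minimal length is minimal in the sense of Nakayama: otherwise a syzygy
  with a constant coefficient would make one of the generators redundant.\<close>

lemma ex_minimal_generators:
  fixes sc :: "('v, 'k::field) mpoly \<Rightarrow> 'm::ab_group_add \<Rightarrow> 'm" and w :: "'v \<Rightarrow> 'g::ab_group_add"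
  assumes pos: "\<And>t. keys t \<subseteq> V \<Longrightarrow> mdeg w t = 0 \<Longrightarrow> t = 0"
    and sc: "Modules.module sc" and fg: "\<exists>l s x. pgen V w sc l s x H"
  shows "\<exists>l s x. pgen V w sc l s x H \<and> (\<forall>g. \<forall>u\<in>pSyz V w sc l s x g. \<forall>k. lookup (u k) 0 = 0)"
proof -
  interpret R: graded_pieces "forms V w :: 'g \<Rightarrow> ('v, 'k) mpoly set"
    by (rule graded_pieces_forms)
  interpret Modules.module sc by (rule sc)
  define l where "l = (LEAST l. \<exists>s x. R.gen sc l s x H)"
  have l_min: "\<And>l'. \<exists>s x. R.gen sc l' s x H \<Longrightarrow> l \<le> l'" unfolding l_def by (rule Least_le)
  obtain s x where gen: "R.gen sc l s x H" using LeastI_ex[OF fg] unfolding l_def by blast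
  have "lookup (u k) 0 = 0" if u: "u \<in> R.Syz sc l s x g" for u g k
  proof (rule ccontr)
    assume nz: "lookup (u k) 0 \<noteq> 0"
    then have k: "k < l" using u by (auto simp: R.Syz_def not_less[symmetric])
    have uk: "u k \<in> forms V w (g - s k)" using u k by (simp add: R.Syz_def)
    \<comment> \<open>The form \<open>u k\<close> has a constant term and therefore degree zero; by
      \<open>pos\<close> it is then the constant \<open>c\<close>, a unit.\<close>
    then have g: "g = s k" using lookup_0_forms[OF uk] nz by auto
    define c where "c = lookup (u k) 0"
    have ukc: "u k = single 0 c"
    proof (rule poly_mapping_eqI)
      show "lookup (u k) t = lookup (single 0 c) t" for t
        using uk pos[of t] by (cases "t \<in> keys (u k)")
          (auto simp: forms_iff g c_def lookup_single when_def in_keys_iff)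
    qed
    define C where "C = (single 0 (inverse c) :: ('v, 'k) mpoly)"
    have C: "C \<in> forms V w 0" by (auto simp: C_def forms_iff)
    have "c \<noteq> 0" using nz by (simp add: c_def)
    then have Cu: "C * u k = 1" unfolding ukc C_def by (simp add: mult_single)
    let ?j = "\<lambda>j. if j < k then j else Suc j"
    have j: "?j i < l" if "i < l - 1" for i using that by auto
    have "R.gen sc (l - 1) (\<lambda>i. s (?j i)) (\<lambda>i. x (?j i)) H"
    proof (rule R.genI)
      show "x (?j i) \<in> H (s (?j i))" if "i < l - 1" for i by (rule R.gen_mem[OF gen j[OF that]])
      fix h y assume "y \<in> H h"
      then obtain b where b: "\<And>i. i < l \<Longrightarrow> b i \<in> forms V w (h - s i)" "y = (\<Sum>i<l. sc (b i) (x i))"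
        using R.genD[OF gen] by blast
      \<comment> \<open>Subtracting \<open>b k * C\<close> times the relation turns the coefficient
        at \<open>k\<close> into zero, so \<open>x k\<close> can be omitted.\<close>
      define b' where "b' i = b i - b k * (C * u i)" for i
      have "b' i \<in> forms V w (h - s i)" if i: "i < l" for i
      proof -
        have "C * u i \<in> forms V w (g - s i)"
          using R.Rg_mult[OF C] u i by (fastforce simp: R.Syz_def)
        from R.Rg_mult'[OF b(1)[OF k] this] have "b k * (C * u i) \<in> forms V w (h - s i)"
          by (simp add: g)
        then show ?thesis using b(1)[OF i] R.Rg_diff by (simp add: b'_def)
      qed
      moreover have "y = (\<Sum>i<l - 1. sc (b' (?j i)) (x (?j i)))"
      proof -
        have "(\<Sum>i<l - 1. sc (b' (?j i)) (x (?j i))) = (\<Sum>i<l. sc (b' i) (x i))"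
          using sum_skip[OF k, of "\<lambda>i. sc (b' i) (x i)"] by (simp add: b'_def Cu)
        also have "\<dots> = (\<Sum>i<l. sc (b i) (x i) - sc (b k * C) (sc (u i) (x i)))"
          by (rule sum.cong) (simp_all add: b'_def scale_left_diff_distrib mult.assoc)
        also have "\<dots> = y - sc (b k * C) (\<Sum>i<l. sc (u i) (x i))"
          unfolding sum_subtractf scale_sum_right b(2) ..
        finally show ?thesis using u by (simp add: R.Syz_def)
      qed
      ultimately show "\<exists>c. (\<forall>i<l - 1. c i \<in> forms V w (h - s (?j i))) \<and> y = (\<Sum>i<l - 1. sc (c i) (x (?j i)))"
        using j by (intro exI[of _ "\<lambda>i. b' (?j i)"] conjI allI impI) auto
    qed
    then have "l \<le> l - 1" using l_min by blast
    with k show False by simp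
  qed
  with gen show ?thesis by blast
qed

text \<open>Each syzygy module lies in a free module of finite rank, so the basis theorem and then
  \<open>ex_minimal_generators\<close> apply again at every stage.\<close>

lemma ex_minimal_chain:
  fixes sc :: "('v, 'k::field) mpoly \<Rightarrow> 'm::ab_group_add \<Rightarrow> 'm" and w :: "'v \<Rightarrow> 'g::ab_group_add"
  assumes V: "finite V" and pos: "\<And>t. keys t \<subseteq> V \<Longrightarrow> mdeg w t = 0 \<Longrightarrow> t = 0"
    and sc: "Modules.module sc" and fg: "\<exists>l s x. pgen V w sc l s x H"
  shows "\<exists>L s x0 x Z. minimal_chain V w sc H L s x0 x Z"
proof -
  interpret R: graded_pieces "forms V w :: 'g \<Rightarrow> ('v, 'k) mpoly set"
    by (rule graded_pieces_forms)
  define M where "M Z \<longleftrightarrow> (\<forall>g. \<forall>u\<in>Z g. \<forall>k. lookup (u k) 0 = 0)"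
    for Z :: "'g \<Rightarrow> (nat \<Rightarrow> ('v, 'k) mpoly) set"
  obtain l0 s0 x0 where 0: "R.gen sc l0 s0 x0 H" "M (R.Syz sc l0 s0 x0)"
    using ex_minimal_generators[OF pos sc fg] unfolding M_def by blast
  define Sz where "Sz a = (case a of (l, s, x) \<Rightarrow> R.Syz vscale l s x)"
    for a :: "nat \<times> (nat \<Rightarrow> 'g) \<times> (nat \<Rightarrow> nat \<Rightarrow> ('v, 'k) mpoly)"
  define gn where "gn a Z = (case a of (l, s, x) \<Rightarrow> R.gen vscale l s x Z)"
    for a :: "nat \<times> (nat \<Rightarrow> 'g) \<times> (nat \<Rightarrow> nat \<Rightarrow> ('v, 'k) mpoly)" and Z
  have next': "\<exists>a. gn a Z \<and> M (Sz a)" if "R.graded_sub vscale Z" "\<And>g. Z g \<subseteq> free_piece V w l s g" for Z l s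
  proof -
    have "\<exists>l s x. R.gen vscale l s x Z" by (rule finitely_generated_submodule[OF V that])
    from ex_minimal_generators[OF pos module_vscale this] show ?thesis
      unfolding gn_def Sz_def M_def by fastforce
  qed
  \<comment> \<open>Dependent choice: a state \<open>(l, s, x)\<close> determines the next syzygy
    module through \<open>Sz\<close>, and the clause for \<open>i = 0\<close> ties the first state
    to the relations of \<open>x0\<close>.\<close>
  have "\<exists>A. \<forall>i. (M (Sz (A i)) \<and> (i = 0 \<longrightarrow> gn (A i) (R.Syz sc l0 s0 x0))) \<and> gn (A (Suc i)) (Sz (A i))"
  proof (rule dependent_nat_choice)
    show "\<exists>a. M (Sz a) \<and> (0 = (0::nat) \<longrightarrow> gn a (R.Syz sc l0 s0 x0))"
      using next'[OF R.graded_sub_Syz[OF sc] Syz_subset_free_piece, of l0 s0 x0] by blast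
    show "\<exists>b. (M (Sz b) \<and> (Suc i = 0 \<longrightarrow> gn b (R.Syz sc l0 s0 x0))) \<and> gn b (Sz a)" for a and i :: nat
    proof -
      obtain l s x where a: "a = (l, s, x)" by (cases a)
      show ?thesis
        using next'[OF R.graded_sub_Syz[OF module_vscale] Syz_subset_free_piece, of l s x] by (auto simp: a Sz_def)
    qed
  qed
  then obtain A where A: "\<And>i. M (Sz (A i))" "gn (A 0) (R.Syz sc l0 s0 x0)" "\<And>i. gn (A (Suc i)) (Sz (A i))"
    by metis
  define L where "L i = (case i of 0 \<Rightarrow> l0 | Suc j \<Rightarrow> fst (A j))" for i
  define s where "s i = (case i of 0 \<Rightarrow> s0 | Suc j \<Rightarrow> fst (snd (A j)))" for i
  define x where "x i = snd (snd (A i))" for i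
  define Z where "Z i = (case i of 0 \<Rightarrow> R.Syz sc l0 s0 x0 | Suc j \<Rightarrow> Sz (A j))" for i
  have "minimal_chain V w sc H L s x0 x Z"
    unfolding minimal_chain_def
  proof (intro conjI allI)
    show "R.gen vscale (L (Suc i)) (s (Suc i)) (x i) (Z i)" for i
      using A(2) A(3)[of "i - 1"] by (cases i) (simp_all add: L_def s_def x_def Z_def gn_def split: prod.splits)
    show "Z (Suc i) = R.Syz vscale (L (Suc i)) (s (Suc i)) (x i)" for i
      by (simp add: L_def s_def x_def Z_def Sz_def split: prod.splits)
    have "M (Z i)" for i using A(1) 0(2) by (cases i) (simp_all add: Z_def)
    then show "\<forall>u\<in>Z i g. \<forall>k. lookup (u k) 0 = 0" for i g by (simp add: M_def)
  qed (use 0 in \<open>simp_all add: L_def s_def Z_def\<close>)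
  then show ?thesis by blast
qed

section \<open>Resolutions of records and chains of homogeneous generators\<close>

lemma free_module_simps:
  "carrier (free_module V w l s) = {u. (\<forall>k<l. u k \<in> carrier (poly_ring V)) \<and> (\<forall>k\<ge>l. u k = 0)}"
  "zero (free_module V w l s) = 0" "add (free_module V w l s) = (+)" "smult (free_module V w l s) = vscale"
  "homog_part (free_module V w l s) = free_piece V w l s"
  by (simp_all add: free_module_def free_piece_def vscale_def fun_eq_iff)

text \<open>The projections \<open>pr g\<close> make the carrier the direct sum of its homogeneous
  pieces. They translate between exactness, which \<open>minimal_free_resolution\<close> states for
  carriers, and generation degree by degree.\<close>

locale graded_module_struct =
  fixes V :: "'v set" and w :: "'v \<Rightarrow> 'g::ab_group_add"
    and M :: "(('v, 'k::field) mpoly, 'm::ab_group_add, 'g) graded_module" and pr :: "'g \<Rightarrow> 'm \<Rightarrow> 'm"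
  assumes zero_M: "zero M = 0" and add_M: "add M = (+)"
    and sub: "pgraded_sub V w (smult M) (homog_part M)"
    and pr_add: "pr g (x + y) = pr g x + pr g y"
    and pr_homog: "x \<in> homog_part M h \<Longrightarrow> pr g x = (if g = h then x else 0)"
    and homog_carrier: "homog_part M g \<subseteq> carrier M"
    and carrier_add: "x \<in> carrier M \<Longrightarrow> y \<in> carrier M \<Longrightarrow> x + y \<in> carrier M"
    and carrier_smult: "p \<in> carrier (poly_ring V) \<Longrightarrow> x \<in> carrier M \<Longrightarrow> smult M p x \<in> carrier M"
    and decomposition: "x \<in> carrier M \<Longrightarrow>
      \<exists>D. finite D \<and> (\<forall>g. pr g x \<in> homog_part M g) \<and> (\<forall>g. g \<notin> D \<longrightarrow> pr g x = 0) \<and> x = (\<Sum>g\<in>D. pr g x)"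
begin

sublocale R: graded_pieces "forms V w :: 'g \<Rightarrow> ('v, 'k) mpoly set"
  by (rule graded_pieces_forms)

sublocale Modules.module "smult M"
  using sub by (rule R.graded_subD(1))

sublocale pr: additive "pr g" for g
  by unfold_locales (rule pr_add)

lemma carrier_0: "0 \<in> carrier M"
  using R.graded_subD(2)[OF sub] homog_carrier by blast

lemma carrier_sum: "(\<And>i. i \<in> A \<Longrightarrow> f i \<in> carrier M) \<Longrightarrow> sum f A \<in> carrier M"
  by (induction A rule: infinite_finite_induct) (auto simp: carrier_0 carrier_add)

end

lemma graded_module_struct_free:
  "graded_module_struct V w (free_module V w l s :: (('v, 'k::field) mpoly, _, 'g::ab_group_add) graded_module)
    (\<lambda>g u k. hcomp w (g - s k) (u k))"
proof -
  interpret R: graded_pieces "forms V w :: 'g \<Rightarrow> ('v, 'k) mpoly set"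
    by (rule graded_pieces_forms)
  let ?F = "free_module V w l s :: (('v, 'k::field) mpoly, nat \<Rightarrow> ('v, 'k) mpoly, 'g) graded_module"
  let ?C = "{u. (\<forall>k<l. u k \<in> carrier (poly_ring V)) \<and> (\<forall>k\<ge>l. u k = 0)}"
  have hcomp_0: "hcomp w g 0 = (0 :: ('v, 'k) mpoly)" for g
    by (rule hcomp_eq_0) simp
  show ?thesis
  proof (unfold_locales, unfold free_module_simps)
    show "R.graded_sub vscale (free_piece V w l s)"
      unfolding R.graded_sub_def
    proof (intro conjI allI ballI)
      fix g h and a :: "('v, 'k) mpoly" and u :: "nat \<Rightarrow> ('v, 'k) mpoly"
      assume a: "a \<in> forms V w g" and u: "u \<in> free_piece V w l s h"
      have "a * u k \<in> forms V w (g + h - s k)" if "k < l" for k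
        by (rule R.Rg_mult'[OF a, of _ "h - s k"]) (use u that in \<open>auto simp: free_piece_def\<close>)
      then show "vscale a u \<in> free_piece V w l s (g + h)"
        using u by (simp add: free_piece_def)
    qed (auto simp: free_piece_def module_vscale R.Rg_zero R.Rg_add R.Rg_minus)
    show "(\<lambda>k. hcomp w (g - s k) ((u + v) k)) = (\<lambda>k. hcomp w (g - s k) (u k)) + (\<lambda>k. hcomp w (g - s k) (v k))"
      for g and u v :: "nat \<Rightarrow> ('v, 'k) mpoly" by (simp add: fun_eq_iff hcomp_add)
    show "(\<lambda>k. hcomp w (g - s k) (u k)) = (if g = h then u else 0)"
      if u: "u \<in> free_piece V w l s h" for g h and u :: "nat \<Rightarrow> ('v, 'k) mpoly"
    proof
      show "hcomp w (g - s k) (u k) = (if g = h then u else 0) k" for k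
      proof (cases "k < l")
        case True
        then have "u k \<in> forms V w (h - s k)" using u by (simp add: free_piece_def)
        from hcomp_form[OF this] show ?thesis by auto
      qed (use u in \<open>auto simp: free_piece_def hcomp_0\<close>)
    qed
    show "free_piece V w l s g \<subseteq> ?C" for g
      by (auto simp: free_piece_def forms_def)
    fix u v :: "nat \<Rightarrow> ('v, 'k) mpoly" and p :: "('v, 'k) mpoly"
    assume u: "u \<in> ?C"
    show "v \<in> ?C \<Longrightarrow>
        u + v \<in> ?C"
      using u by (auto intro: poly_ring_closed)
    show "p \<in> carrier (poly_ring V) \<Longrightarrow>
        vscale p u \<in> ?C"
      using u by (auto intro: poly_ring_closed)
    define D where "D = (\<Union>k<l. (\<lambda>t. mdeg w t + s k) ` keys (u k))"
    have "hcomp w (g - s k) (u k) = 0" if "g \<notin> D" for g k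
    proof (cases "k < l")
      case True
      have "g - s k \<notin> mdeg w ` keys (u k)"
      proof
        assume "g - s k \<in> mdeg w ` keys (u k)"
        then obtain t where "t \<in> keys (u k)" "mdeg w t + s k = g"
          by (metis diff_add_cancel imageE)
        with that True show False by (auto simp: D_def)
      qed
      then show ?thesis by (rule hcomp_eq_0)
    qed (use u in \<open>auto simp: hcomp_0\<close>)
    moreover have "u k = (\<Sum>g\<in>D. hcomp w (g - s k) (u k))" for k
    proof (cases "k < l")
      case True
      have "(\<Sum>g\<in>D. hcomp w (g - s k) (u k)) = (\<Sum>g\<in>(\<lambda>g. g - s k) ` D. hcomp w g (u k))"
        by (subst sum.reindex) (auto simp: inj_on_def)
      also have "\<dots> = u k"
      proof (rule hcomp_sum_superset)
        show "mdeg w ` keys (u k) \<subseteq> (\<lambda>g. g - s k) ` D"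
        proof (rule image_subsetI)
          fix t assume "t \<in> keys (u k)"
          with True have "mdeg w t + s k \<in> D" by (auto simp: D_def)
          then show "mdeg w t \<in> (\<lambda>g. g - s k) ` D" by (rule rev_image_eqI) simp
        qed
      qed (simp add: D_def)
      finally show ?thesis ..
    qed (use u in \<open>auto simp: hcomp_0\<close>)
    moreover have "(\<lambda>k. hcomp w (g - s k) (u k)) \<in> free_piece V w l s g" for g
      using u by (auto simp: free_piece_def hcomp_0 intro: hcomp_forms)
    ultimately show "\<exists>D. finite D \<and> (\<forall>g. (\<lambda>k. hcomp w (g - s k) (u k)) \<in> free_piece V w l s g) \<and>
        (\<forall>g. g \<notin> D \<longrightarrow> (\<lambda>k. hcomp w (g - s k) (u k)) = 0) \<and>
        u = (\<Sum>g\<in>D. (\<lambda>k. hcomp w (g - s k) (u k)))"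
      by (intro exI[of _ D]) (auto simp: D_def fun_eq_iff sum_fun_apply)
  qed (auto simp: fun_eq_iff)
qed

context graded_module_struct begin

definition comb :: "nat \<Rightarrow> (nat \<Rightarrow> 'm) \<Rightarrow> (nat \<Rightarrow> ('v, 'k) mpoly) \<Rightarrow> 'm" where
  "comb l x u = (\<Sum>k<l. smult M (u k) (x k))"

lemma comb_add: "comb l x (u + v) = comb l x u + comb l x v"
  by (simp add: comb_def scale_left_distrib sum.distrib)

lemma comb_vscale: "comb l x (vscale a u) = smult M a (comb l x u)"
  by (simp add: comb_def scale_sum_right)

context
  fixes l :: nat and s :: "nat \<Rightarrow> 'g" and x :: "nat \<Rightarrow> 'm"
  assumes x: "\<And>k. k < l \<Longrightarrow> x k \<in> homog_part M (s k)"
begin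

abbreviation Fls where "Fls \<equiv> (free_module V w l s :: (('v, 'k) mpoly, nat \<Rightarrow> ('v, 'k) mpoly, 'g) graded_module)"

abbreviation (input) prF where "prF \<equiv> (\<lambda>g u k. hcomp w (g - s k) (u k :: ('v, 'k) mpoly))"

interpretation F: graded_module_struct V w Fls prF
  by (rule graded_module_struct_free)

interpretation comb: additive "comb l x" by unfold_locales (rule comb_add)

lemma comb_homog: "u \<in> free_piece V w l s g \<Longrightarrow> comb l x u \<in> homog_part M g"
  unfolding comb_def using R.graded_sub_comb[OF sub, of l x s u g] x by (simp add: free_piece_def)

lemma comb_carrier: "u \<in> carrier Fls \<Longrightarrow> comb l x u \<in> carrier M"
  unfolding comb_def free_module_simps using x homog_carrier
  by (intro carrier_sum carrier_smult) auto

lemma comb_graded_hom: "graded_hom (poly_ring V) Fls M (comb l x)"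
  using comb_carrier comb_homog
  by (auto simp: graded_hom_def free_module_simps add_M comb_add comb_vscale)

text \<open>A homomorphism of degree zero carries the decomposition of \<open>u\<close> to that of
  its image.\<close>

lemma pr_comb:
  assumes u: "u \<in> carrier Fls"
  shows "pr g (comb l x u) = comb l x (prF g u)"
proof -
  obtain D where D: "finite D" "\<And>g. prF g u \<in> homog_part Fls g"
    "\<And>g. g \<notin> D \<Longrightarrow> prF g u = 0" "u = (\<Sum>g\<in>D. prF g u)"
    using F.decomposition[OF u] by blast
  have "pr g (comb l x u) = (\<Sum>h\<in>D. pr g (comb l x (prF h u)))"
    by (subst D(4)) (simp only: comb.sum pr.sum)
  also have "\<dots> = (\<Sum>h\<in>D. if h = g then comb l x (prF g u) else 0)"
    using pr_homog[OF comb_homog[OF D(2)[unfolded free_module_simps]]] by (intro sum.cong) auto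
  also have "\<dots> = comb l x (prF g u)"
    using D(1) D(3)[of g] comb.zero by (auto simp: sum.delta)
  finally show ?thesis .
qed

lemma Syz_iff: "u \<in> R.Syz (smult M) l s x g \<longleftrightarrow> u \<in> free_piece V w l s g \<and> comb l x u = 0"
  by (auto simp: R.Syz_def free_piece_def comb_def)

text \<open>Formulated for a graded part \<open>C\<close> of the carrier with pieces
  \<open>K\<close>, to cover two cases: the whole module, for the augmentation, and a kernel with
  its syzygies, for exactness.\<close>

lemma comb_image_iff:
  assumes K: "\<And>g. K g \<subseteq> homog_part M g"
    and C: "\<And>y. y \<in> C \<longleftrightarrow> y \<in> carrier M \<and> (\<forall>g. pr g y \<in> K g)"
    and C_add: "\<And>y z. y \<in> C \<Longrightarrow> z \<in> C \<Longrightarrow> y + z \<in> C"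
    and C_smult: "\<And>p y. p \<in> carrier (poly_ring V) \<Longrightarrow> y \<in> C \<Longrightarrow> smult M p y \<in> C"
    and K_C: "\<And>g. K g \<subseteq> C" and zero_C: "0 \<in> C"
  shows "comb l x ` carrier Fls = C \<longleftrightarrow> R.gen (smult M) l s x K"
proof
  assume im: "comb l x ` carrier Fls = C"
  show "R.gen (smult M) l s x K"
  proof (rule R.genI)
    fix k assume k: "k < l"
    define e where "e j = (if j = k then 1 else 0 :: ('v, 'k) mpoly)" for j
    have "comb l x e = x k"
      unfolding comb_def e_def by (rule sum_scale_unit[OF module_axioms k])
    moreover have "e \<in> carrier Fls" using k by (auto simp: e_def free_module_simps)
    ultimately have "x k \<in> C" using imageI[of e "carrier Fls" "comb l x"] im by simp
    then have "pr (s k) (x k) \<in> K (s k)" using C by blast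
    then show "x k \<in> K (s k)" using pr_homog[OF x[OF k]] by simp
  next
    fix g y assume y: "y \<in> K g"
    then obtain u where u: "u \<in> carrier Fls" "y = comb l x u" using im K_C by blast
    have "y = pr g y" using pr_homog[of y g g] y K[of g] by auto
    also have "\<dots> = comb l x (prF g u)" by (simp only: u(2) pr_comb[OF u(1)])
    finally have "y = comb l x (prF g u)" .
    moreover have "prF g u \<in> free_piece V w l s g"
      using F.decomposition[OF u(1)] unfolding free_module_simps by blast
    ultimately show "\<exists>c. (\<forall>k<l. c k \<in> forms V w (g - s k)) \<and> y = (\<Sum>k<l. smult M (c k) (x k))"
      by (intro exI[of _ "prF g u"]) (simp add: comb_def free_piece_def)
  qed
next
  assume gen: "R.gen (smult M) l s x K"
  have C_sum: "(\<And>i. i \<in> A \<Longrightarrow> f i \<in> C) \<Longrightarrow> sum f A \<in> C" for f :: "'b \<Rightarrow> 'm" and A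
    by (induction A rule: infinite_finite_induct) (auto simp: zero_C C_add)
  show "comb l x ` carrier Fls = C"
  proof (intro equalityI subsetI)
    fix y assume "y \<in> comb l x ` carrier Fls"
    then show "y \<in> C"
      using R.gen_mem[OF gen] K_C by (auto simp: comb_def free_module_simps intro!: C_sum C_smult)
  next
    fix y assume y: "y \<in> C"
    then have yc: "y \<in> carrier M" and yK: "\<And>g. pr g y \<in> K g" using C by auto
    obtain D where D: "finite D" "y = (\<Sum>g\<in>D. pr g y)" using decomposition[OF yc] by blast
    have "\<exists>c. c \<in> carrier Fls \<and> pr g y = comb l x c" for g
    proof -
      obtain c where c: "\<forall>k<l. c k \<in> forms V w (g - s k)" "pr g y = (\<Sum>k<l. smult M (c k) (x k))"
        using R.genD[OF gen yK] by blast
      define c' where "c' k = (if k < l then c k else 0)" for k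
      show ?thesis using c
        by (intro exI[of _ c']) (auto simp: c'_def comb_def free_module_simps forms_def)
    qed
    then obtain c where c: "\<And>g. c g \<in> carrier Fls" "\<And>g. pr g y = comb l x (c g)" by metis
    have "y = comb l x (\<Sum>g\<in>D. c g)" unfolding comb.sum c(2)[symmetric] by (rule D(2))
    moreover have "(\<Sum>g\<in>D. c g) \<in> carrier Fls" by (rule F.carrier_sum) (rule c(1))
    ultimately show "y \<in> comb l x ` carrier Fls" by blast
  qed
qed

lemma Syz_subset_kernel: "R.Syz (smult M) l s x g \<subseteq> a_kernel Fls M (comb l x)"
proof
  fix u assume "u \<in> R.Syz (smult M) l s x g"
  then show "u \<in> a_kernel Fls M (comb l x)"
    using F.homog_carrier[of g] by (auto simp: a_kernel_def' zero_M Syz_iff free_module_simps)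
qed

lemma kernel_comb_iff: "u \<in> a_kernel Fls M (comb l x) \<longleftrightarrow> u \<in> carrier Fls \<and> (\<forall>g. prF g u \<in> R.Syz (smult M) l s x g)"
proof -
  have "comb l x u = 0 \<longleftrightarrow> (\<forall>g. comb l x (prF g u) = 0)" if u: "u \<in> carrier Fls"
  proof
    assume "comb l x u = 0"
    then show "\<forall>g. comb l x (prF g u) = 0" by (simp only: pr_comb[OF u, symmetric]) (simp add: pr.zero)
  next
    assume "\<forall>g. comb l x (prF g u) = 0"
    moreover obtain D where "u = (\<Sum>g\<in>D. prF g u)" using F.decomposition[OF u] by blast
    then have "comb l x u = (\<Sum>g\<in>D. comb l x (prF g u))" by (metis comb.sum)
    ultimately show "comb l x u = 0" by simp
  qed
  then show ?thesis
    using F.decomposition[of u] by (auto simp: a_kernel_def' zero_M Syz_iff free_module_simps)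
qed

end

text \<open>Linearity expands \<open>f\<close> along the basis. In this way the abstract
  differentials of a resolution become sequences of generators.\<close>

lemma graded_hom_comb:
  assumes f: "graded_hom (poly_ring V) (free_module V w l s) M f"
  defines "x \<equiv> \<lambda>k. f (\<lambda>j. if j = k then 1 else 0)"
  shows "\<And>k. k < l \<Longrightarrow> x k \<in> homog_part M (s k)"
    and "\<And>u. u \<in> carrier (free_module V w l s) \<Longrightarrow> f u = comb l x u"
proof -
  let ?F = "free_module V w l s :: (('v, 'k) mpoly, nat \<Rightarrow> ('v, 'k) mpoly, 'g) graded_module"
  interpret F: graded_module_struct V w ?F "\<lambda>g u k. hcomp w (g - s k) (u k)"
    by (rule graded_module_struct_free)
  let ?e = "\<lambda>k j. if j = k then 1 else 0 :: ('v, 'k) mpoly"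
  have e: "?e k \<in> homog_part ?F (s k)" if "k < l" for k
    using that by (auto simp: free_module_simps free_piece_def R.Rg_one R.Rg_zero)
  show "x k \<in> homog_part M (s k)" if "k < l" for k
    using f e[OF that] by (auto simp: graded_hom_def x_def)
  fix u assume u: "u \<in> carrier ?F"
  have ec: "vscale (u k) (?e k) \<in> carrier ?F" if "k < l" for k
    using F.carrier_smult[of "u k" "?e k"] e[OF that] F.homog_carrier u that
    by (auto simp: free_module_simps)
  have f_sum: "f (\<Sum>k<m. vscale (u k) (?e k)) = (\<Sum>k<m. smult M (u k) (x k))" if "m \<le> l" for m
    using that
  proof (induction m)
    case 0
    have "f 0 = f (0 + 0)" by simp
    also have "\<dots> = f 0 + f 0"
      using f F.carrier_0 unfolding graded_hom_def free_module_simps add_M by blast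
    finally have "f 0 = 0" by simp
    then show ?case by (simp only: lessThan_0 sum.empty)
  next
    case (Suc m)
    then have m: "m < l" by simp
    have "(\<Sum>k<m. vscale (u k) (?e k)) \<in> carrier ?F" by (rule F.carrier_sum) (use ec Suc.prems in auto)
    then have "f (\<Sum>k<Suc m. vscale (u k) (?e k)) = f (\<Sum>k<m. vscale (u k) (?e k)) + f (vscale (u m) (?e m))"
      using f ec[OF m] unfolding graded_hom_def free_module_simps add_M sum.lessThan_Suc by blast
    also have "f (vscale (u m) (?e m)) = smult M (u m) (x m)"
    proof -
      have "u m \<in> carrier (poly_ring V)" using u m by (simp add: free_module_simps)
      moreover have "?e m \<in> carrier ?F" using e[OF m] F.homog_carrier by blast
      ultimately show ?thesis using f unfolding graded_hom_def free_module_simps x_def by blast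
    qed
    finally show ?case using Suc by simp
  qed
  have "u = (\<Sum>k<l. vscale (u k) (?e k))"
  proof
    fix j
    have "(\<Sum>k<l. u k * ?e k j) = (\<Sum>k<l. if k = j then u k else 0)" by (rule sum.cong) auto
    then show "u j = (\<Sum>k<l. vscale (u k) (?e k)) j"
      using u by (auto simp: sum_fun_apply free_module_simps)
  qed
  then have "f u = f (\<Sum>k<l. vscale (u k) (?e k))" by (rule arg_cong)
  also have "\<dots> = comb l x u" by (simp only: f_sum[OF order_refl] comb_def)
  finally show "f u = comb l x u" .
qed

end

lemma a_kernel_cong:
  assumes "\<And>u. u \<in> carrier R \<Longrightarrow> f u = h u"
  shows "a_kernel R S f = a_kernel R S h"
  using assms by (auto simp: a_kernel_def')

context graded_module_struct begin

lemma carrier_iff_pr: "y \<in> carrier M \<longleftrightarrow> y \<in> carrier M \<and> (\<forall>g. pr g y \<in> homog_part M g)"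
  using decomposition by blast

lemma comb_onto_iff:
  assumes "\<And>k. k < l \<Longrightarrow> x k \<in> homog_part M (s k)"
  shows "comb l x ` carrier (free_module V w l s) = carrier M \<longleftrightarrow> R.gen (smult M) l s x (homog_part M)"
  by (rule comb_image_iff)
    (use assms carrier_iff_pr carrier_add carrier_smult homog_carrier carrier_0 in auto)

lemma comb_onto_kernel_iff:
  fixes s s' x x'
  assumes x: "\<And>k. k < l \<Longrightarrow> x k \<in> homog_part M (s k)"
    and x': "\<And>k. k < l' \<Longrightarrow> x' k \<in> free_piece V w l s (s' k)"
  shows "a_kernel (free_module V w l s) M (comb l x) =
      graded_module_struct.comb (free_module V w l s) l' x' ` carrier (free_module V w l' s') \<longleftrightarrow>
    R.gen vscale l' s' x' (R.Syz (smult M) l s x)"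
proof -
  let ?F = "free_module V w l s :: (('v, 'k) mpoly, nat \<Rightarrow> ('v, 'k) mpoly, 'g) graded_module"
  interpret F: graded_module_struct V w ?F "\<lambda>g u k. hcomp w (g - s k) (u k)"
    by (rule graded_module_struct_free)
  let ?C = "a_kernel ?F M (comb l x)"
  interpret C: additive "comb l x" by unfold_locales (rule comb_add)
  have "F.comb l' x' ` carrier (free_module V w l' s') = ?C \<longleftrightarrow>
      R.gen (smult ?F) l' s' x' (R.Syz (smult M) l s x)"
  proof (rule F.comb_image_iff)
    show "x' k \<in> homog_part ?F (s' k)" if "k < l'" for k
      using x'[OF that] by (simp add: free_module_simps)
    show "R.Syz (smult M) l s x g \<subseteq> homog_part ?F g" for g
      unfolding free_module_simps by (rule Syz_subset_free_piece)
    show "y \<in> ?C \<longleftrightarrow> y \<in> carrier ?F \<and> (\<forall>g. (\<lambda>k. hcomp w (g - s k) (y k)) \<in> R.Syz (smult M) l s x g)" for y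
      by (rule kernel_comb_iff[OF x])
    show "y + z \<in> ?C" if "y \<in> ?C" "z \<in> ?C" for y z
      using that F.carrier_add by (simp add: a_kernel_def' zero_M C.add)
    show "smult ?F p y \<in> ?C" if "p \<in> carrier (poly_ring V)" "y \<in> ?C" for p y
      using that F.carrier_smult by (simp add: a_kernel_def' zero_M free_module_simps comb_vscale)
    show "R.Syz (smult M) l s x g \<subseteq> ?C" for g by (rule Syz_subset_kernel[OF x])
    show "0 \<in> ?C" using F.carrier_0 by (simp add: a_kernel_def' zero_M C.zero)
  qed
  then show ?thesis unfolding free_module_simps by (metis (no_types, lifting))
qed

text \<open>The case of a free target, which handles exactness at the positions
  \<open>Suc i\<close>.\<close>

lemma free_comb_onto_kernel_iff:
  fixes x x' :: "nat \<Rightarrow> nat \<Rightarrow> ('v, 'k) mpoly"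
  assumes "\<forall>k<l'. x k \<in> free_piece V w l s (s' k)" "\<forall>k<l''. x' k \<in> free_piece V w l' s' (s'' k)"
  shows "a_kernel (free_module V w l' s') (free_module V w l s) (graded_module_struct.comb (free_module V w l s) l' x) =
      graded_module_struct.comb (free_module V w l' s') l'' x' ` carrier (free_module V w l'' s'') \<longleftrightarrow>
    R.gen vscale l'' s'' x' (R.Syz vscale l' s' x)"
proof -
  interpret F: graded_module_struct V w
    "free_module V w l s :: (('v, 'k) mpoly, nat \<Rightarrow> ('v, 'k) mpoly, 'g) graded_module"
    "\<lambda>g u k. hcomp w (g - s k) (u k)"
    by (rule graded_module_struct_free)
  have "x k \<in> homog_part (free_module V w l s) (s' k)" if "k < l'" for k
    using assms(1) that by (simp add: free_module_simps)
  from F.comb_onto_kernel_iff[where l = l' and x = x and s = s' and l' = l'' and x' = x' and s' = s'', OF this]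
  show ?thesis using assms(2) unfolding free_module_simps(4) by blast
qed

text \<open>The generators are the images of the basis vectors. Exactness says that each family
  generates the relations of the previous one, and minimality passes over because \<open>Z i\<close>
  lies in the image of \<open>res_diff F i\<close>.\<close>

lemma minimal_chain_of_resolution:
  assumes res: "minimal_free_resolution V w M F"
  shows "\<exists>x0 x Z. minimal_chain V w (smult M) (homog_part M) (res_rank F) (res_shift F) x0 x Z"
proof -
  let ?L = "res_rank F" and ?s = "res_shift F"
  let ?F = "\<lambda>i. free_module V w (?L i) (?s i) :: (('v, 'k) mpoly, nat \<Rightarrow> ('v, 'k) mpoly, 'g) graded_module"
  let ?pr = "\<lambda>i g u k. hcomp w (g - ?s i k) (u k :: ('v, 'k) mpoly)"
  have free: "graded_module_struct V w (?F i) (?pr i)" for i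
    by (rule graded_module_struct_free)
  note r = res[unfolded minimal_free_resolution_def res_module_def One_nat_def]
  note r2 = r[THEN conjunct2] note r3 = r2[THEN conjunct2] note r4 = r3[THEN conjunct2]
  note r5 = r4[THEN conjunct2] note r6 = r5[THEN conjunct2]
  have aug: "graded_hom (poly_ring V) (?F 0) M (res_aug F)" by (rule r[THEN conjunct1])
  have diff: "\<And>i. graded_hom (poly_ring V) (?F (Suc i)) (?F i) (res_diff F i)"
    by (rule r2[THEN conjunct1, THEN spec])
  have onto: "res_aug F ` carrier (?F 0) = carrier M" by (rule r3[THEN conjunct1])
  have ker0: "a_kernel (?F 0) M (res_aug F) = res_diff F 0 ` carrier (?F (Suc 0))"
    by (rule r4[THEN conjunct1])
  have ker: "\<And>i. a_kernel (?F (Suc i)) (?F i) (res_diff F i) = res_diff F (Suc i) ` carrier (?F (Suc (Suc i)))"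
    by (rule r5[THEN conjunct1, THEN spec])
  have min: "\<And>i u k. u \<in> carrier (?F (Suc i)) \<Longrightarrow> lookup (res_diff F i u k) 0 = 0"
    using r6 by simp
  define x0 where "x0 k = res_aug F (\<lambda>j. if j = k then 1 else 0)" for k
  define x where "x i k = res_diff F i (\<lambda>j. if j = k then 1 else 0)" for i k
  note aug' = graded_hom_comb[OF aug, folded x0_def]
  note diff' = graded_module_struct.graded_hom_comb[OF free diff, folded x_def]
  have x: "x i k \<in> free_piece V w (?L i) (?s i) (?s (Suc i) k)" if "k < ?L (Suc i)" for i k
    using diff'(1)[OF that] by (simp add: free_module_simps)
  have diff_im: "res_diff F i ` carrier (?F (Suc i)) =
      graded_module_struct.comb (?F i) (?L (Suc i)) (x i) ` carrier (?F (Suc i))" for i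
    by (rule image_cong[OF refl diff'(2)])
  define Z where "Z i = (case i of 0 \<Rightarrow> R.Syz (smult M) (?L 0) (?s 0) x0
    | Suc j \<Rightarrow> R.Syz vscale (?L (Suc j)) (?s (Suc j)) (x j))" for i
  have kerZ0: "a_kernel (?F 0) M (comb (?L 0) x0) = res_diff F 0 ` carrier (?F (Suc 0))"
    unfolding ker0[symmetric] by (rule a_kernel_cong) (rule aug'(2)[symmetric])
  have kerZ: "a_kernel (?F (Suc i)) (?F i) (graded_module_struct.comb (?F i) (?L (Suc i)) (x i)) =
      res_diff F (Suc i) ` carrier (?F (Suc (Suc i)))" for i
    unfolding ker[symmetric] by (rule a_kernel_cong) (rule diff'(2)[symmetric])
  have Z_im: "Z i g \<subseteq> res_diff F i ` carrier (?F (Suc i))" for i g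
  proof (cases i)
    case 0
    show ?thesis unfolding 0 kerZ0[symmetric] Z_def nat.case
      by (rule Syz_subset_kernel) (rule aug'(1))
  next
    case (Suc j)
    show ?thesis unfolding Suc kerZ[symmetric] Z_def nat.case
      using graded_module_struct.Syz_subset_kernel[OF free, of "?L (Suc j)" "x j" j "?s (Suc j)" g] diff'(1)
      unfolding free_module_simps(4) by blast
  qed
  have "minimal_chain V w (smult M) (homog_part M) ?L ?s x0 x Z"
    unfolding minimal_chain_def
  proof (intro conjI allI ballI)
    have "comb (?L 0) x0 ` carrier (?F 0) = carrier M"
      unfolding onto[symmetric] by (rule image_cong[OF refl aug'(2)[symmetric]])
    then show "R.gen (smult M) (?L 0) (?s 0) x0 (homog_part M)"
      using comb_onto_iff[of "?L 0" x0 "?s 0"] aug'(1) by blast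
    show "R.gen vscale (?L (Suc i)) (?s (Suc i)) (x i) (Z i)" for i
    proof (cases i)
      case 0
      show ?thesis
        using comb_onto_kernel_iff[where l = "?L 0" and x = x0 and s = "?s 0" and l' = "?L (Suc 0)" and x' = "x 0" and s' = "?s (Suc 0)"]
          aug'(1) x[of _ 0] kerZ0 diff_im[of 0] unfolding 0 Z_def nat.case by simp
    next
      case (Suc j)
      show ?thesis
        using free_comb_onto_kernel_iff[of "?L (Suc j)" "x j" "?L j" "?s j" "?s (Suc j)" "?L (Suc i)" "x i" "?s (Suc i)"]
          x[of _ j] x[of _ i] kerZ[of j] diff_im[of i] unfolding Suc Z_def nat.case by simp
    qed
    show "lookup (u k) 0 = 0" if "u \<in> Z i g" for i g u k
      using Z_im[of i g] that min by blast
  qed (simp_all add: Z_def)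
  then show ?thesis by blast
qed

lemma resolution_of_minimal_chain:
  assumes chain: "minimal_chain V w (smult M) (homog_part M) L s x0 x Z"
  shows "\<exists>F. minimal_free_resolution V w M F"
proof -
  let ?F = "\<lambda>i. free_module V w (L i) (s i) :: (('v, 'k) mpoly, nat \<Rightarrow> ('v, 'k) mpoly, 'g) graded_module"
  let ?pr = "\<lambda>i g u k. hcomp w (g - s i k) (u k :: ('v, 'k) mpoly)"
  have free: "graded_module_struct V w (?F i) (?pr i)" for i
    by (rule graded_module_struct_free)
  have gen0: "R.gen (smult M) (L 0) (s 0) x0 (homog_part M)" and Z0: "Z 0 = R.Syz (smult M) (L 0) (s 0) x0"
    and gen: "\<And>i. R.gen vscale (L (Suc i)) (s (Suc i)) (x i) (Z i)"
    and Z: "\<And>i. Z (Suc i) = R.Syz vscale (L (Suc i)) (s (Suc i)) (x i)"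
    and min: "\<And>i g u k. u \<in> Z i g \<Longrightarrow> lookup (u k) 0 = 0"
    using chain unfolding minimal_chain_def by blast+
  have Z_free: "Z i g \<subseteq> free_piece V w (L i) (s i) g" for i g
    by (cases i) (simp_all add: Z0 Z Syz_subset_free_piece)
  have xZ: "x i k \<in> Z i (s (Suc i) k)" if "k < L (Suc i)" for i k
    using R.gen_mem[OF gen that] .
  then have x: "x i k \<in> homog_part (?F i) (s (Suc i) k)" if "k < L (Suc i)" for i k
    using Z_free that unfolding free_module_simps by blast
  have x': "x i k \<in> free_piece V w (L i) (s i) (s (Suc i) k)" if "k < L (Suc i)" for i k
    using x[OF that] by (simp add: free_module_simps)
  define d where "d i = graded_module_struct.comb (?F i) (L (Suc i)) (x i)" for i
  have x0: "x0 k \<in> homog_part M (s 0 k)" if "k < L 0" for k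
    by (rule R.gen_mem[OF gen0 that])
  define F where "F = \<lparr>res_rank = L, res_shift = s, res_diff = d, res_aug = comb (L 0) x0\<rparr>"
  have [simp]: "res_rank F = L" "res_shift F = s" "res_diff F = d" "res_aug F = comb (L 0) x0"
    by (simp_all add: F_def)
  have "minimal_free_resolution V w M F"
    unfolding minimal_free_resolution_def res_module_def One_nat_def
  proof (intro conjI allI ballI, simp_all)
    show "graded_hom (poly_ring V) (?F 0) M (comb (L 0) x0)"
      by (rule comb_graded_hom) (rule x0)
    show "graded_hom (poly_ring V) (?F (Suc i)) (?F i) (d i)" for i
      unfolding d_def by (rule graded_module_struct.comb_graded_hom[OF free]) (rule x)
    show "comb (L 0) x0 ` carrier (?F 0) = carrier M"
      using comb_onto_iff[of "L 0" x0 "s 0"] x0 gen0 by blast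
    show "a_kernel (?F 0) M (comb (L 0) x0) = d 0 ` carrier (?F (Suc 0))"
      unfolding d_def using comb_onto_kernel_iff[where l = "L 0" and x = x0 and s = "s 0" and l' = "L (Suc 0)" and x' = "x 0" and s' = "s (Suc 0)"]
        x0 x'[of _ 0] gen[of 0] unfolding Z0 by blast
    show "a_kernel (?F (Suc i)) (?F i) (d i) = d (Suc i) ` carrier (?F (Suc (Suc i)))" for i
      unfolding d_def
      using free_comb_onto_kernel_iff[of "L (Suc i)" "x i" "L i" "s i" "s (Suc i)" "L (Suc (Suc i))" "x (Suc i)" "s (Suc (Suc i))"]
        x' gen[of "Suc i"] unfolding Z by blast
    show "lookup (d i u k) 0 = 0" if "u \<in> carrier (?F (Suc i))" for i u k
    proof -
      have "lookup (x i j k) 0 = 0" if "j < L (Suc i)" for j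
        using min[OF xZ[OF that]] .
      then show ?thesis
        by (simp add: d_def graded_module_struct.comb_def[OF free] free_module_simps sum_fun_apply lookup_sum lookup_mult_0)
    qed
  qed
  then show ?thesis by blast
qed

text \<open>The chain is read off the very resolution that \<open>betti\<close> selects, so its
  shifts are exactly the degrees of nonzero Betti numbers. The existence proof guarantees that the
  selected object is a resolution.\<close>

theorem betti_minimal_chain:
  assumes V: "finite V" and pos: "\<And>t. mdeg w t = 0 \<Longrightarrow> t = 0"
    and fg: "\<exists>l s x. R.gen (smult M) l s x (homog_part M)"
  shows "\<exists>L s x0 x Z. minimal_chain V w (smult M) (homog_part M) L s x0 x Z \<and>
    (\<forall>i g. betti V w M i g \<noteq> 0 \<longleftrightarrow> (\<exists>k<L i. s i k = g))"
proof -
  have "\<exists>F. minimal_free_resolution V w M F"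
    using ex_minimal_chain[OF V pos module_axioms fg] resolution_of_minimal_chain by blast
  then have res: "minimal_free_resolution V w M (SOME F. minimal_free_resolution V w M F)"
    by (rule someI_ex)
  let ?F = "SOME F. minimal_free_resolution V w M F"
  have "betti V w M i g \<noteq> 0 \<longleftrightarrow> (\<exists>k<res_rank ?F i. res_shift ?F i k = g)" for i g
    unfolding betti_def Let_def by (auto simp: card_eq_0_iff)
  with minimal_chain_of_resolution[OF res] show ?thesis by blast
qed

end

section \<open>The bigraded ring and its \<open>S\<close>-basis\<close>

text \<open>For \<open>R = S\<close> the condition on \<open>h\<close> reads \<open>h = 0\<close>,
  and the only strand is the ring itself with basis \<open>1\<close>.\<close>

lemma strand_data_S: "strand_data n {..<n} S_wt (\<lambda>p. p :: (nat, 'k::field) mpoly) (\<lambda>a. a) (\<lambda>a. a) (\<lambda>_. 1) (\<lambda>_ _. 1)"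
proof -
  interpret S: graded_pieces "forms {..<n} S_wt :: int \<Rightarrow> (nat, 'k) mpoly set"
    by (rule graded_pieces_forms)
  show ?thesis
    by unfold_locales (auto simp: S.Rg_one)
qed

definition emx :: "(nat \<Rightarrow>\<^sub>0 nat) \<Rightarrow> (nat + nat) \<Rightarrow>\<^sub>0 nat" where
  "emx = msum (\<lambda>i c. single (Inl i) c)"

definition xpart :: "((nat + nat) \<Rightarrow>\<^sub>0 nat) \<Rightarrow> nat \<Rightarrow>\<^sub>0 nat" where
  "xpart = Poly_Mapping.map_key Inl"

text \<open>The truncated subtraction is exact, since \<open>emx (xpart t)\<close> divides
  \<open>t\<close>.\<close>

definition ypart :: "((nat + nat) \<Rightarrow>\<^sub>0 nat) \<Rightarrow> (nat + nat) \<Rightarrow>\<^sub>0 nat" where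
  "ypart t = t - emx (xpart t)"

lemma emx_single [simp]: "emx (single i c) = single (Inl i) c"
  by (simp add: emx_def msum_single)

lemma emx_add: "emx (s + t) = emx s + emx t"
  unfolding emx_def by (rule msum_add) (simp_all add: single_add)

lemma lookup_emx: "lookup (emx t) v = (case v of Inl i \<Rightarrow> lookup t i | Inr _ \<Rightarrow> 0)"
  by (induction t rule: poly_mapping_add_induct)
    (auto simp: emx_add lookup_add lookup_single when_def split: sum.splits)

lemma lookup_xpart: "lookup (xpart t) i = lookup t (Inl i)"
  by (simp add: xpart_def map_key.rep_eq)

lemma lookup_ypart: "lookup (ypart t) v = (case v of Inl i \<Rightarrow> 0 | Inr _ \<Rightarrow> lookup t v)"
  by (auto simp: ypart_def lookup_minus lookup_emx lookup_xpart split: sum.splits)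

lemma xpart_emx: "xpart (emx s) = s"
  by (rule poly_mapping_eqI) (simp add: lookup_xpart lookup_emx)

lemma emx_xpart_ypart: "emx (xpart t) + ypart t = t"
  by (rule poly_mapping_eqI) (auto simp: lookup_add lookup_emx lookup_xpart lookup_ypart split: sum.splits)

lemma emx_plus_eq_iff:
  assumes "xpart u = 0"
  shows "emx s + u = t \<longleftrightarrow> s = xpart t \<and> u = ypart t"
proof
  assume t: "emx s + u = t"
  have u0: "lookup u (Inl i) = 0" for i
    using assms lookup_xpart[of u i] by simp
  show "s = xpart t \<and> u = ypart t" unfolding t[symmetric]
    by (auto intro!: poly_mapping_eqI simp: lookup_xpart lookup_ypart lookup_add lookup_emx u0 split: sum.splits)
qed (simp add: emx_xpart_ypart)

lemma mdeg_emx: "mdeg A_wt (emx s) = (mdeg S_wt s, 0)"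
proof (induction s rule: poly_mapping_add_induct)
  case (1 i c)
  show ?case by (simp add: mdeg_single prod_eq_iff fst_sum snd_sum)
qed (simp add: emx_add mdeg_add)

lemma mdeg_y: "xpart t = 0 \<Longrightarrow> fst (mdeg A_wt t) = 0"
  unfolding mdeg_def fst_sum
proof (intro sum.neutral ballI)
  fix v j assume t: "xpart t = 0" and v: "v \<in> keys t"
  obtain i where "v = Inr i"
    using v lookup_xpart[of t] t by (cases v) (auto simp: in_keys_iff)
  then show "fst (A_wt v) = 0" by simp
qed

lemma mdeg_S_total: "mdeg S_wt t = int (\<Sum>v\<in>keys t. lookup t v)"
  by (simp add: mdeg_def)

lemma mdeg_A_total: "fst (mdeg A_wt t) + snd (mdeg A_wt t) = int (\<Sum>v\<in>keys t. lookup t v)"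
  unfolding mdeg_def fst_sum snd_sum sum.distrib[symmetric] of_nat_sum
  by (rule sum.cong) (auto split: sum.splits)

lemma mdeg_S_nonneg: "mdeg S_wt t \<ge> 0"
  unfolding mdeg_S_total by (rule of_nat_0_le_iff)

lemma mdeg_A_nonneg: "fst (mdeg A_wt t) \<ge> 0"
  unfolding mdeg_def fst_sum by (intro sum_nonneg) (auto split: sum.splits)

lemma total_degree_eq_0: "(\<Sum>v\<in>keys t. lookup t v) = (0::nat) \<Longrightarrow> t = 0"
  by (intro poly_mapping_eqI) (auto simp: in_keys_iff)

lemma mdeg_S_eq_0: "mdeg S_wt t = 0 \<Longrightarrow> t = 0"
  unfolding mdeg_S_total of_nat_eq_0_iff by (rule total_degree_eq_0)

lemma mdeg_A_eq_0: "mdeg A_wt t = 0 \<Longrightarrow> t = 0"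
proof (rule total_degree_eq_0)
  assume "mdeg A_wt t = 0"
  then have "int (\<Sum>v\<in>keys t. lookup t v) = 0"
    using mdeg_A_total[of t] by (simp del: of_nat_sum)
  then show "(\<Sum>v\<in>keys t. lookup t v) = 0"
    unfolding of_nat_eq_0_iff .
qed

definition ren :: "(nat, 'k::field) mpoly \<Rightarrow> (nat + nat, 'k) mpoly" where
  "ren = msum (\<lambda>t c. single (emx t) c)"

lemma ren_single: "ren (single t c) = single (emx t) c"
  by (simp add: ren_def msum_single)

lemma ren_add: "ren (p + q) = ren p + ren q"
  unfolding ren_def by (rule msum_add) (simp_all add: single_add)

lemma ren_mult: "ren (p * q) = ren p * ren q"
  unfolding ren_def by (rule msum_mult) (simp_all add: single_add emx_add mult_single)

lemma emx_0: "emx 0 = 0"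
  by (rule poly_mapping_eqI) (simp add: lookup_emx split: sum.splits)

lemma ren_1: "ren 1 = 1"
  using ren_single[of 0 1] by (simp add: emx_0)

lemma keys_emx: "keys (emx t) = Inl ` keys t"
  by (auto simp: in_keys_iff lookup_emx image_iff split: sum.splits)

text \<open>Multiplication by the \<open>y\<close>-monomial \<open>u\<close> places the coefficients
  of \<open>c\<close> on monomials with \<open>y\<close>-part \<open>u\<close>. Different
  \<open>u\<close> therefore do not interfere, which yields both spanning and independence in
  \<open>strand_data_A\<close>.\<close>

lemma lookup_ren_mult:
  assumes "xpart u = 0"
  shows "lookup (ren c * single u 1) t =
    (lookup c (xpart t) when ypart t = u)"
proof (induction c rule: poly_mapping_add_induct)
  case (1 s b)
  show ?case
    by (auto simp: ren_single mult_single lookup_single emx_plus_eq_iff[OF assms] when_def)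
qed (simp add: ren_add distrib_right lookup_add when_add_distrib)

lemma keys_ren: "t \<in> keys (ren c) \<Longrightarrow> \<exists>s\<in>keys c. t = emx s"
proof -
  assume t: "t \<in> keys (ren c)"
  have "xpart 0 = 0" by (simp add: xpart_def)
  from lookup_ren_mult[OF this, of c t] have "lookup (ren c) t = (lookup c (xpart t) when ypart t = 0)"
    by simp
  with t have "xpart t \<in> keys c" "ypart t = 0" by (auto simp: in_keys_iff when_def split: if_splits)
  then show ?thesis using emx_xpart_ypart[of t] by (intro bexI[of _ "xpart t"]) simp_all
qed

definition y_monomials :: "nat \<Rightarrow> int \<Rightarrow> ((nat + nat) \<Rightarrow>\<^sub>0 nat) set" where
  "y_monomials m b = {t. keys t \<subseteq> Inr ` {..<m} \<and> mdeg A_wt t = (0, b)}"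

lemma xpart_y_monomial: "t \<in> y_monomials m b \<Longrightarrow> xpart t = 0"
  by (intro poly_mapping_eqI) (auto simp: lookup_xpart y_monomials_def in_keys_iff subset_iff)

text \<open>Every exponent is at most the total degree \<open>b\<close>. This is the reason why
  strands of finite free modules have finite rank.\<close>

lemma finite_y_monomials: "finite (y_monomials m b)"
proof -
  let ?W = "Inr ` {..<m} :: (nat + nat) set"
  have le: "lookup t v \<le> nat b" if "t \<in> y_monomials m b" for t v
  proof (cases "v \<in> keys t")
    case True
    have "lookup t v \<le> (\<Sum>v\<in>keys t. lookup t v)"
      using True by (intro member_le_sum) auto
    moreover have "int (\<Sum>v\<in>keys t. lookup t v) = b"
      using mdeg_A_total[of t] that by (simp add: y_monomials_def)
    ultimately show ?thesis by linarith
  qed (simp add: in_keys_iff)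
  have "lookup ` y_monomials m b \<subseteq> {f. \<forall>v. (v \<in> ?W \<longrightarrow> f v \<in> {..nat b}) \<and> (v \<notin> ?W \<longrightarrow> f v = 0)}"
    using le by (auto simp: y_monomials_def in_keys_iff subset_iff)
  then have "finite (lookup ` y_monomials m b)"
    by (rule finite_subset) (intro finite_set_of_finite_funs, auto)
  moreover have "inj_on lookup (y_monomials m b)"
    by (rule inj_onI) (rule poly_mapping_eqI, simp)
  ultimately show ?thesis by (rule finite_imageD)
qed

definition y_mon :: "nat \<Rightarrow> int \<Rightarrow> nat \<Rightarrow> (nat + nat) \<Rightarrow>\<^sub>0 nat" where
  "y_mon m b = (SOME f. bij_betw f {..<card (y_monomials m b)} (y_monomials m b))"

lemma bij_y_mon: "bij_betw (y_mon m b) {..<card (y_monomials m b)} (y_monomials m b)"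
proof -
  have "\<exists>f. bij_betw f {..<card (y_monomials m b)} (y_monomials m b)"
    using ex_bij_betw_nat_finite[OF finite_y_monomials] by (metis atLeast0LessThan)
  then show ?thesis unfolding y_mon_def by (rule someI_ex)
qed

lemma strand_data_A:
  "strand_data n (A_vars n m) A_wt (ren :: (nat, 'k::field) mpoly \<Rightarrow> _) (\<lambda>a. (a, 0)) fst
    (\<lambda>h. card (y_monomials m (snd h))) (\<lambda>h q. single (y_mon m (snd h) q) 1)"
proof unfold_locales
  fix h :: "int \<times> int" and q
  let ?b = "snd h" and ?l = "card (y_monomials m (snd h))"
  have mem: "y_mon m ?b q \<in> y_monomials m ?b" if "q < ?l" for q
    using bij_betwE[OF bij_y_mon[of m ?b]] that by blast
  note xp = xpart_y_monomial[OF mem]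
  show "single (y_mon m ?b q) 1 \<in> forms (A_vars n m) A_wt h" if "fst h = 0" "q < ?l"
    using mem[OF that(2)] that(1) by (auto simp: forms_iff y_monomials_def prod_eq_iff)
  show "\<exists>c. (\<forall>q<?l. c q \<in> forms {..<n} S_wt a) \<and> f = (\<Sum>q<?l. ren (c q) * single (y_mon m ?b q) 1)"
    if h: "fst h = 0" and f: "f \<in> forms (A_vars n m) A_wt (h + (a, 0))" for f :: "(nat + nat, 'k) mpoly" and a
  proof -
    \<comment> \<open>\<open>c u\<close> is the coefficient in \<open>S\<close> of the
      \<open>y\<close>-monomial \<open>u\<close> in \<open>f\<close>.\<close>
    define c where "c u = Poly_Mapping.map_key (\<lambda>s. emx s + u) f" for u
    have "inj (\<lambda>s. emx s + u)" for u
      by (rule injI) (metis add_right_cancel xpart_emx)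
    then have lookup_c: "lookup (c u) s = lookup f (emx s + u)" for u s
      by (simp add: c_def map_key.rep_eq)
    have "c u \<in> forms {..<n} S_wt a" if "u \<in> y_monomials m ?b" for u
      unfolding forms_iff
    proof
      fix s assume "s \<in> keys (c u)"
      then have "emx s + u \<in> keys f" by (simp add: in_keys_iff lookup_c)
      with f have k: "keys (emx s + u) \<subseteq> A_vars n m" "mdeg A_wt (emx s + u) = h + (a, 0)"
        by (auto simp: forms_iff)
      have "Inl ` keys s \<subseteq> keys (emx s + u)"
        unfolding keys_emx[symmetric] by (auto simp: in_keys_iff lookup_add)
      with k(1) have "keys s \<subseteq> {..<n}" by auto
      moreover have "mdeg S_wt s = a"
        using k(2) h that by (simp add: mdeg_add mdeg_emx y_monomials_def prod_eq_iff)
      ultimately show "keys s \<subseteq> {..<n} \<and> mdeg S_wt s = a" ..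
    qed
    moreover have "f = (\<Sum>u\<in>y_monomials m ?b. ren (c u) * single u 1)"
    proof (rule poly_mapping_eqI)
      fix t
      have "lookup (\<Sum>u\<in>y_monomials m ?b. ren (c u) * single u 1) t =
          (\<Sum>u\<in>y_monomials m ?b. if u = ypart t then lookup f t else 0)"
        unfolding lookup_sum
        by (rule sum.cong) (auto simp: lookup_ren_mult xpart_y_monomial lookup_c when_def emx_xpart_ypart)
      also have "\<dots> = (if ypart t \<in> y_monomials m ?b then lookup f t else 0)"
        by (simp add: finite_y_monomials)
      also have "\<dots> = lookup f t"
      proof (cases "t \<in> keys f")
        case True
        with f have k: "keys t \<subseteq> A_vars n m" "mdeg A_wt t = h + (a, 0)"
          by (auto simp: forms_iff)
        have "v \<in> Inr ` {..<m}" if "v \<in> keys (ypart t)" for v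
          using that k(1) by (cases v) (auto simp: in_keys_iff lookup_ypart subset_iff)
        moreover have "fst (mdeg A_wt (ypart t)) = 0"
          by (rule mdeg_y, rule poly_mapping_eqI) (simp add: lookup_xpart lookup_ypart)
        moreover have "snd (mdeg A_wt (ypart t)) = ?b"
          using arg_cong[OF k(2), of snd] mdeg_add[of A_wt "emx (xpart t)" "ypart t"]
          by (simp add: emx_xpart_ypart mdeg_emx)
        ultimately have "ypart t \<in> y_monomials m ?b" by (auto simp: y_monomials_def prod_eq_iff)
        then show ?thesis by simp
      qed (simp add: in_keys_iff)
      finally show "lookup f t =
          lookup (\<Sum>u\<in>y_monomials m ?b. ren (c u) * single u 1) t" ..
    qed
    moreover have "(\<Sum>u\<in>y_monomials m ?b. ren (c u) * single u 1) =
        (\<Sum>q<?l. ren (c (y_mon m ?b q)) * single (y_mon m ?b q) 1)"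
      by (rule sum.reindex_bij_betw[OF bij_y_mon, symmetric])
    ultimately show ?thesis using mem by (intro exI[of _ "\<lambda>q. c (y_mon m ?b q)"]) auto
  qed
  show "\<forall>q<?l. e q = 0"
    if "(\<Sum>q<?l. ren (e q) * single (y_mon m ?b q) 1) = 0" for e :: "nat \<Rightarrow> (nat, 'k) mpoly"
  proof (intro allI impI, rule poly_mapping_eqI)
    fix q s assume q: "q < ?l"
    let ?t = "emx s + y_mon m ?b q"
    have t: "xpart ?t = s" "ypart ?t = y_mon m ?b q"
      using emx_plus_eq_iff[OF xp[OF q], of s ?t] by auto
    have "0 = (\<Sum>q'<?l. lookup (ren (e q') * single (y_mon m ?b q') 1) ?t)"
      unfolding lookup_sum[symmetric] that by simp
    also have "\<dots> = (\<Sum>q'<?l. if q' = q then lookup (e q) s else 0)"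
    proof (rule sum.cong[OF refl])
      fix q' assume "q' \<in> {..<?l}"
      then have q': "q' < ?l" by simp
      have "y_mon m ?b q = y_mon m ?b q' \<longleftrightarrow> q' = q"
        using inj_on_eq_iff[OF bij_betw_imp_inj_on[OF bij_y_mon[of m ?b]], of q q'] q q' by auto
      then show "lookup (ren (e q') * single (y_mon m ?b q') 1) ?t =
          (if q' = q then lookup (e q) s else 0)"
        by (simp add: lookup_ren_mult[OF xp[OF q']] t when_def)
    qed
    finally show "lookup (e q) s = lookup 0 s" using q by simp
  qed
next
  fix c :: "(nat, 'k) mpoly" and a assume "c \<in> forms {..<n} S_wt a"
  then show "ren c \<in> forms (A_vars n m) A_wt (a, 0)"
    using keys_ren[of _ c] by (fastforce simp: forms_iff keys_emx mdeg_emx)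
qed (rule ren_add ren_mult ren_1 | simp add: prod_eq_iff)+

section \<open>The Rees algebra and its strands\<close>

lemma poly_ring_simps [simp]:
  "ring.add (poly_ring V) = (+)" "monoid.mult (poly_ring V) = (*)"
  "ring.zero (poly_ring V) = 0" "monoid.one (poly_ring V) = 1"
  by (simp_all add: poly_ring_def fun_eq_iff)

lemma poly_ring_minus: "p \<in> carrier (poly_ring V) \<Longrightarrow> - p \<in> carrier (poly_ring V)"
  by (simp add: carrier_poly_ring)

lemma cring_poly_ring: "cring (poly_ring V :: ('v, 'k::field) mpoly ring)"
proof (rule cringI)
  show "abelian_group (poly_ring V :: ('v, 'k::field) mpoly ring)"
  proof (rule abelian_groupI)
    fix p :: "('v, 'k) mpoly" assume "p \<in> carrier (poly_ring V)"
    then show "\<exists>q\<in>carrier (poly_ring V). q \<oplus>\<^bsub>poly_ring V\<^esub> p = \<zero>\<^bsub>poly_ring V\<^esub>"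
      by (intro bexI[of _ "- p"] poly_ring_minus) simp_all
  qed (simp_all add: poly_ring_closed add_ac)
  show "Group.comm_monoid (poly_ring V :: ('v, 'k::field) mpoly ring)"
    by (rule comm_monoidI) (simp_all add: poly_ring_closed mult_ac)
qed (simp add: algebra_simps)

lemma ring_poly_ring: "ring (poly_ring V :: ('v, 'k::field) mpoly ring)"
  using cring_poly_ring by (rule cring.axioms(1))

lemma ideal_poly_ring_iff:
  "ideal J (poly_ring V :: ('v, 'k::field) mpoly ring) \<longleftrightarrow> J \<subseteq> carrier (poly_ring V) \<and> 0 \<in> J \<and>
    (\<forall>p\<in>J. \<forall>q\<in>J. p + q \<in> J) \<and> (\<forall>p\<in>carrier (poly_ring V). \<forall>q\<in>J. p * q \<in> J)"
proof
  assume "ideal J (poly_ring V :: ('v, 'k::field) mpoly ring)"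
  note i = this and a = ideal.axioms(1)[OF this]
  show "J \<subseteq> carrier (poly_ring V) \<and> 0 \<in> J \<and>
    (\<forall>p\<in>J. \<forall>q\<in>J. p + q \<in> J) \<and> (\<forall>p\<in>carrier (poly_ring V). \<forall>q\<in>J. p * q \<in> J)"
    using additive_subgroup.a_subset[OF a] additive_subgroup.zero_closed[OF a]
      additive_subgroup.a_closed[OF a] ideal.I_l_closed[OF i] by auto
next
  assume J: "J \<subseteq> carrier (poly_ring V) \<and> 0 \<in> J \<and>
    (\<forall>p\<in>J. \<forall>q\<in>J. p + q \<in> J) \<and> (\<forall>p\<in>carrier (poly_ring V). \<forall>q\<in>J. p * q \<in> J)"
  interpret ring "poly_ring V :: ('v, 'k::field) mpoly ring" by (rule ring_poly_ring)
  show "ideal J (poly_ring V)"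
  proof (rule idealI[OF ring_poly_ring])
    have "\<ominus>\<^bsub>poly_ring V\<^esub> p \<in> J" if "p \<in> J" for p
    proof -
      have p: "p \<in> carrier (poly_ring V)" using J that by blast
      have "\<ominus>\<^bsub>poly_ring V\<^esub> p = - 1 * p"
        using p poly_ring_minus[OF p] by (intro minus_equality) simp_all
      moreover have "- 1 * p \<in> J" using J that poly_ring_minus[OF poly_ring_0_1(2)] by blast
      ultimately show ?thesis by simp
    qed
    then show "subgroup J (add_monoid (poly_ring V))"
      using J by (intro subgroup.intro) (auto simp: a_inv_def)
    have "a * x \<in> J" if "a \<in> J" "x \<in> carrier (poly_ring V)" for a x
      using J that by (subst mult.commute) blast
    then show "a \<otimes>\<^bsub>poly_ring V\<^esub> x \<in> J" if "a \<in> J" "x \<in> carrier (poly_ring V)" for a x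
      using that by simp
  qed (use J in simp)
qed

locale rees =
  fixes n d :: nat and I :: "(nat, 'k::field) mpoly set" and fs :: "(nat, 'k) mpoly list"
  assumes fs: "set fs \<subseteq> forms {..<n} S_wt (int d)"
    and I: "I = Idl\<^bsub>poly_ring {..<n}\<^esub> (set fs)"
begin

abbreviation SF :: "int \<Rightarrow> (nat, 'k) mpoly set" where "SF \<equiv> forms {..<n} S_wt"
abbreviation S :: "(nat, 'k) mpoly ring" where "S \<equiv> poly_ring {..<n}"
abbreviation m :: nat where "m \<equiv> length fs"
abbreviation AC :: "(nat + nat, 'k) mpoly set" where "AC \<equiv> carrier (poly_ring (A_vars n m))"
abbreviation AF :: "int \<times> int \<Rightarrow> (nat + nat, 'k) mpoly set" where "AF \<equiv> forms (A_vars n m) A_wt"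
definition J :: "nat \<Rightarrow> (nat, 'k) mpoly set" where "J j = ideal_power n I j"

sublocale SR: int_graded_pieces SF
  unfolding int_graded_pieces_def by (rule graded_pieces_forms)

sublocale AR: graded_pieces AF
  by (rule graded_pieces_forms)

lemma fs_carrier: "set fs \<subseteq> carrier S"
  using fs forms_carrier by blast

lemma ideal_I: "ideal I S"
  unfolding I by (rule ring.genideal_ideal[OF ring_poly_ring fs_carrier])

lemma J_0: "J 0 = carrier S"
  by (simp add: J_def nat_pow_def ideals_set_def)

lemma J_Suc: "J (Suc j) = ideal_prod S (J j) I"
  by (simp add: J_def nat_pow_def ideals_set_def)

lemma ideal_J: "ideal (J j) S"
proof (induction j)
  case 0
  show ?case unfolding J_0 by (rule ring.oneideal[OF ring_poly_ring])
next
  case (Suc j)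
  then show ?case unfolding J_Suc by (intro ring.ideal_prod_is_ideal[OF ring_poly_ring] ideal_I)
qed

lemma J_closed:
  "J j \<subseteq> carrier S" "0 \<in> J j" "p \<in> J j \<Longrightarrow> q \<in> J j \<Longrightarrow> p + q \<in> J j"
  "r \<in> carrier S \<Longrightarrow> p \<in> J j \<Longrightarrow> r * p \<in> J j" "p \<in> J j \<Longrightarrow> - p \<in> J j"
proof -
  note i = ideal_J[of j, unfolded ideal_poly_ring_iff]
  show "J j \<subseteq> carrier S" "0 \<in> J j" "p \<in> J j \<Longrightarrow> q \<in> J j \<Longrightarrow> p + q \<in> J j" using i by blast+
  show *: "r \<in> carrier S \<Longrightarrow> p \<in> J j \<Longrightarrow> r * p \<in> J j" for r p using i by blast
  have "- 1 \<in> carrier S" by (rule poly_ring_minus) simp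
  then show "p \<in> J j \<Longrightarrow> - p \<in> J j" using *[of "- 1" p] by simp
qed

lemma J_sum: "(\<And>i. i \<in> A \<Longrightarrow> f i \<in> J j) \<Longrightarrow> sum f A \<in> J j"
  by (induction A rule: infinite_finite_induct) (auto simp: J_closed)

lemma J_mult:
  assumes "p \<in> J i" "q \<in> J j" shows "p * q \<in> J (i + j)"
  using assms(2)
proof (induction j arbitrary: q)
  case 0
  then show ?case using J_closed(4)[of q p i] assms(1) by (simp add: J_0 mult.commute)
next
  case (Suc j)
  from Suc.prems show ?case unfolding J_Suc
  proof (induction q rule: ideal_prod.induct)
    case (prod a b)
    have "(p * a) * b \<in> ideal_prod S (J (i + j)) I"
      using ideal_prod.prod[OF Suc.IH[OF prod(1)] prod(2), of S] by simp
    then show ?case by (simp add: J_Suc[symmetric] mult.assoc)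
  next
    case (sum a b)
    then show ?case using J_closed(3)[of "p * a" "i + Suc j" "p * b"] by (simp add: distrib_left)
  qed
qed

lemma fs_J: "set fs \<subseteq> J 1"
proof
  fix f assume f: "f \<in> set fs"
  then have "f \<in> I" using ring.genideal_self[OF ring_poly_ring fs_carrier] unfolding I by blast
  then have "1 * f \<in> ideal_prod S (J 0) I"
    using ideal_prod.prod[of 1 "J 0" f I S] by (simp add: J_0)
  then show "f \<in> J 1" by (simp add: J_Suc[symmetric])
qed

definition X :: "nat + nat \<Rightarrow> nat \<Rightarrow>\<^sub>0 (nat, 'k) mpoly" where
  "X v = (case v of Inl i \<Rightarrow> single 0 (single (single i 1) 1)
    | Inr j \<Rightarrow> single 1 (fs ! j))"

definition mon :: "((nat + nat) \<Rightarrow>\<^sub>0 nat) \<Rightarrow> nat \<Rightarrow>\<^sub>0 (nat, 'k) mpoly" where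
  "mon t = (\<Prod>v\<in>keys t. X v ^ lookup t v)"

abbreviation const :: "'k \<Rightarrow> nat \<Rightarrow>\<^sub>0 (nat, 'k) mpoly" where
  "const c \<equiv> single 0 (single 0 c)"

lemma mon_superset: "finite A \<Longrightarrow> keys t \<subseteq> A \<Longrightarrow> mon t = (\<Prod>v\<in>A. X v ^ lookup t v)"
  unfolding mon_def by (rule prod.mono_neutral_left) (auto simp: in_keys_iff)

lemma mon_add: "mon (s + t) = mon s * mon t"
  using keys_add[of s t]
  by (simp add: mon_superset[of "keys s \<union> keys t"] lookup_add power_add prod.distrib)

lemma mon_single: "mon (single v c) = X v ^ c"
  by (simp add: mon_superset[of "{v}"])

lemma rees_map_msum: "rees_map fs = msum (\<lambda>t c. const c * mon t)"
  by (simp add: fun_eq_iff rees_map_def msum_def mon_def X_def)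

lemma rees_map_single: "rees_map fs (single t c) = const c * mon t"
  by (simp add: rees_map_msum msum_single)

lemma rees_map_add: "rees_map fs (p + q) = rees_map fs p + rees_map fs q"
  unfolding rees_map_msum by (rule msum_add) (simp_all add: single_add distrib_right)

lemma rees_map_mult: "rees_map fs (p * q) = rees_map fs p * rees_map fs q"
  unfolding rees_map_msum
proof (rule msum_mult)
  fix s t b c
  have "const (b * c) = const b * const c" by (simp add: mult_single)
  then show "const (b * c) * mon (s + t) = const b * mon s * (const c * mon t)"
    by (simp add: mon_add mult_ac)
qed (simp_all add: single_add distrib_right)

sublocale rees_map: additive "rees_map fs"
  by unfold_locales (rule rees_map_add)

lemma rees_map_1: "rees_map fs 1 = 1"
  using rees_map_single[of 0 1] by (simp add: mon_def)

lemma single_1_power: "single i (1::nat) = t \<Longrightarrow>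
    single t (1::'k) ^ c = single (single i c) 1"
  by (induction c) (auto simp: mult_single single_add[symmetric])

lemma single_0_power: "single (0::nat) (p :: (nat, 'k) mpoly) ^ c = single 0 (p ^ c)"
  by (induction c) (auto simp: mult_single)

lemma mon_emx: "mon (emx t) = single 0 (single t 1)"
proof (induction t rule: poly_mapping_add_induct)
  case (1 i c)
  show ?case by (simp add: mon_single X_def single_0_power single_1_power)
qed (simp add: emx_add mon_add mult_single)

lemma rees_map_ren: "rees_map fs (ren p) = single 0 p"
proof (induction p rule: poly_mapping_add_induct)
  case (1 t c)
  show ?case by (simp add: ren_single rees_map_single mon_emx mult_single)
qed (simp add: ren_add rees_map_add single_add)

text \<open>Homogeneous elements are concentrated in one power of the extra variable. Zero is added
  separately because for negative \<open>snd g\<close> there is no \<open>j\<close>.\<close>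

definition rees_homog :: "int \<times> int \<Rightarrow> (nat \<Rightarrow>\<^sub>0 (nat, 'k) mpoly) set" where
  "rees_homog g = {single j q | j q. int j = snd g \<and> q \<in> J j \<and> q \<in> SF (int j * int d + fst g)} \<union> {0}"

lemma rees_homogE:
  assumes "f \<in> rees_homog g"
  obtains "f = 0" | j q where "f = single j q" "int j = snd g" "q \<in> J j" "q \<in> SF (int j * int d + fst g)"
  using assms unfolding rees_homog_def by blast

lemma rees_homogI:
  "int j = snd g \<Longrightarrow> q \<in> J j \<Longrightarrow> q \<in> SF (int j * int d + fst g) \<Longrightarrow> single j q \<in> rees_homog g"
  unfolding rees_homog_def by blast

lemma rees_homog_0: "0 \<in> rees_homog g"
  by (simp add: rees_homog_def)

lemma single_in_rees_homog_iff:
  "single j q \<in> rees_homog (a, int j) \<longleftrightarrow> q \<in> J j \<and> q \<in> SF (int j * int d + a)"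
proof
  assume "single j q \<in> rees_homog (a, int j)"
  then show "q \<in> J j \<and> q \<in> SF (int j * int d + a)"
  proof (cases rule: rees_homogE)
    case 1
    then have "q = 0" by (metis lookup_single_eq lookup_zero)
    then show ?thesis by (simp add: J_closed SR.Rg_zero)
  next
    case (2 j' q')
    then have "j' = j" by simp
    with 2(1) have "q = q'" by (metis lookup_single_eq)
    with 2 \<open>j' = j\<close> show ?thesis by simp
  qed
qed (auto intro: rees_homogI)

lemma homog_part_rees: "homog_part (rees_module n d I fs) = rees_homog"
proof
  fix g :: "int \<times> int"
  obtain a b where g: "g = (a, b)" by fastforce
  show "homog_part (rees_module n d I fs) g = rees_homog g"
  proof (intro equalityI subsetI)
    fix f assume f: "f \<in> homog_part (rees_module n d I fs) g"
    show "f \<in> rees_homog g"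
    proof (cases "f = 0")
      case False
      then obtain j where j: "j \<in> keys f"
        using poly_mapping_eqI[of f 0] by (auto simp: in_keys_iff)
      have deg: "int i = b \<and> lookup f i \<in> SF (int i * int d + a)" if "i \<in> keys f" for i
        using f that by (auto simp: rees_module_def g)
      have "f = single j (lookup f j)"
      proof (rule poly_mapping_eqI)
        fix i
        show "lookup f i = lookup (single j (lookup f j)) i"
          using deg[of i] deg[OF j] by (cases "i = j") (auto simp: lookup_single when_def in_keys_iff)
      qed
      moreover have "single j (lookup f j) \<in> rees_homog g"
        using deg[OF j] f by (intro rees_homogI) (auto simp: g rees_module_def J_def)
      ultimately show ?thesis by simp
    qed (simp add: rees_homog_0)
  next
    fix f assume "f \<in> rees_homog g"
    then show "f \<in> homog_part (rees_module n d I fs) g"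
      by (cases rule: rees_homogE)
        (auto simp: rees_module_def J_def[symmetric] g J_closed lookup_single when_def split: if_splits)
  qed
qed

lemma rees_homog_add:
  assumes f: "f \<in> rees_homog g" and f': "f' \<in> rees_homog g" shows "f + f' \<in> rees_homog g"
  using f
proof (cases rule: rees_homogE)
  case 1 with f' show ?thesis by simp
next
  case (2 j q)
  from f' show ?thesis
  proof (cases rule: rees_homogE)
    case 1 with f show ?thesis by simp
  next
    case (2 j' q')
    note * = this \<open>f = single j q\<close> \<open>int j = snd g\<close> \<open>q \<in> J j\<close> \<open>q \<in> SF (int j * int d + fst g)\<close>
    then have "j' = j" by simp
    with * show ?thesis
      by (auto simp: single_add[symmetric] intro!: rees_homogI J_closed SR.Rg_add)
  qed
qed

lemma rees_homog_mult:
  assumes f: "f \<in> rees_homog g" and f': "f' \<in> rees_homog g'" shows "f * f' \<in> rees_homog (g + g')"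
  using f
proof (cases rule: rees_homogE)
  case 1 then show ?thesis by (simp add: rees_homog_0)
next
  case (2 j q)
  note j = this
  from f' show ?thesis
  proof (cases rule: rees_homogE)
    case 1 then show ?thesis by (simp add: rees_homog_0)
  next
    case (2 j' q')
    have "q * q' \<in> SF (int (j + j') * int d + fst (g + g'))"
      by (rule SR.Rg_mult'[OF j(4) 2(4)]) (simp add: algebra_simps)
    then show ?thesis
      using j 2 J_mult[OF j(3) 2(3)] by (auto simp: mult_single intro!: rees_homogI)
  qed
qed

lemma rees_homog_minus: "f \<in> rees_homog g \<Longrightarrow> - f \<in> rees_homog g"
  by (erule rees_homogE) (auto simp: rees_homog_0 single_uminus[symmetric] intro!: rees_homogI J_closed SR.Rg_minus)

lemma rees_homog_1: "1 \<in> rees_homog 0"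
  using rees_homogI[of 0 0 1] by (simp add: J_0 SR.Rg_one)

lemma const_rees_homog: "const c \<in> rees_homog 0"
  by (rule rees_homogI) (auto simp: J_0 carrier_poly_ring forms_iff)

lemma rees_homog_prod: "(\<And>i. i \<in> A \<Longrightarrow> f i \<in> rees_homog (h i)) \<Longrightarrow> prod f A \<in> rees_homog (sum h A)"
  by (induction A rule: infinite_finite_induct) (auto simp: rees_homog_1 rees_homog_mult)

lemma X_rees_homog: "v \<in> A_vars n m \<Longrightarrow> X v \<in> rees_homog (A_wt v)"
proof (erule PlusE)
  fix i assume "v = Inl i" "i \<in> {..<n}"
  then show "X v \<in> rees_homog (A_wt v)"
    by (auto simp: X_def J_0 carrier_poly_ring forms_iff mdeg_single intro!: rees_homogI)
next
  fix j assume j: "v = Inr j" "j \<in> {..<m}"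
  then have "fs ! j \<in> set fs" by simp
  then show "X v \<in> rees_homog (A_wt v)"
    using j(1) subsetD[OF fs] subsetD[OF fs_J] by (auto simp: X_def intro!: rees_homogI)
qed

lemma mon_rees_homog: "keys t \<subseteq> A_vars n m \<Longrightarrow> mon t \<in> rees_homog (mdeg A_wt t)"
  unfolding mon_def mdeg_def
proof (rule rees_homog_prod)
  fix v assume "keys t \<subseteq> A_vars n m" "v \<in> keys t"
  then have v: "X v \<in> rees_homog (A_wt v)" by (intro X_rees_homog) blast
  show "X v ^ lookup t v \<in> rees_homog (\<Sum>j<lookup t v. A_wt v)"
    using rees_homog_prod[of "{..<lookup t v}" "\<lambda>_. X v" "\<lambda>_. A_wt v"] v by simp
qed

lemma rees_map_homog:
  assumes "p \<in> AF g" shows "rees_map fs p \<in> rees_homog g"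
  unfolding rees_map_msum msum_def
proof -
  have t: "const (lookup p t) * mon t \<in> rees_homog g" if "t \<in> keys p" for t
    using rees_homog_mult[OF const_rees_homog mon_rees_homog, of t "lookup p t"] that assms
    by (auto simp: forms_iff)
  have "(\<Sum>t\<in>A. const (lookup p t) * mon t) \<in> rees_homog g" if "A \<subseteq> keys p" for A
    using finite_subset[OF that finite_keys] that
    by (induction A rule: finite_induct) (auto simp: rees_homog_0 rees_homog_add t)
  then show "(\<Sum>t\<in>keys p. const (lookup p t) * mon t) \<in> rees_homog g" by blast
qed

text \<open>\<open>q\<close> belongs to \<open>Q j\<close> if \<open>q t^j\<close> is in the image
  of \<open>A\<close>. Products of \<open>Q i\<close> and \<open>Q j\<close> land in
  \<open>Q (i + j)\<close>, while \<open>Q 0\<close> contains \<open>S\<close> and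
  \<open>Q 1\<close> contains \<open>I\<close>; hence \<open>Q j\<close> contains the
  \<open>j\<close>-th power and the map to the Rees algebra is onto.\<close>

definition Q :: "nat \<Rightarrow> (nat, 'k) mpoly set" where
  "Q j = {q. \<exists>p\<in>AC. rees_map fs p = single j q}"

lemma QI: "p \<in> AC \<Longrightarrow> rees_map fs p = single j q \<Longrightarrow> q \<in> Q j"
  unfolding Q_def by (intro CollectI bexI)

lemma QE:
  assumes "q \<in> Q j"
  obtains p where "p \<in> AC" "rees_map fs p = single j q"
  using assms unfolding Q_def by (elim CollectE bexE) (rule that)

lemma Q_add:
  assumes "p \<in> Q j" "q \<in> Q j" shows "p + q \<in> Q j"
proof -
  obtain p' where p': "p' \<in> AC" "rees_map fs p' = single j p"
    by (rule QE[OF assms(1)])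
  obtain q' where q': "q' \<in> AC" "rees_map fs q' = single j q"
    by (rule QE[OF assms(2)])
  show ?thesis
    by (rule QI[OF poly_ring_closed(1)[OF p'(1) q'(1)]]) (simp add: rees_map_add p' q' single_add)
qed

lemma Q_mult:
  assumes "p \<in> Q i" "q \<in> Q j" shows "p * q \<in> Q (i + j)"
proof -
  obtain p' where p': "p' \<in> AC" "rees_map fs p' = single i p"
    by (rule QE[OF assms(1)])
  obtain q' where q': "q' \<in> AC" "rees_map fs q' = single j q"
    by (rule QE[OF assms(2)])
  show ?thesis
    by (rule QI[OF poly_ring_closed(2)[OF p'(1) q'(1)]]) (simp add: rees_map_mult p' q' mult_single)
qed

lemma ren_carrier: "s \<in> carrier S \<Longrightarrow> ren s \<in> AC"
  using keys_ren[of _ s] by (fastforce simp: carrier_poly_ring keys_emx)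

lemma Q_0: "carrier S \<subseteq> Q 0"
  by (intro subsetI QI[OF ren_carrier rees_map_ren])

text \<open>As \<open>Q 0\<close> contains \<open>S\<close>, the part of \<open>Q 1\<close> inside
  \<open>S\<close> is an ideal; it contains the generators \<open>fs\<close> as images of the
  \<open>y\<close>-variables.\<close>

lemma Q_1: "I \<subseteq> Q 1"
proof -
  have fs_Q: "set fs \<subseteq> Q 1"
  proof
    fix f assume "f \<in> set fs"
    then obtain j where j: "j < m" "f = fs ! j" by (metis in_set_conv_nth)
    have "rees_map fs (single (single (Inr j) 1) 1) = single 1 f"
      by (simp add: rees_map_single mon_single X_def j)
    moreover have "single (single (Inr j) 1) 1 \<in> AC"
      using j by (auto simp: carrier_poly_ring)
    ultimately show "f \<in> Q 1" by (intro QI)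
  qed
  have Q1_mult: "p * q \<in> Q 1" if "p \<in> carrier S" "q \<in> Q 1" for p q
    using Q_mult[of p 0 q 1] that Q_0 by auto
  have "0 \<in> Q 1" by (rule QI[of 0]) (simp_all add: rees_map.zero)
  then have "ideal (Q 1 \<inter> carrier S) S"
    unfolding ideal_poly_ring_iff by (auto simp del: One_nat_def intro: Q_add Q1_mult poly_ring_closed(1,2))
  from ring.genideal_minimal[OF ring_poly_ring this] show ?thesis
    unfolding I using fs_Q fs_carrier by blast
qed

lemma J_Q: "J j \<subseteq> Q j"
proof (induction j)
  case 0
  show ?case by (simp add: J_0 Q_0)
next
  case (Suc j)
  show ?case unfolding J_Suc
  proof
    fix q assume "q \<in> ideal_prod S (J j) I"
    then show "q \<in> Q (Suc j)"
    proof induction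
      case (prod a b)
      then show ?case using Q_mult[of a j b 1] Suc Q_1 by auto
    next
      case (sum a b)
      then show ?case using Q_add by simp
    qed
  qed
qed

lemma single_in_range:
  assumes "q \<in> J j"
  obtains p where "p \<in> AC" "rees_map fs p = single j q"
  using subsetD[OF J_Q assms] that by (rule QE)

definition rees_pr :: "int \<times> int \<Rightarrow> (nat \<Rightarrow>\<^sub>0 (nat, 'k) mpoly) \<Rightarrow> nat \<Rightarrow>\<^sub>0 (nat, 'k) mpoly" where
  "rees_pr g f = (if snd g < 0 then 0 else
     single (nat (snd g)) (hcomp S_wt (snd g * int d + fst g) (lookup f (nat (snd g)))))"

lemma rees_pr_add: "rees_pr g (f + h) = rees_pr g f + rees_pr g h"
  by (simp add: rees_pr_def lookup_add hcomp_add single_add)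

lemma hcomp_zero: "hcomp w g 0 = 0"
  by (rule hcomp_eq_0) simp

lemma rees_pr_homog:
  assumes "f \<in> rees_homog h"
  shows "rees_pr g f = (if g = h then f else 0)"
  using assms
proof (cases rule: rees_homogE)
  case 1
  then show ?thesis by (simp add: rees_pr_def hcomp_zero)
next
  case (2 j q)
  show ?thesis
  proof (cases "snd g = int j")
    case True
    have "snd g * int d + fst g = int j * int d + fst h \<longleftrightarrow> g = h"
      using True 2(2) by (auto simp: prod_eq_iff)
    then show ?thesis
      using True hcomp_form[OF 2(4), of "snd g * int d + fst g"] by (simp add: rees_pr_def 2(1))
  next
    case False
    then have "g \<noteq> h" using 2(2) by auto
    moreover have "nat (snd g) \<noteq> j" if "\<not> snd g < 0" using that False by auto
    ultimately show ?thesis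
      by (auto simp: rees_pr_def 2(1) lookup_single hcomp_zero)
  qed
qed

text \<open>The map preserves bidegrees, so components may be taken in \<open>A\<close>, monomial by
  monomial. Homogeneity of the powers is deduced from this.\<close>

lemma rees_pr_rees_map:
  assumes "p \<in> AC"
  shows "rees_pr g (rees_map fs p) = rees_map fs (hcomp A_wt g p)"
proof -
  interpret pr: additive "rees_pr g" by unfold_locales (rule rees_pr_add)
  let ?D = "insert g (mdeg A_wt ` keys p)"
  have p: "(\<Sum>h\<in>?D. hcomp A_wt h p) = p" by (rule hcomp_sum_superset) auto
  have "rees_pr g (rees_map fs p) = (\<Sum>h\<in>?D. rees_pr g (rees_map fs (hcomp A_wt h p)))"
    by (subst p[symmetric]) (simp only: rees_map.sum pr.sum)
  also have "\<dots> = (\<Sum>h\<in>?D. if h = g then rees_map fs (hcomp A_wt g p) else 0)"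
    using rees_pr_homog[OF rees_map_homog[OF hcomp_forms[OF assms]]] by (intro sum.cong) auto
  finally show ?thesis by simp
qed

lemma rees_pr_in:
  assumes "p \<in> AC"
  shows "rees_pr g (rees_map fs p) \<in> rees_homog g"
  unfolding rees_pr_rees_map[OF assms] by (rule rees_map_homog[OF hcomp_forms[OF assms]])

text \<open>Lift \<open>q t^j\<close> to \<open>A\<close>: the component of the lift in bidegree
  \<open>(e - j d, j)\<close> maps to \<open>hcomp S_wt e q\<close> placed at
  \<open>t^j\<close>.\<close>

lemma J_hcomp: "q \<in> J j \<Longrightarrow> hcomp S_wt e q \<in> J j"
proof -
  assume "q \<in> J j"
  then obtain p where p: "p \<in> AC" "rees_map fs p = single j q"
    by (rule single_in_range)
  have "rees_pr (e - int j * int d, int j) (single j q) = single j (hcomp S_wt e q)"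
    by (simp add: rees_pr_def)
  then show ?thesis
    using rees_pr_in[OF p(1), of "(e - int j * int d, int j)"] p(2) single_in_rees_homog_iff by metis
qed

text \<open>A preimage of \<open>q t^j\<close> may be replaced by its component of bidegree
  \<open>(e - j d, j)\<close>, which vanishes because no monomial of \<open>A\<close> has negative
  \<open>x\<close>-degree.\<close>

lemma J_low_degree:
  assumes q: "q \<in> J j" "q \<in> SF e" and e: "e < int j * int d"
  shows "q = 0"
proof -
  let ?g = "(e - int j * int d, int j)"
  obtain p where p: "p \<in> AC" "rees_map fs p = single j q"
    using single_in_range[OF q(1)] .
  have "single j q = rees_pr ?g (single j q)"
    using hcomp_form[OF q(2), of e] by (simp add: rees_pr_def)
  also have "\<dots> = rees_map fs (hcomp A_wt ?g p)"
    using rees_pr_rees_map[OF p(1), of ?g] p(2) by simp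
  also have "hcomp A_wt ?g p = 0"
  proof (rule hcomp_eq_0)
    show "?g \<notin> mdeg A_wt ` keys p"
    proof
      assume "?g \<in> mdeg A_wt ` keys p"
      then obtain t where "mdeg A_wt t = ?g" by auto
      then show False using mdeg_A_nonneg[of t] e by simp
    qed
  qed
  finally show ?thesis by (metis lookup_single_eq lookup_zero rees_map.zero)
qed

abbreviation Rees where "Rees \<equiv> rees_module n d I fs"

lemma rees_carrier: "f \<in> carrier Rees \<longleftrightarrow> (\<forall>j. lookup f j \<in> J j)"
  by (simp add: rees_module_def J_def)

lemma rees_carrier_range:
  assumes "f \<in> carrier Rees"
  obtains p where "p \<in> AC" "rees_map fs p = f"
proof -
  have "\<forall>j. \<exists>p. p \<in> AC \<and> rees_map fs p = single j (lookup f j)"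
    using assms J_Q unfolding rees_carrier by (blast elim: QE)
  from choice[OF this] obtain p where p: "\<And>j. p j \<in> AC"
    "\<And>j. rees_map fs (p j) = single j (lookup f j)" by blast
  have "rees_map fs (\<Sum>j\<in>keys f. p j) = f"
    by (rule poly_mapping_eqI)
      (simp add: rees_map.sum p(2) lookup_sum lookup_single when_def in_keys_iff)
  moreover have "(\<Sum>j\<in>keys f. p j) \<in> AC"
    by (rule poly_ring_sum) (rule p(1))
  ultimately show ?thesis using that by blast
qed

lemma rees_homog_carrier: "rees_homog g \<subseteq> carrier Rees"
  by (auto elim!: rees_homogE simp: rees_carrier J_closed lookup_single when_def)

lemma rees_carrier_add: "f \<in> carrier Rees \<Longrightarrow> h \<in> carrier Rees \<Longrightarrow> f + h \<in> carrier Rees"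
  by (simp add: rees_carrier lookup_add J_closed)

lemma rees_carrier_sum: "(\<And>i. i \<in> A \<Longrightarrow> f i \<in> carrier Rees) \<Longrightarrow> sum f A \<in> carrier Rees"
  by (auto simp: rees_carrier lookup_sum intro: J_sum)

lemma rees_map_carrier:
  assumes "p \<in> AC" shows "rees_map fs p \<in> carrier Rees"
proof -
  let ?D = "mdeg A_wt ` keys p"
  have "(\<Sum>h\<in>?D. rees_map fs (hcomp A_wt h p)) \<in> carrier Rees"
    by (rule rees_carrier_sum, rule subsetD[OF rees_homog_carrier rees_map_homog[OF hcomp_forms[OF assms]]])
  then have "rees_map fs (\<Sum>h\<in>?D. hcomp A_wt h p) \<in> carrier Rees" by (simp only: rees_map.sum)
  then show ?thesis using hcomp_sum_superset[of ?D A_wt p] by simp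
qed

lemma module_rees: "Modules.module (smult Rees)"
  by unfold_locales (simp_all add: rees_module_def rees_map_add rees_map_mult rees_map_1 algebra_simps)

lemma graded_sub_rees: "AR.graded_sub (smult Rees) rees_homog"
  unfolding AR.graded_sub_def
  using module_rees rees_homog_0 rees_homog_add rees_homog_minus rees_homog_mult[OF rees_map_homog]
  by (auto simp: rees_module_def)

lemma rees_graded_module: "graded_module_struct (A_vars n m) A_wt Rees rees_pr"
proof (unfold_locales, unfold homog_part_rees)
  fix f assume f: "f \<in> carrier Rees"
  obtain p where p: "p \<in> AC" "rees_map fs p = f"
    using rees_carrier_range[OF f] .
  let ?D = "mdeg A_wt ` keys p"
  have pr: "rees_pr g f = rees_map fs (hcomp A_wt g p)" for g
    using rees_pr_rees_map[OF p(1)] p(2) by simp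
  have "f = (\<Sum>g\<in>?D. rees_pr g f)"
    unfolding pr rees_map.sum[symmetric] using p(2) hcomp_sum_superset[of ?D A_wt p] by simp
  moreover have "rees_pr g f \<in> rees_homog g" for g using rees_pr_in[OF p(1)] p(2) by simp
  moreover have "rees_pr g f = 0" if "g \<notin> ?D" for g
    using hcomp_eq_0[OF that] by (simp add: pr rees_map.zero)
  ultimately show "\<exists>D. finite D \<and> (\<forall>g. rees_pr g f \<in> rees_homog g) \<and> (\<forall>g. g \<notin> D \<longrightarrow> rees_pr g f = 0) \<and>
      f = (\<Sum>g\<in>D. rees_pr g f)"
    by (intro exI[of _ ?D]) auto
  fix a :: "(nat + nat, 'k) mpoly" assume a: "a \<in> AC"
  have "rees_map fs (a * p) \<in> carrier Rees" by (rule rees_map_carrier[OF poly_ring_closed(2)[OF a p(1)]])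
  then show "smult Rees a f \<in> carrier Rees" by (simp add: rees_module_def rees_map_mult p(2))
qed (use graded_sub_rees rees_pr_add rees_pr_homog rees_homog_carrier rees_carrier_add in
  \<open>simp_all add: rees_module_def fun_eq_iff\<close>)

text \<open>Surjectivity of the map from \<open>A\<close> makes the Rees algebra a cyclic
  \<open>A\<close>-module with generator \<open>1\<close>.\<close>

lemma gen_rees: "AR.gen (smult Rees) (Suc 0) (\<lambda>_. 0) (\<lambda>_. 1) rees_homog"
proof (rule AR.genI)
  fix g f assume f: "f \<in> rees_homog g"
  then obtain p where p: "p \<in> AC" "rees_map fs p = f"
    using rees_carrier_range rees_homog_carrier by blast
  have "f = rees_map fs (hcomp A_wt g p)"
    using rees_pr_rees_map[OF p(1), of g] rees_pr_homog[OF f, of g] p(2) by simp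
  then show "\<exists>c. (\<forall>k<Suc 0. c k \<in> AF (g - 0)) \<and> f = (\<Sum>k<Suc 0. smult Rees (c k) 1)"
    using hcomp_forms[OF p(1), of A_wt g] by (intro exI[of _ "\<lambda>_. hcomp A_wt g p"]) (simp add: rees_module_def)
qed (simp add: rees_homog_1)

section \<open>Strands of the Rees algebra as powers of the ideal\<close>

definition J_homog :: "nat \<Rightarrow> int \<Rightarrow> (nat, 'k) mpoly set" where
  "J_homog j a = J j \<inter> SF a"

abbreviation ideal_mod where "ideal_mod j \<equiv> ideal_module n (ideal_power n I j)"

lemma homog_part_ideal_module: "homog_part (ideal_mod j) = J_homog j"
  by (simp add: ideal_module_def J_homog_def J_def fun_eq_iff)

lemma smult_ideal_module: "smult (ideal_mod j) = (*)"
  by (simp add: ideal_module_def)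

lemma module_times: "Modules.module ((*) :: (nat, 'k) mpoly \<Rightarrow> _)"
  by unfold_locales (simp_all add: algebra_simps)

abbreviation lin_power :: "nat \<Rightarrow> nat \<Rightarrow> bool" where
  "lin_power j p \<equiv> SR.lin (*) p (int j * int d) (J_homog j)"

lemma graded_sub_J: "SR.graded_sub (*) (J_homog j)"
  unfolding SR.graded_sub_def J_homog_def
  by (auto simp: module_times J_closed SR.Rg_zero SR.Rg_add SR.Rg_minus SR.Rg_mult
      intro: J_closed(4)[OF forms_carrier])

lemma J_graded_module: "graded_module_struct {..<n} S_wt (ideal_mod j) (hcomp S_wt)"
proof (unfold_locales, unfold homog_part_ideal_module smult_ideal_module)
  fix x assume "x \<in> carrier (ideal_mod j)"
  then have x: "x \<in> J j" by (simp add: ideal_module_def J_def)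
  have "hcomp S_wt g x \<in> J_homog j g" for g
    using J_hcomp[OF x] hcomp_forms x J_closed(1) unfolding J_homog_def by blast
  then show "\<exists>D. finite D \<and> (\<forall>g. hcomp S_wt g x \<in> J_homog j g) \<and> (\<forall>g. g \<notin> D \<longrightarrow> hcomp S_wt g x = 0) \<and>
      x = (\<Sum>g\<in>D. hcomp S_wt g x)"
    using hcomp_eq_0 hcomp_sum_superset[of "mdeg S_wt ` keys x" S_wt x]
    by (intro exI[of _ "mdeg S_wt ` keys x"]) auto
qed (auto simp: graded_sub_J hcomp_add hcomp_form[of _ "{..<n}"] J_closed ideal_module_def J_def[symmetric]
  J_homog_def fun_eq_iff)

text \<open>The ideal is viewed as a submodule of the free module of rank one, to which the basis
  theorem applies.\<close>

lemma fg_J: "\<exists>l s x. SR.gen (*) l s x (J_homog j)"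
proof -
  define N where "N g = {u :: nat \<Rightarrow> (nat, 'k) mpoly. u 0 \<in> J_homog j g \<and> (\<forall>k\<ge>1. u k = 0)}" for g
  have "SR.graded_sub vscale N"
    using graded_sub_J[of j] module_vscale unfolding SR.graded_sub_def N_def by auto
  moreover have "N g \<subseteq> free_piece {..<n} S_wt 1 (\<lambda>_. 0) g" for g
    by (auto simp: N_def free_piece_def J_homog_def)
  ultimately obtain l s x where "SR.gen vscale l s x N"
    using finitely_generated_submodule[of "{..<n}" S_wt N 1 "\<lambda>_. 0"] by auto
  then have "SR.gen (*) l s (\<lambda>k. x k 0) (J_homog j)"
  proof (rule SR.gen_image[rotated -1, where \<phi> = "\<lambda>u. u 0"])
    show "(\<lambda>u. u 0) ` N g = J_homog j g" for g
    proof (intro equalityI subsetI)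
      fix q assume "q \<in> J_homog j g"
      then show "q \<in> (\<lambda>u. u 0) ` N g"
        by (intro image_eqI[of _ _ "\<lambda>k. if k = 0 then q else 0"]) (auto simp: N_def)
    qed (auto simp: N_def)
  qed auto
  then show ?thesis by blast
qed

sublocale strand_S: strand_data n "{..<n}" S_wt "\<lambda>p. p :: (nat, 'k) mpoly" "\<lambda>a. a" "\<lambda>a. a" "\<lambda>_. 1" "\<lambda>_ _. 1"
  by (rule strand_data_S)

sublocale strand_A: strand_data n "A_vars n m" A_wt "ren :: (nat, 'k) mpoly \<Rightarrow> _" "\<lambda>a. (a, 0)" fst
  "\<lambda>h. card (y_monomials m (snd h))" "\<lambda>h q. single (y_mon m (snd h) q) 1"
  by (rule strand_data_A)

text \<open>With base point \<open>(- j d, j)\<close> the piece at parameter \<open>a\<close> has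
  bidegree \<open>(a - j d, j)\<close>, that is, the degree \<open>a\<close> part of the power
  without any shift.\<close>

lemma lin_strand_rees:
  "SR.lin (strand_A.ssc (smult Rees)) p r (strand_A.strand (- int j * int d, int j) rees_homog) \<longleftrightarrow>
    SR.lin (*) p r (J_homog j)"
proof (rule SR.lin_image_iff[where \<phi> = "single j"])
  show "SR.graded_sub (*) (J_homog j)" by (rule graded_sub_J)
  show "single j (a * q) = strand_A.ssc (smult Rees) a (single j q)" for a q
    by (simp add: strand_A.ssc_def rees_module_def rees_map_ren mult_single)
  show "\<forall>g. \<forall>x\<in>J_homog j g. single j x = 0 \<longrightarrow> x = 0"
    by (metis lookup_single_eq lookup_zero)
  show "single j ` J_homog j a = strand_A.strand (- int j * int d, int j) rees_homog a" for a
  proof (intro equalityI subsetI)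
    fix f assume "f \<in> strand_A.strand (- int j * int d, int j) rees_homog a"
    then have f: "f \<in> rees_homog (a - int j * int d, int j)" by (simp add: strand_A.strand_def)
    then show "f \<in> single j ` J_homog j a"
    proof (cases rule: rees_homogE)
      case 1
      then show ?thesis by (intro image_eqI[of _ _ 0]) (simp_all add: J_homog_def J_closed SR.Rg_zero)
    qed (auto simp: J_homog_def)
  qed (auto simp: strand_A.strand_def J_homog_def single_in_rees_homog_iff)
qed (simp add: single_add)

lemma lin_negative_strand_rees:
  assumes "b < 0" shows "SR.lin (strand_A.ssc (smult Rees)) p r (strand_A.strand (a, b) rees_homog)"
proof -
  have "rees_homog (a', b) = {0}" for a' using assms by (auto simp: rees_homog_def)
  then have "strand_A.strand (a, b) rees_homog = (\<lambda>_. {0})" by (simp add: strand_A.strand_def fun_eq_iff)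
  then show ?thesis using SR.lin_zero[OF strand_A.module_ssc[OF module_rees]] by simp
qed

lemma shifts_rees_iff:
  assumes "minimal_chain (A_vars n m) A_wt (smult Rees) rees_homog L s x0 x Z"
  shows "(\<forall>i. \<forall>k<L i. fst (s i k) \<le> int i) \<longleftrightarrow> (\<forall>j p. lin_power j p)"
proof -
  \<comment> \<open>The base points have \<open>x\<close>-degree \<open>- b * d\<close>, so the
    bound \<open>r - \<alpha> g0\<close> for \<open>r = 0\<close> becomes \<open>b * d\<close>, as
    expected of the \<open>b\<close>-th power.\<close>
  define G0 where "G0 = range (\<lambda>b. (- b * int d, b))"
  have G0: "\<exists>g0\<in>G0. \<exists>a. g = g0 + (a, 0)" for g
    by (intro bexI[of _ "(- snd g * int d, snd g)"] exI[of _ "fst g + snd g * int d"])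
      (auto simp: G0_def prod_eq_iff)
  have "(\<forall>i. \<forall>k<L i. fst (s i k) \<le> int i) \<longleftrightarrow>
      (\<forall>p b. SR.lin (strand_A.ssc (smult Rees)) p (b * int d) (strand_A.strand (- b * int d, b) rees_homog))"
    using strand_A.shifts_le_iff_strands_lin[OF assms graded_sub_rees, of G0 0] G0 by (simp add: G0_def)
  also have "\<dots> \<longleftrightarrow> (\<forall>j p. lin_power j p)"
  proof (intro iffI allI)
    fix p j assume "\<forall>p b. SR.lin (strand_A.ssc (smult Rees)) p (b * int d) (strand_A.strand (- b * int d, b) rees_homog)"
    then show "lin_power j p" using lin_strand_rees by blast
  next
    fix p b assume *: "\<forall>j p. lin_power j p"
    show "SR.lin (strand_A.ssc (smult Rees)) p (b * int d) (strand_A.strand (- b * int d, b) rees_homog)"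
    proof (cases "b < 0")
      case False
      then obtain j where "b = int j" by (metis nonneg_int_cases not_less)
      then show ?thesis using * lin_strand_rees[of p _ j] by simp
    qed (rule lin_negative_strand_rees)
  qed
  finally show ?thesis .
qed

lemma shifts_J_iff:
  assumes "minimal_chain {..<n} S_wt (*) (J_homog j) L s x0 x Z"
  shows "(\<forall>i. \<forall>k<L i. s i k \<le> r + int i) \<longleftrightarrow> (\<forall>p. SR.lin (*) p r (J_homog j))"
proof -
  have "strand_S.ssc (*) = (*)" "strand_S.strand 0 (J_homog j) = J_homog j"
    by (simp_all add: strand_S.ssc_def strand_S.strand_def fun_eq_iff)
  then show ?thesis
    using strand_S.shifts_le_iff_strands_lin[OF assms graded_sub_J, of "{0}" r] by simp
qed

end

section \<open>Regularity and linear powers\<close>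

lemma Sup_eq_iff_all_le:
  fixes c :: "'a::complete_linorder"
  assumes "e \<in> X" "c \<le> e"
  shows "Sup X = c \<longleftrightarrow> (\<forall>x\<in>X. x \<le> c)"
proof
  assume "\<forall>x\<in>X. x \<le> c"
  then show "Sup X = c" using assms by (intro antisym Sup_least) (auto intro: Sup_upper2)
qed (auto intro: Sup_upper)

text \<open>One shift already reaches \<open>c\<close>, so the supremum equals \<open>c\<close>
  exactly when \<open>c\<close> is an upper bound.\<close>

lemma Sup_shifts_eq_iff:
  fixes c :: int
  assumes "Q i0 a0" "c \<le> a0 - int i0"
  shows "Sup {ereal (of_int (a - int i)) | i a. Q i a} = ereal (of_int c) \<longleftrightarrow> (\<forall>i a. Q i a \<longrightarrow> a \<le> c + int i)"
proof -
  let ?X = "{ereal (of_int (a - int i)) | i a. Q i a}"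
  have le: "ereal (of_int x) \<le> ereal (of_int y) \<longleftrightarrow> x \<le> y" for x y :: int by simp
  have "ereal (of_int (a0 - int i0)) \<in> ?X" using assms(1) by blast
  then have "Sup ?X = ereal (of_int c) \<longleftrightarrow> (\<forall>x\<in>?X. x \<le> ereal (of_int c))"
    by (rule Sup_eq_iff_all_le) (use assms(2) in \<open>simp only: le\<close>)
  also have "\<dots> \<longleftrightarrow> (\<forall>i a. Q i a \<longrightarrow> ereal (of_int (a - int i)) \<le> ereal (of_int c))" by blast
  also have "\<dots> \<longleftrightarrow> (\<forall>i a. Q i a \<longrightarrow> a \<le> c + int i)"
    unfolding le by (simp add: algebra_simps)
  finally show ?thesis .
qed

text \<open>If \<open>x0 k\<close> vanished, the unit vector at \<open>k\<close> would be a relation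
  with constant coefficient \<open>1\<close>, against minimality.\<close>

lemma minimal_chain_generator_nonzero:
  fixes sc :: "('v, 'k::field) mpoly \<Rightarrow> 'm::ab_group_add \<Rightarrow> 'm" and w :: "'v \<Rightarrow> 'g::ab_group_add"
  assumes chain: "minimal_chain V w sc H L s x0 x Z" and sc: "Modules.module sc" and k: "k < L 0"
  shows "x0 k \<noteq> 0"
proof
  assume "x0 k = 0"
  interpret R: graded_pieces "forms V w :: 'g \<Rightarrow> ('v, 'k) mpoly set"
    by (rule graded_pieces_forms)
  interpret Modules.module sc by (rule sc)
  define e where "e j = (if j = k then 1 else 0 :: ('v, 'k) mpoly)" for j
  have "(\<Sum>j<L 0. sc (e j) (x0 j)) = 0"
    by (rule sum.neutral) (auto simp: e_def \<open>x0 k = 0\<close>)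
  then have "e \<in> R.Syz sc (L 0) (s 0) x0 (s 0 k)"
    using k by (auto simp: R.Syz_def e_def R.Rg_one R.Rg_zero)
  then have "e \<in> Z 0 (s 0 k)" using chain by (simp add: minimal_chain_def)
  then have "lookup (e k) 0 = 0" using chain unfolding minimal_chain_def by blast
  then show False by (simp add: e_def)
qed

context rees begin

lemma rees_homog_low_degree: "f \<in> rees_homog g \<Longrightarrow> fst g < 0 \<Longrightarrow> f = 0"
  by (erule rees_homogE) (use J_low_degree in fastforce)+

lemma reg_rees_iff: "reg_10 n m Rees = 0 \<longleftrightarrow> (\<forall>j p. lin_power j p)"
proof -
  interpret M: graded_module_struct "A_vars n m" A_wt Rees rees_pr by (rule rees_graded_module)
  have fin: "finite (A_vars n m)" by simp
  have fg: "\<exists>l s x. AR.gen (smult Rees) l s x rees_homog" using gen_rees by blast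
  obtain L s x0 x Z where chain: "minimal_chain (A_vars n m) A_wt (smult Rees) rees_homog L s x0 x Z"
    and betti: "\<And>i g. betti (A_vars n m) A_wt Rees i g \<noteq> 0 \<longleftrightarrow> (\<exists>k<L i. s i k = g)"
    using M.betti_minimal_chain[unfolded homog_part_rees, OF fin mdeg_A_eq_0 fg] by blast
  have gen: "AR.gen (smult Rees) (L 0) (s 0) x0 rees_homog"
    using chain by (simp add: minimal_chain_def)
  \<comment> \<open>Since \<open>1\<close> is a nonzero homogeneous element, position
    \<open>0\<close> has a generator. Being nonzero, it has nonnegative \<open>x\<close>-degree and
    bounds the supremum from below.\<close>
  have L0: "0 < L 0"
  proof (rule ccontr)
    assume "\<not> 0 < L 0"
    then have "(1 :: nat \<Rightarrow>\<^sub>0 (nat, 'k) mpoly) = 0" using AR.genD[OF gen rees_homog_1] by simp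
    then show False by simp
  qed
  obtain a b where ab: "s 0 0 = (a, b)" by fastforce
  have "x0 0 \<in> rees_homog (a, b)" using AR.gen_mem[OF gen L0] ab by simp
  then have "a \<ge> 0"
    using rees_homog_low_degree[of "x0 0" "(a, b)"] minimal_chain_generator_nonzero[OF chain module_rees L0] by force
  then have "reg_10 n m Rees = ereal (of_int 0) \<longleftrightarrow>
      (\<forall>i a. (\<exists>b. betti (A_vars n m) A_wt Rees i (a, b) \<noteq> 0) \<longrightarrow> a \<le> 0 + int i)"
    unfolding reg_10_def using betti[of 0 "(a, b)"] L0 ab
    by (intro Sup_shifts_eq_iff[of _ 0 a]) auto
  also have "\<dots> \<longleftrightarrow> (\<forall>i. \<forall>k<L i. fst (s i k) \<le> int i)"
    unfolding betti by (auto, metis fst_conv prod.collapse, metis fst_conv)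
  finally show ?thesis unfolding shifts_rees_iff[OF chain] by (simp add: zero_ereal_def)
qed

text \<open>A nonzero power has a first generator, of degree at least \<open>j * d\<close>, which
  supplies the lower bound; for the zero ideal the supremum would be
  \<open>-\<infinity>\<close>.\<close>

lemma reg_power_iff:
  assumes "J j \<noteq> {0}"
  shows "cm_reg n (ideal_mod j) = ereal (of_nat (j * d)) \<longleftrightarrow> (\<forall>p. lin_power j p)"
proof -
  interpret M: graded_module_struct "{..<n}" S_wt "ideal_mod j" "hcomp S_wt" by (rule J_graded_module)
  have fin: "finite {..<n}" by simp
  obtain L s x0 x Z where chain: "minimal_chain {..<n} S_wt (*) (J_homog j) L s x0 x Z"
    and betti: "\<And>i g. betti {..<n} S_wt (ideal_mod j) i g \<noteq> 0 \<longleftrightarrow> (\<exists>k<L i. s i k = g)"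
    using M.betti_minimal_chain[unfolded homog_part_ideal_module smult_ideal_module, OF fin mdeg_S_eq_0 fg_J]
    by blast
  have gen: "SR.gen (*) (L 0) (s 0) x0 (J_homog j)"
    using chain by (simp add: minimal_chain_def)
  obtain q where q: "q \<in> J j" "q \<noteq> 0" using assms J_closed(2) by blast
  have L0: "0 < L 0"
  proof (rule ccontr)
    assume L0: "\<not> 0 < L 0"
    have "hcomp S_wt g q = 0" for g
    proof -
      have "q \<in> carrier S" using q(1) J_closed(1) by blast
      then have "hcomp S_wt g q \<in> J_homog j g"
        using J_hcomp[OF q(1)] hcomp_forms by (simp add: J_homog_def)
      then show ?thesis using SR.genD[OF gen] L0 by fastforce
    qed
    then have "q = 0" using hcomp_sum_superset[of "mdeg S_wt ` keys q" S_wt q] by simp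
    with q(2) show False by simp
  qed
  have "x0 0 \<in> J_homog j (s 0 0)" by (rule SR.gen_mem[OF gen L0])
  then have "s 0 0 \<ge> int j * int d"
    using J_low_degree[of "x0 0" j "s 0 0"] minimal_chain_generator_nonzero[OF chain module_times L0]
    by (force simp: J_homog_def)
  then have "cm_reg n (ideal_mod j) = ereal (of_int (int j * int d)) \<longleftrightarrow>
      (\<forall>i a. betti {..<n} S_wt (ideal_mod j) i a \<noteq> 0 \<longrightarrow> a \<le> int j * int d + int i)"
    unfolding cm_reg_def using betti[of 0 "s 0 0"] L0
    by (intro Sup_shifts_eq_iff[of _ 0 "s 0 0"]) auto
  also have "\<dots> \<longleftrightarrow> (\<forall>i. \<forall>k<L i. s i k \<le> int j * int d + int i)"
    unfolding betti by blast
  finally show ?thesis unfolding shifts_J_iff[OF chain] by simp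
qed

text \<open>The zeroth power is \<open>S\<close>, free on \<open>1\<close> in degree
  \<open>0\<close>. It occurs among the strands of the Rees algebra, whereas
  \<open>linear_powers\<close> starts at exponent \<open>1\<close>.\<close>

lemma lin_J_0: "SR.lin (*) p 0 (J_homog 0)"
proof (cases p)
  case (Suc p')
  have J0: "J_homog 0 = SF" using forms_carrier by (auto simp: J_homog_def J_0 fun_eq_iff)
  show ?thesis unfolding Suc J0
  proof (rule SR.linI[of "(*)" "Suc 0" "\<lambda>_. 0" "\<lambda>_. 1"])
    have "SR.Syz (*) (Suc 0) (\<lambda>_. 0) (\<lambda>_. 1) = (\<lambda>_. {0})"
      by (auto simp: SR.Syz_def fun_eq_iff SR.Rg_zero) (metis less_Suc0 not_less)
    then show "SR.lin vscale p' (0 + 1) (SR.Syz (*) (Suc 0) (\<lambda>_. 0) (\<lambda>_. 1))"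
      by (simp only: SR.lin_zero[OF module_vscale])
    show "SR.gen (*) (Suc 0) (\<lambda>_. 0) (\<lambda>_. 1) SF"
    proof (rule SR.genI)
      fix g y assume "y \<in> SF g"
      then show "\<exists>c. (\<forall>k<Suc 0. c k \<in> SF (g - 0)) \<and> y = (\<Sum>k<Suc 0. c k * 1)"
        by (intro exI[of _ "\<lambda>_. y"]) simp
    qed (simp add: SR.Rg_one)
  qed simp
qed (simp add: SR.lin_0)

lemma J_eq_0:
  assumes "I = {0}" "j \<ge> 1" shows "J j = {0}"
proof -
  obtain i where j: "j = Suc i" using assms(2) by (cases j) auto
  have "q = 0" if "q \<in> J j" for q
    using that unfolding j J_Suc by induction (auto simp: assms(1))
  then show ?thesis using J_closed(2)[of j] by auto
qed

lemma J_1: "J 1 = I"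
  unfolding One_nat_def J_Suc
proof
  show "ideal_prod S (J 0) I \<subseteq> I"
  proof
    fix q assume "q \<in> ideal_prod S (J 0) I"
    then show "q \<in> I"
      using ideal_I[unfolded ideal_poly_ring_iff] by induction (auto simp: J_0)
  qed
  show "I \<subseteq> ideal_prod S (J 0) I"
  proof
    fix q assume "q \<in> I"
    then show "q \<in> ideal_prod S (J 0) I" using ideal_prod.prod[of 1 "J 0" q I S] by (simp add: J_0)
  qed
qed

text \<open>The polynomial ring is a domain, so the powers of a nonzero \<open>f\<close> in
  \<open>I\<close> are nonzero.\<close>

lemma J_neq_0:
  assumes "I \<noteq> {0}" shows "J j \<noteq> {0}"
proof -
  obtain f where f: "f \<in> J 1" "f \<noteq> 0" using assms J_closed(2)[of 1] unfolding J_1 by blast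
  have "f ^ j \<in> J j"
  proof (induction j)
    case 0
    show ?case by (simp add: J_0)
  next
    case (Suc j)
    then show ?case using J_mult[OF f(1) Suc] by simp
  qed
  moreover have "f ^ j \<noteq> 0" using f(2) by simp
  ultimately show ?thesis by blast
qed

text \<open>A generating proper subset would have fewer than \<open>min_num_gens\<close> elements.
  This supplies a system to which the quantifier over generating systems in
  \<open>linear_powers\<close> can be applied.\<close>

lemma fs_min_homog_gens:
  assumes "m = min_num_gens S I"
  shows "min_homog_gens n I (set fs)"
  unfolding min_homog_gens_def
proof (intro conjI allI impI notI)
  fix H assume H: "H \<subset> set fs" and IH: "I = Idl\<^bsub>S\<^esub> H"
  have fin: "finite H" using H finite_subset by auto
  then have "min_num_gens S I \<le> card H"
    unfolding min_num_gens_def using H fs_carrier IH by (intro Least_le exI[of _ H]) auto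
  also have "\<dots> < card (set fs)" by (rule psubset_card_mono[OF _ H]) simp
  also have "\<dots> \<le> m" by (rule card_length)
  finally show False using assms by simp
qed (use fs I in auto)

lemma fs_nonzero:
  assumes "I \<noteq> {0}" shows "\<exists>f\<in>set fs. f \<noteq> 0"
proof (rule ccontr)
  assume "\<not> ?thesis"
  then have "set fs \<subseteq> {0}" by blast
  moreover have "ideal {0} S" by (simp add: ideal_poly_ring_iff)
  ultimately have "I \<subseteq> {0}" unfolding I by (intro ring.genideal_minimal[OF ring_poly_ring])
  moreover have "0 \<in> I" using ideal_I[unfolded ideal_poly_ring_iff] by blast
  ultimately show False using assms by blast
qed

text \<open>\<open>I\<close> has no nonzero elements in degrees below \<open>d\<close>, so in degree
  \<open>d\<close> only the constant part of \<open>p\<close> can contribute.\<close>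

lemma hcomp_mult_lowest:
  assumes p: "p \<in> carrier S" and q: "q \<in> I"
  shows "hcomp S_wt (int d) (p * q) = hcomp S_wt 0 p * hcomp S_wt (int d) q"
proof -
  let ?h = "hcomp S_wt :: int \<Rightarrow> (nat, 'k) mpoly \<Rightarrow> (nat, 'k) mpoly"
  interpret h: additive "?h e" for e by unfold_locales (rule hcomp_add)
  let ?P = "insert 0 (mdeg S_wt ` keys p)" and ?Q = "insert (int d) (mdeg S_wt ` keys q)"
  have qS: "q \<in> carrier S" using q J_closed(1)[of 1] J_1 by blast
  have ph: "?h a p \<in> SF a" and qh: "?h b q \<in> SF b" for a b
    using hcomp_forms p qS by blast+
  have eP: "(\<Sum>a\<in>?P. ?h a p) = p" and eQ: "(\<Sum>b\<in>?Q. ?h b q) = q"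
    by (rule hcomp_sum_superset; auto)+
  have term_eq: "?h (int d) (?h a p * ?h b q) = (if a = 0 then if b = int d then ?h 0 p * ?h (int d) q else 0 else 0)"
    if "a \<in> ?P" for a b
  proof (cases "b < int d")
    case True
    have "?h b q \<in> J 1" using J_hcomp[of q 1 b] q J_1 by simp
    then have "?h b q = 0" using J_low_degree[OF _ qh] True by simp
    then show ?thesis using True by (simp add: hcomp_zero)
  next
    case False
    have "a \<ge> 0" using that mdeg_S_nonneg by auto
    have "?h a p * ?h b q \<in> SF (a + b)" by (rule SR.Rg_mult[OF ph qh])
    from hcomp_form[OF this, of "int d"] show ?thesis using False \<open>a \<ge> 0\<close> by auto
  qed
  have "?h (int d) (p * q) = ?h (int d) (\<Sum>a\<in>?P. \<Sum>b\<in>?Q. ?h a p * ?h b q)"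
    by (simp only: eP eQ sum_product[symmetric])
  also have "\<dots> = (\<Sum>a\<in>?P. \<Sum>b\<in>?Q. ?h (int d) (?h a p * ?h b q))" by (simp only: h.sum)
  also have "\<dots> = (\<Sum>a\<in>?P. \<Sum>b\<in>?Q. if a = 0 then if b = int d then ?h 0 p * ?h (int d) q else 0 else 0)"
    by (intro sum.cong refl term_eq)
  also have "\<dots> = (\<Sum>a\<in>?P. if a = 0 then ?h 0 p * ?h (int d) q else 0)"
    by (intro sum.cong refl) simp
  also have "\<dots> = ?h 0 p * ?h (int d) q" by simp
  finally show ?thesis .
qed

text \<open>The part of \<open>G\<close> in degree \<open>d\<close> already generates \<open>I\<close>: the elements of \<open>I\<close> whose component of
  degree \<open>d\<close> lies in the ideal it generates form an ideal containing \<open>G\<close>.\<close>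

lemma min_homog_gens_degree:
  assumes "min_homog_gens n I G"
  shows "G \<subseteq> SF (int d)"
proof -
  have G: "G \<subseteq> (\<Union>a. SF a)" "I = Idl\<^bsub>S\<^esub> G" and min: "\<And>H. H \<subset> G \<Longrightarrow> I \<noteq> Idl\<^bsub>S\<^esub> H"
    using assms unfolding min_homog_gens_def by blast+
  have GS: "G \<subseteq> carrier S" using G(1) forms_carrier by blast
  define G' where "G' = G \<inter> SF (int d)"
  have G'S: "G' \<subseteq> carrier S" using GS by (auto simp: G'_def)
  have idG': "ideal (Idl\<^bsub>S\<^esub> G') S" by (rule ring.genideal_ideal[OF ring_poly_ring G'S])
  note i' = idG'[unfolded ideal_poly_ring_iff] and i = ideal_I[unfolded ideal_poly_ring_iff]
  have self: "G \<subseteq> I" unfolding G(2) by (rule ring.genideal_self[OF ring_poly_ring GS])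
  have self': "G' \<subseteq> Idl\<^bsub>S\<^esub> G'" by (rule ring.genideal_self[OF ring_poly_ring G'S])
  define Y where "Y = {x \<in> I. hcomp S_wt (int d) x \<in> Idl\<^bsub>S\<^esub> G'}"
  have "ideal Y S" unfolding ideal_poly_ring_iff
  proof (intro conjI ballI)
    show "Y \<subseteq> carrier S" using i by (auto simp: Y_def)
    show "0 \<in> Y" using i i' by (simp add: Y_def hcomp_zero)
    show "p + q \<in> Y" if "p \<in> Y" "q \<in> Y" for p q
      using that i i' by (auto simp: Y_def hcomp_add)
    show "p * q \<in> Y" if p: "p \<in> carrier S" and q: "q \<in> Y" for p q
    proof -
      have "hcomp S_wt 0 p \<in> carrier S" by (rule forms_carrier[OF hcomp_forms[OF p]])
      then show ?thesis using p q i i' by (auto simp: Y_def hcomp_mult_lowest)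
    qed
  qed
  moreover have "G \<subseteq> Y"
  proof
    fix g assume g: "g \<in> G"
    then obtain a where a: "g \<in> SF a" using G(1) by blast
    show "g \<in> Y"
    proof (cases "a = int d")
      case True
      then have "g \<in> G'" using g a by (simp add: G'_def)
      then show ?thesis using hcomp_form[OF a, of "int d"] True self self' g by (auto simp: Y_def)
    next
      case False
      then show ?thesis using hcomp_form[OF a, of "int d"] self g i' by (auto simp: Y_def)
    qed
  qed
  ultimately have "I \<subseteq> Y" unfolding G(2) by (rule ring.genideal_minimal[OF ring_poly_ring])
  \<comment> \<open>Each \<open>f\<close> is its own component of degree \<open>d\<close>, so
    membership in \<open>Y\<close> puts it into the ideal generated by \<open>G'\<close>.\<close>
  have "set fs \<subseteq> Idl\<^bsub>S\<^esub> G'"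
  proof
    fix f assume f: "f \<in> set fs"
    then have "f \<in> I" using fs_J J_1 by blast
    with \<open>I \<subseteq> Y\<close> have "hcomp S_wt (int d) f \<in> Idl\<^bsub>S\<^esub> G'" by (auto simp: Y_def)
    moreover have "f \<in> SF (int d)" using f fs by blast
    ultimately show "f \<in> Idl\<^bsub>S\<^esub> G'" using hcomp_form[of f "{..<n}" S_wt "int d" "int d"] by simp
  qed
  then have "I \<subseteq> Idl\<^bsub>S\<^esub> G'" unfolding I by (rule ring.genideal_minimal[OF ring_poly_ring idG'])
  moreover have "Idl\<^bsub>S\<^esub> G' \<subseteq> I"
    by (rule ring.genideal_minimal[OF ring_poly_ring ideal_I]) (use self in \<open>auto simp: G'_def\<close>)
  ultimately have "I = Idl\<^bsub>S\<^esub> G'" by blast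
  then have "G' = G" using min[of G'] unfolding G'_def by blast
  then show ?thesis unfolding G'_def by blast
qed

lemma linear_powers_iff:
  assumes "m = min_num_gens S I"
  shows "linear_powers n I \<longleftrightarrow> (\<forall>j p. lin_power j p)"
proof (cases "I = {0}")
  case True
  have "lin_power j p" for j p
  proof (cases "j = 0")
    case False
    then have "J_homog j = (\<lambda>_. {0})"
      using J_eq_0[OF True, of j] SR.Rg_zero by (auto simp: J_homog_def fun_eq_iff)
    then show ?thesis by (simp only: SR.lin_zero[OF module_times])
  qed (use lin_J_0 in simp)
  then show ?thesis using True by (simp add: linear_powers_def)
next
  case False
  have reg: "cm_reg n (ideal_mod j) = ereal (of_nat (j * d)) \<longleftrightarrow> (\<forall>p. lin_power j p)" for j
    by (rule reg_power_iff[OF J_neq_0[OF False]])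
  have all: "(\<forall>j\<ge>1. cm_reg n (ideal_mod j) = ereal (of_nat (j * d))) \<longleftrightarrow>
      (\<forall>j p. lin_power j p)"
  proof -
    have "SR.lin (*) p (int 0 * int d) (J_homog 0)" for p using lin_J_0 by simp
    then show ?thesis unfolding reg by (metis One_nat_def Suc_leI neq0_conv)
  qed
  \<comment> \<open>The degree in \<open>linear_powers\<close> is existentially quantified; a
    nonzero element of \<open>fs\<close> lies in both degrees and forces
    \<open>d' = d\<close>.\<close>
  have "d' = d" if "\<forall>G. min_homog_gens n I G \<longrightarrow> G \<subseteq> SF (int d')" for d' :: nat
  proof -
    obtain f where f: "f \<in> set fs" "f \<noteq> 0" using fs_nonzero[OF False] by blast
    have "f \<in> SF (int d')" using that fs_min_homog_gens[OF assms] f(1) by blast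
    moreover have "f \<in> SF (int d)" using f(1) fs by blast
    ultimately show ?thesis
      using hcomp_form[of f "{..<n}" S_wt "int d'" "int d"] hcomp_form[of f "{..<n}" S_wt "int d" "int d"] f(2)
      by (auto split: if_splits)
  qed
  then show ?thesis
    unfolding linear_powers_def all[symmetric] using False min_homog_gens_degree by blast
qed

end

theorem theorem2p5:
  fixes n d :: nat
    and I :: "(nat, 'k::field) mpoly set"
    and fs :: "(nat, 'k) mpoly list"
  assumes "infinite (UNIV :: 'k set)"
    and "homogeneous_ideal n I"
    and "\<exists>G. G \<subseteq> forms (S_vars n) S_wt (int d) \<and> I = Idl\<^bsub>S_ring n\<^esub> G"
    and "set fs \<subseteq> forms (S_vars n) S_wt (int d)"
    and "I = Idl\<^bsub>S_ring n\<^esub> (set fs)"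
    and "length fs = min_num_gens (S_ring n) I"
  shows "linear_powers n I \<longleftrightarrow> reg_10 n (length fs) (rees_module n d I fs) = 0"
proof -
  interpret rees n d I fs
    by unfold_locales (rule assms(4), rule assms(5))
  show ?thesis
    unfolding reg_rees_iff by (rule linear_powers_iff[OF assms(6)])
qed

end
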